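(* The estimator $\check G_n$ (defined in the context) is consistent, in the total variation distance, for $G_{n,\theta,\sigma}$ and for $G_{\infty,\theta,\sigma}$. That is, for every $\delta>0$, $$P_{n,\theta,\sigma}\left(\left\|\check G_n-G_{n,\theta,\sigma}\right\|_{TV}>\delta\right)\xrightarrow{n\to\infty}0\qquad\text{and}\qquad P_{n,\theta,\sigma}\left(\left\|\check G_n-G_{\infty,\theta,\sigma}\right\|_{TV}>\delta\right)\xrightarrow{n\to\infty}0$$ for all $\theta\in\mathbb{R}^P$ and all $\sigma>0$.
   Context: Model. Fix integers $P\ge1$ and $0\le\mathcal{O}<P$. For each sample size $n>P$ one observes $Y=X\theta+u$, where $X$ is a non-stochastic $n\times P$ matrix of rank $P$ (its elements may depend on $n$), $\theta\in\mathbb{R}^P$, and $u\sim N(0,\sigma^2I_n)$ with $0<\sigma<\infty$. $P_{n,\theta,\sigma}$ is the distribution of the sample $Y$ of size $n$. It is assumed that $Q=\lim_{n\to\infty}X'X/n$ exists and is non-singular. The total variation distance of two cdfs on $\mathbb{R}^k$ (identified with the measures they induce) is $\|G-G^\ast\|_{TV}=\sup_E|G(E)-G^\ast(E)|$ over Borel sets $E$. Notation. For a matrix $D$ with $P$ columns, $D[p]$ is the matrix of its first $p$ columns; $Q[p:p]$ is the upper-left $p\times p$ block of $Q$. For $0\le p\le P$, $M_p=\{\theta\in\mathbb{R}^P:\theta_{p+1}=\dots=\theta_P=0\}$, and $p_0(\theta)=\min\{p:0\le p\le P,\ \theta\in M_p\}$. $\tilde\theta(p)\in\mathbb{R}^P$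 has first $p$ components $(X[p]'X[p])^{-1}X[p]'Y$ and remaining components $0$ (so $\tilde\theta(0)=0$); $\tilde\theta_p(p)$ is its $p$-th component. Model selection. $\hat\sigma^2=(n-P)^{-1}\|Y-X\tilde\theta(P)\|^2$, $\hat\sigma\ge0$; for $0<p\le P$, $\xi_{n,p}=\left([(X[p]'X[p]/n)^{-1}]_{p,p}\right)^{1/2}$ and $T_p=\sqrt n\,\tilde\theta_p(p)/(\hat\sigma\xi_{n,p})$; $T_0=0$. Critical values: $c_{\mathcal{O}}=0$ and $0<c_p<\infty$ for $\mathcal{O}<p\le P$, independent of $n$. $\hat p=\max\{p:\mathcal{O}\le p\le P,\ |T_p|\ge c_p\}$ and $\tilde\theta=\sum_{p=\mathcal{O}}^P\tilde\theta(p)\mathbf{1}(\hat p=p)$. Target. $A$ is a non-stochastic $k\times P$ matrix of rank $k$, $1\le k\le P$, and $G_{n,\theta,\sigma}(t)=P_{n,\theta,\sigma}\left(\sqrt nA(\tilde\theta-\theta)\le t\right)$, $t\in\mathbb{R}^k$ (componentwise inequality). Further quantities. $e_p$ is the $p$-th standard basis vector of $\mathbb{R}^p$ and $B^-$ denotes a generalized inverse of $B$ (the choice is immaterial below). For $1\le p\le P$ let $C_n^{(p)}=A[p](X[p]'X[p]/n)^{-1}e_p$, $b_{n,p}=C_n^{(p)\prime}\left(A[p](X[p]'X[p]/n)^{-1}A[p]'\right)^-$, $\zeta_{n,p}^2=\xi_{n,p}^2-b_{n,p}C_n^{(p)}$, $\zeta_{n,p}\ge0$; and $C_\infty^{(p)}=A[p]Q[p:p]^{-1}e_p$,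 $b_{\infty,p}=C_\infty^{(p)\prime}\left(A[p]Q[p:p]^{-1}A[p]'\right)^-$, $\xi_{\infty,p}^2=(Q[p:p]^{-1})_{p,p}$, $\zeta_{\infty,p}^2=\xi_{\infty,p}^2-b_{\infty,p}C_\infty^{(p)}$, $\xi_{\infty,p},\zeta_{\infty,p}\ge0$. $\Phi_{\infty,p}$ is the cdf of $N\left(0,\sigma^2A[p]Q[p:p]^{-1}A[p]'\right)$ on $\mathbb{R}^k$ for $p>0$, and of point mass at $0\in\mathbb{R}^k$ for $p=0$. $\hat\Phi_{n,p}$ is the cdf of $N\left(0,\hat\sigma^2A[p](X[p]'X[p]/n)^{-1}A[p]'\right)$ for $p>0$, and of point mass at $0$ if $p=0$ or $\hat\sigma=0$. For $s\ge0$, $\Delta_s(a,b)=\mathbb{P}(|\mathfrak{N}-a|<b)$ with $\mathfrak{N}\sim N(0,s^2)$ ($\mathfrak{N}=0$ if $s=0$). Asymptotic cdf. With $p_\ast=\max\{p_0(\theta),\mathcal{O}\}$, $$G_{\infty,\theta,\sigma}(t)=\Phi_{\infty,p_\ast}(t)\prod_{q=p_\ast+1}^P\Delta_{\sigma\xi_{\infty,q}}(0,c_q\sigma\xi_{\infty,q})+\sum_{p=p_\ast+1}^P\int_{z\le t}\left(1-\Delta_{\sigma\zeta_{\infty,p}}(b_{\infty,p}z,c_p\sigma\xi_{\infty,p})\right)\Phi_{\infty,p}(dz)\prod_{q=p+1}^P\Delta_{\sigma\xi_{\infty,q}}(0,c_q\sigma\xi_{\infty,q}).$$ The estimator. Let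 $\bar p=\bar p(Y,X)\in\{0,\dots,P\}$ be an auxiliary procedure that consistently estimates $p_0(\theta)$, i.e. $P_{n,\theta,\sigma}(\bar p=p_0(\theta))\to1$ for all $\theta\in\mathbb{R}^P$, $\sigma>0$. Then $\check G_n(t)$ is the expression for $G_{\infty,\theta,\sigma}(t)$ just displayed with $p_\ast,\sigma,b_{\infty,p},\zeta_{\infty,p},\xi_{\infty,p},\Phi_{\infty,p}$ replaced by $\max\{\bar p,\mathcal{O}\},\hat\sigma,b_{n,p},\zeta_{n,p},\xi_{n,p},\hat\Phi_{n,p}$, respectively; it is a cdf. *)

theory Defs
  imports "HOL-Probability.Probability" "Jordan_Normal_Form.DL_Rank"
    "Jordan_Normal_Form.Gauss_Jordan_Elimination"
begin

unbundle no vec_syntax and no inner_syntax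
hide_type (open) Finite_Cartesian_Product.vec
hide_const (open) Finite_Cartesian_Product.vec

text \<open>
  Vectors and matrices are those of \<^theory>\<open>Jordan_Normal_Form.Matrix\<close>, because the sample size and
  the order of the model both vary. Entries are indexed from 0, so that the \<open>p\<close>-th component of a
  vector has index \<open>p - 1\<close>.
\<close>


section \<open>Matrices\<close>

definition first_cols :: "nat \<Rightarrow> real mat \<Rightarrow> real mat" where
  "first_cols p D = mat (dim_row D) p (\<lambda>(i, j). D $$ (i, j))"

definition lead_block :: "nat \<Rightarrow> real mat \<Rightarrow> real mat" where
  "lead_block p Q = mat p p (\<lambda>(i, j). Q $$ (i, j))"

text \<open>Only meaningful for invertible matrices.\<close>

definition minv :: "real mat \<Rightarrow> real mat" where
  "minv B = the (mat_inverse B)"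

definition ginv :: "real mat \<Rightarrow> real mat" where
  "ginv B = (SOME B'. B' \<in> carrier_mat (dim_col B) (dim_row B) \<and> B * B' * B = B)"


section \<open>Distributions on Euclidean space\<close>

text \<open>
  The Borel sigma-algebra of \<open>R\<^sup>m\<close> is the one generated by the coordinate functions.
\<close>

definition borel_vec :: "nat \<Rightarrow> real vec measure" where
  "borel_vec m = vimage_algebra (carrier_vec m) (\<lambda>v. \<lambda>i\<in>{..<m}. v $ i) (\<Pi>\<^sub>M i\<in>{..<m}. borel)"

definition std_gauss :: "nat \<Rightarrow> real vec measure" where
  "std_gauss m = distr (\<Pi>\<^sub>M i\<in>{..<m}. density lborel std_normal_density) (borel_vec m) (vec m)"

text \<open>
  \<open>N(0, \<Sigma>)\<close>, with \<open>\<Sigma>\<close> possibly singular: the law of \<open>L Z\<close> with \<open>Z\<close> standard normal and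
  \<open>L L' = \<Sigma>\<close>. It does not depend on the factorization.
\<close>

definition gauss :: "nat \<Rightarrow> real mat \<Rightarrow> real vec measure" where
  "gauss k \<Sigma> = (SOME M. \<exists>m. \<exists>L \<in> carrier_mat k m.
     L * L\<^sup>T = \<Sigma> \<and> M = distr (std_gauss m) (borel_vec k) (\<lambda>z. L *\<^sub>v z))"

text \<open>\<open>cdf_measure k G\<close> is the measure induced by a cdf \<open>G\<close> on \<open>R\<^sup>k\<close>; the order on vectors is
  componentwise.\<close>

definition cdf_measure :: "nat \<Rightarrow> (real vec \<Rightarrow> real) \<Rightarrow> real vec measure" where
  "cdf_measure k G = (THE M. finite_measure M \<and> sets M = sets (borel_vec k) \<and>
     (\<forall>t \<in> carrier_vec k. measure M {z \<in> carrier_vec k. z \<le> t} = G t))"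

definition tv_dist :: "nat \<Rightarrow> (real vec \<Rightarrow> real) \<Rightarrow> (real vec \<Rightarrow> real) \<Rightarrow> real" where
  "tv_dist k G H =
     (SUP E \<in> sets (borel_vec k). \<bar>measure (cdf_measure k G) E - measure (cdf_measure k H) E\<bar>)"

text \<open>\<open>Delta s a b\<close> is the probability of \<open>\<bar>N - a\<bar> < b\<close> for \<open>N\<close> distributed as \<open>N(0, s\<^sup>2)\<close>.\<close>

definition Delta :: "real \<Rightarrow> real \<Rightarrow> real \<Rightarrow> real" where
  "Delta s a b = measure (if s = 0 then return borel 0 else density lborel (normal_density 0 s))
     {x. \<bar>x - a\<bar> < b}"


section \<open>The model and the post-model-selection estimator\<close>

text \<open>
  Throughout, \<open>X\<close> is the \<open>n \<times> P\<close> regressor matrix for one sample size \<open>n\<close>; thus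
  \<open>n = dim_row X\<close> and \<open>P = dim_col X\<close>. Likewise \<open>k = dim_row A\<close>.
  The order of the smallest candidate model, usually written with a script O, is \<open>p_min\<close>. The
  estimated error variance is positive almost surely for \<open>n > P\<close>, so the value of \<open>T_stat\<close> where
  it vanishes is immaterial.
\<close>

definition sample_dist :: "real mat \<Rightarrow> real vec \<Rightarrow> real \<Rightarrow> real vec measure" where
  "sample_dist X \<theta> \<sigma> = (let n = dim_row X in
     distr (gauss n (\<sigma>\<^sup>2 \<cdot>\<^sub>m 1\<^sub>m n)) (borel_vec n) (\<lambda>u. X *\<^sub>v \<theta> + u))"

definition p0 :: "nat \<Rightarrow> real vec \<Rightarrow> nat" where
  "p0 P \<theta> = (LEAST p. p \<le> P \<and> (\<forall>i. p \<le> i \<and> i < P \<longrightarrow> \<theta> $ i = 0))"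

definition theta_restr :: "real mat \<Rightarrow> real vec \<Rightarrow> nat \<Rightarrow> real vec" where
  "theta_restr X Y p = (let Xp = first_cols p X; v = minv (Xp\<^sup>T * Xp) *\<^sub>v (Xp\<^sup>T *\<^sub>v Y)
     in vec (dim_col X) (\<lambda>i. if i < p then v $ i else 0))"

definition sigma_hat :: "real mat \<Rightarrow> real vec \<Rightarrow> real" where
  "sigma_hat X Y = (let r = Y - X *\<^sub>v theta_restr X Y (dim_col X)
     in sqrt ((r \<bullet> r) / (real (dim_row X) - real (dim_col X))))"

definition gram :: "real mat \<Rightarrow> nat \<Rightarrow> real mat" where
  "gram X p = (1 / real (dim_row X)) \<cdot>\<^sub>m ((first_cols p X)\<^sup>T * first_cols p X)"

text \<open>
  The finite-sample quantities \<open>\<xi>\<^sub>n\<close>, \<open>C\<^sub>n\<close>, \<open>b\<^sub>n\<close>, \<open>\<zeta>\<^sub>n\<close> and their limits are given by the same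
  formulas, with \<open>S p\<close> equal to \<open>gram X p\<close> and \<open>lead_block p Q\<close>, respectively. The row vector
  \<open>b = C' B\<^sup>-\<close> is represented by the vector of its entries.
\<close>

definition xi :: "(nat \<Rightarrow> real mat) \<Rightarrow> nat \<Rightarrow> real" where
  "xi S p = sqrt (minv (S p) $$ (p - 1, p - 1))"

definition Cvec :: "real mat \<Rightarrow> (nat \<Rightarrow> real mat) \<Rightarrow> nat \<Rightarrow> real vec" where
  "Cvec A S p = first_cols p A *\<^sub>v (minv (S p) *\<^sub>v unit_vec p (p - 1))"

definition avar :: "real mat \<Rightarrow> (nat \<Rightarrow> real mat) \<Rightarrow> nat \<Rightarrow> real mat" where
  "avar A S p = first_cols p A * minv (S p) * (first_cols p A)\<^sup>T"

definition bvec :: "real mat \<Rightarrow> (nat \<Rightarrow> real mat) \<Rightarrow> nat \<Rightarrow> real vec" where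
  "bvec A S p = (ginv (avar A S p))\<^sup>T *\<^sub>v Cvec A S p"

definition zeta :: "real mat \<Rightarrow> (nat \<Rightarrow> real mat) \<Rightarrow> nat \<Rightarrow> real" where
  "zeta A S p = sqrt ((xi S p)\<^sup>2 - bvec A S p \<bullet> Cvec A S p)"

text \<open>
  With \<open>s = \<sigma>\<close> and the limit quantities this is \<open>\<Phi>\<close> with index \<open>\<infinity>,p\<close>; with \<open>s\<close> the estimated
  standard deviation and the finite-sample quantities it is its estimated version.
\<close>

definition Phi :: "real mat \<Rightarrow> (nat \<Rightarrow> real mat) \<Rightarrow> real \<Rightarrow> nat \<Rightarrow> real vec measure" where
  "Phi A S s p = (let k = dim_row A in
     if p = 0 \<or> s = 0 then return (borel_vec k) (0\<^sub>v k) else gauss k (s\<^sup>2 \<cdot>\<^sub>m avar A S p))"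

definition T_stat :: "real mat \<Rightarrow> real vec \<Rightarrow> nat \<Rightarrow> real" where
  "T_stat X Y p = (if p = 0 then 0 else
     sqrt (real (dim_row X)) * theta_restr X Y p $ (p - 1) / (sigma_hat X Y * xi (gram X) p))"

definition p_hat :: "nat \<Rightarrow> (nat \<Rightarrow> real) \<Rightarrow> real mat \<Rightarrow> real vec \<Rightarrow> nat" where
  "p_hat p_min c X Y = Max {p. p_min \<le> p \<and> p \<le> dim_col X \<and> \<bar>T_stat X Y p\<bar> \<ge> c p}"

definition theta_post :: "nat \<Rightarrow> (nat \<Rightarrow> real) \<Rightarrow> real mat \<Rightarrow> real vec \<Rightarrow> real vec" where
  "theta_post p_min c X Y = theta_restr X Y (p_hat p_min c X Y)"

definition G_fin ::
    "nat \<Rightarrow> (nat \<Rightarrow> real) \<Rightarrow> real mat \<Rightarrow> real mat \<Rightarrow> real vec \<Rightarrow> real \<Rightarrow> real vec \<Rightarrow> real" where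
  "G_fin p_min c A X \<theta> \<sigma> t = measure (sample_dist X \<theta> \<sigma>)
     {Y \<in> space (sample_dist X \<theta> \<sigma>).
        sqrt (real (dim_row X)) \<cdot>\<^sub>v (A *\<^sub>v (theta_post p_min c X Y - \<theta>)) \<le> t}"


section \<open>The asymptotic cdf and its estimator\<close>

text \<open>The expression for the asymptotic cdf, as a function of the quantities in which the
  asymptotic cdf and its estimator differ: \<open>r\<close> stands for \<open>p\<^sub>*\<close> and \<open>s\<close> for \<open>\<sigma>\<close>.\<close>

definition G_expr ::
    "(nat \<Rightarrow> real) \<Rightarrow> real mat \<Rightarrow> (nat \<Rightarrow> real mat) \<Rightarrow> real \<Rightarrow> nat \<Rightarrow> real vec \<Rightarrow> real" where
  "G_expr c A S s r t = (let
       P = dim_col A;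
       lower = {z \<in> carrier_vec (dim_row A). z \<le> t};
       D = (\<lambda>q. Delta (s * xi S q) 0 (c q * s * xi S q))
     in measure (Phi A S s r) lower * (\<Prod>q = r + 1..P. D q)
        + (\<Sum>p = r + 1..P.
            (LINT z:lower|Phi A S s p.
               1 - Delta (s * zeta A S p) (bvec A S p \<bullet> z) (c p * s * xi S p))
            * (\<Prod>q = p + 1..P. D q)))"

definition G_inf ::
    "nat \<Rightarrow> (nat \<Rightarrow> real) \<Rightarrow> real mat \<Rightarrow> real mat \<Rightarrow> real vec \<Rightarrow> real \<Rightarrow> real vec \<Rightarrow> real" where
  "G_inf p_min c A Q \<theta> \<sigma> =
     G_expr c A (\<lambda>p. lead_block p Q) \<sigma> (max (p0 (dim_row Q) \<theta>) p_min)"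

definition G_check ::
    "nat \<Rightarrow> (nat \<Rightarrow> real) \<Rightarrow> real mat \<Rightarrow> (real vec \<Rightarrow> real mat \<Rightarrow> nat) \<Rightarrow> real mat \<Rightarrow> real vec
      \<Rightarrow> real vec \<Rightarrow> real" where
  "G_check p_min c A pbar X Y =
     G_expr c A (gram X) (sigma_hat X Y) (max (pbar Y X) p_min)"

end

theory Submission
  imports Defs
begin

text \<open>
  The whole statement reduces to one vector \<open>W\<close> of independent standard normal coordinates. Let \<open>R\<close> be
  the normalized Gram matrix \<open>X'X/n\<close>. Then \<open>R\<^sup>-\<^sup>1 = V V'\<close> for an upper triangular \<open>V\<close> whose columns come from
  the last columns of the inverses of the leading blocks of \<open>R\<close> (\<open>inv_factor\<close>). In these terms the
  restricted least squares estimator of order \<open>p\<close> has the scaled error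
  \<open>\<sigma> \<Sum>\<^sub>q\<^sub><\<^sub>p W\<^sub>q V\<^sub>q\<close>, if the model of order \<open>p\<close> is correct, and the test statistic of that order is
  \<open>\<sigma> W\<^sub>p\<^sub>-\<^sub>1\<close> divided by the estimated standard deviation. Sequential selection therefore looks at one
  coordinate after the other, and the selected estimator adds up the coordinates below the selected order
  (\<open>selected_vec\<close>).

  The expression \<open>G_expr\<close> is the cdf of this random vector (\<open>cdf_measure_G_expr\<close>). On the event that
  order \<open>p\<close> is selected, the coordinates from \<open>p\<close> on are independent of the partial sum, which gives
  the product; the remaining condition on \<open>W\<^sub>p\<^sub>-\<^sub>1\<close> becomes the integrand because \<open>b\<close> is the regression
  coefficient of \<open>\<xi> W\<^sub>p\<^sub>-\<^sub>1\<close> on the partial sum and \<open>\<zeta>\<^sup>2\<close> the residual variance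
  (\<open>set_integral_Delta_eq\<close>).

  The law of the selected vector depends on the design and on \<open>s\<close> only through \<open>s V\<close>. Replacing one
  such matrix by a nearby one has the effect of applying to \<open>W\<close> an upper triangular matrix close to the
  identity before the same linear map, and this changes probabilities uniformly little
  (\<open>triangular_tv\<close>): coordinates are changed one at a time, and each change is a one-dimensional affine
  map, where Scheffe's lemma applies. As the linear map stays fixed, it does not matter that the normal
  laws on \<open>R\<^sup>k\<close> may be singular. Thus the law is continuous in total variation
  (\<open>selected_vec_tv_uniform\<close>).

  For the finite-sample distribution no limit theorem is needed but a coupling. Outside an event of
  small probability the variance estimator is close to \<open>\<sigma>\<^sup>2\<close>, no coordinate is close to its critical
  value, and the last nonzero coefficient dominates the noise; there, selection with estimated and with
  known variance coincide and never stop below the true order (\<open>selection_coupling\<close>). Hence the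
  distance between the finite-sample law and the law of the selected vector is at most the probability
  of that event (\<open>finite_sample_tv\<close>).

  The estimator \<open>G_check\<close> is the same expression at the estimated standard deviation and the estimated
  order, so both claims follow from uniform continuity on the event that the order is correct and the
  standard deviation is nearly so (\<open>G_check_consistent_for\<close>).
\<close>

section \<open>Measures on the space of real vectors\<close>

lemma space_borel_vec [simp]: "space (borel_vec m) = carrier_vec m"
  by (simp add: borel_vec_def)

lemma measurable_borel_vecI:
  assumes "\<And>x. x \<in> space M \<Longrightarrow> f x \<in> carrier_vec m"
    and "\<And>i. i < m \<Longrightarrow> (\<lambda>x. f x $ i) \<in> borel_measurable M"
  shows "f \<in> M \<rightarrow>\<^sub>M borel_vec m"
  unfolding borel_vec_def
proof (rule measurable_vimage_algebra2)
  show "f \<in> space M \<rightarrow> carrier_vec m" using assms(1) by auto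
  show "(\<lambda>x. \<lambda>i\<in>{..<m}. f x $ i) \<in> M \<rightarrow>\<^sub>M (\<Pi>\<^sub>M i\<in>{..<m}. borel)"
    by (rule measurable_restrict) (use assms(2) in auto)
qed

lemma measurable_vec_index [measurable]:
  assumes "i < m" shows "(\<lambda>v. v $ i) \<in> borel_measurable (borel_vec m)"
proof -
  have "(\<lambda>v. \<lambda>i\<in>{..<m}. v $ i) \<in> borel_vec m \<rightarrow>\<^sub>M (\<Pi>\<^sub>M i\<in>{..<m}. (borel :: real measure))"
    unfolding borel_vec_def
    by (rule measurable_vimage_algebra1) (auto simp: space_PiM)
  from measurable_compose[OF this measurable_component_singleton[of i "{..<m}"]] assms
  show ?thesis by simp
qed

abbreviation lower_set :: "nat \<Rightarrow> real vec \<Rightarrow> real vec set" where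
  "lower_set k t \<equiv> {z \<in> carrier_vec k. z \<le> t}"

lemma lower_set_eq:
  assumes "t \<in> carrier_vec k"
  shows "lower_set k t = {z \<in> carrier_vec k. \<forall>i\<in>{..<k}. z $ i \<le> t $ i}"
  using assms by (auto simp: less_eq_vec_def)

lemma sets_lower_set [measurable]: "t \<in> carrier_vec k \<Longrightarrow> lower_set k t \<in> sets (borel_vec k)"
proof -
  assume t: "t \<in> carrier_vec k"
  have "{z \<in> space (borel_vec k). \<forall>i\<in>{..<k}. z $ i \<le> t $ i} \<in> sets (borel_vec k)"
    by measurable
  then show ?thesis using t by (simp add: lower_set_eq)
qed

lemma sets_borel_vec_lower_sets:
  "sets (borel_vec k) = sigma_sets (carrier_vec k) (lower_set k ` carrier_vec k)"
proof
  let ?S = "sigma (carrier_vec k) (lower_set k ` carrier_vec k)"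
  have sub: "lower_set k ` carrier_vec k \<subseteq> Pow (carrier_vec k)" by auto
  have "(\<lambda>v. v) \<in> ?S \<rightarrow>\<^sub>M borel_vec k"
  proof (rule measurable_borel_vecI)
    fix i assume i: "i < k"
    have "{z \<in> carrier_vec k. z $ i \<le> a} \<in> sets ?S" for a
    proof -
      have "{z \<in> carrier_vec k. z $ i \<le> a}
          = (\<Union>N::nat. lower_set k (vec k (\<lambda>j. if j = i then a else real N)))" (is "?L = ?R")
      proof
        show "?R \<subseteq> ?L" using i by (auto simp: less_eq_vec_def)
        show "?L \<subseteq> ?R"
        proof
          fix z assume z: "z \<in> ?L"
          define m where "m = Max (insert 0 ((\<lambda>j. z $ j) ` {..<k}))"
          obtain N :: nat where N: "m \<le> real N" using real_arch_simple by blast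
          have "z $ j \<le> real N" if "j < k" for j
          proof -
            have "z $ j \<le> m" unfolding m_def using that by (intro Max_ge) auto
            then show ?thesis using N by simp
          qed
          then show "z \<in> ?R" using z by (auto simp: less_eq_vec_def intro!: exI[of _ N])
        qed
      qed
      also have "\<dots> \<in> sets ?S"
        by (intro sets.countable_UN) (auto simp: sub intro!: sigma_sets.Basic)
      finally show ?thesis .
    qed
    then show "(\<lambda>v. v $ i) \<in> borel_measurable ?S"
      by (subst borel_measurable_iff_le) (simp add: space_measure_of[OF sub])
  qed (simp add: space_measure_of[OF sub])
  then have "A \<in> sets ?S" if "A \<in> sets (borel_vec k)" for A
    using measurable_sets[of "\<lambda>v. v" ?S "borel_vec k" A] sets.sets_into_space[OF that] that
    by (simp add: space_measure_of[OF sub] Int_absorb2)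
  then show "sets (borel_vec k) \<subseteq> sigma_sets (carrier_vec k) (lower_set k ` carrier_vec k)"
    using sub by (auto simp: sets_measure_of)
  show "sigma_sets (carrier_vec k) (lower_set k ` carrier_vec k) \<subseteq> sets (borel_vec k)"
  proof -
    have "lower_set k ` carrier_vec k \<subseteq> sets (borel_vec k)"
      by (rule image_subsetI) (rule sets_lower_set)
    from sets.sigma_sets_subset[OF this] show ?thesis by simp
  qed
qed

text \<open>
  Lower sets form a generator that is closed under intersections, so a finite measure on \<open>R\<^sup>k\<close> is
  determined by its cdf and \<^const>\<open>cdf_measure\<close> recovers it.
\<close>

lemma finite_measure_eqI_lower_sets:
  assumes "finite_measure M" "finite_measure N"
    and sets: "sets M = sets (borel_vec k)" "sets N = sets (borel_vec k)"
    and eq: "\<And>t. t \<in> carrier_vec k \<Longrightarrow> measure M (lower_set k t) = measure N (lower_set k t)"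
  shows "M = N"
proof (rule measure_eqI_generator_eq[where \<Omega> = "carrier_vec k" and E = "lower_set k ` carrier_vec k"
      and A = "\<lambda>n. lower_set k (vec k (\<lambda>_. real n))"])
  interpret M: finite_measure M by fact
  interpret N: finite_measure N by fact
  show "Int_stable (lower_set k ` carrier_vec k)"
  proof (rule Int_stableI_image)
    fix s t :: "real vec" assume "s \<in> carrier_vec k" "t \<in> carrier_vec k"
    then show "\<exists>u\<in>carrier_vec k. lower_set k s \<inter> lower_set k t = lower_set k u"
      by (intro bexI[of _ "vec k (\<lambda>i. min (s $ i) (t $ i))"]) (auto simp: less_eq_vec_def)
  qed
  show "emeasure M X = emeasure N X" if "X \<in> lower_set k ` carrier_vec k" for X
    using that eq by (auto simp: M.emeasure_eq_measure N.emeasure_eq_measure)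
  show "(\<Union>n. lower_set k (vec k (\<lambda>_. real n))) = carrier_vec k"
  proof -
    have "\<exists>n::nat. z \<le> vec k (\<lambda>_. real n)" if z: "z \<in> carrier_vec k" for z
    proof -
      define m where "m = Max (insert 0 ((\<lambda>j. z $ j) ` {..<k}))"
      obtain N :: nat where N: "m \<le> real N" using real_arch_simple by blast
      have "z $ j \<le> real N" if "j < k" for j
      proof -
        have "z $ j \<le> m" unfolding m_def using that by (intro Max_ge) auto
        then show ?thesis using N by simp
      qed
      then show ?thesis using z by (auto simp: less_eq_vec_def intro!: exI[of _ N])
    qed
    then show ?thesis by auto
  qed
  show "emeasure M (lower_set k (vec k (\<lambda>_. real n))) \<noteq> \<infinity>" for n
    by (simp add: M.emeasure_eq_measure)
  show "sets M = sigma_sets (carrier_vec k) (lower_set k ` carrier_vec k)"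
    "sets N = sigma_sets (carrier_vec k) (lower_set k ` carrier_vec k)"
    using sets sets_borel_vec_lower_sets by simp_all
  show "lower_set k ` carrier_vec k \<subseteq> Pow (carrier_vec k)" by auto
  show "range (\<lambda>n. lower_set k (vec k (\<lambda>_. real n))) \<subseteq> lower_set k ` carrier_vec k" by auto
qed

lemma cdf_measure_eqI:
  assumes "finite_measure M" "sets M = sets (borel_vec k)"
    and "\<And>t. t \<in> carrier_vec k \<Longrightarrow> measure M (lower_set k t) = G t"
  shows "cdf_measure k G = M"
  unfolding cdf_measure_def
proof (rule the_equality)
  show "finite_measure M \<and> sets M = sets (borel_vec k) \<and>
      (\<forall>t\<in>carrier_vec k. measure M (lower_set k t) = G t)"
    using assms by auto
  show "N = M" if "finite_measure N \<and> sets N = sets (borel_vec k) \<and>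
      (\<forall>t\<in>carrier_vec k. measure N (lower_set k t) = G t)" for N
    using that assms by (intro finite_measure_eqI_lower_sets[of N M k]) auto
qed

lemma tv_dist_leI:
  assumes "cdf_measure k G = M" "cdf_measure k H = N"
    and "\<And>E. E \<in> sets (borel_vec k) \<Longrightarrow> \<bar>measure M E - measure N E\<bar> \<le> \<epsilon>"
  shows "tv_dist k G H \<le> \<epsilon>"
  unfolding tv_dist_def using assms by (intro cSUP_least) auto

section \<open>Characteristic functions of random vectors\<close>

text \<open>
  Levy uniqueness is a statement on probability measures; the total mass is read off the
  characteristic function at \<open>0\<close>, and both measures are normalized by it.
\<close>

lemma finite_measure_eqI_char:
  assumes M: "finite_measure M" "sets M = sets borel" and N: "finite_measure N" "sets N = sets borel"
    and eq: "\<And>t. char M t = char N t"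
  shows "M = N"
proof -
  interpret M: finite_measure M by fact
  interpret N: finite_measure N by fact
  have sp: "space M = UNIV" "space N = UNIV" using sets_eq_imp_space_eq[OF M(2)] sets_eq_imp_space_eq[OF N(2)] by simp_all
  have mass: "measure M UNIV = measure N UNIV"
    using eq[of 0] sp by (simp add: char_def)
  show ?thesis
  proof (cases "measure M UNIV = 0")
    case True
    have "emeasure M A = 0" "emeasure N A = 0" for A
      using True mass sp M.bounded_measure[of A] N.bounded_measure[of A]
      by (simp_all add: M.emeasure_eq_measure N.emeasure_eq_measure measure_le_0_iff)
    then show ?thesis using M N by (intro measure_eqI) auto
  next
    case False
    define c where "c = 1 / measure M UNIV"
    have c: "c > 0" using False by (simp add: c_def zero_less_measure_iff)
    have D: "real_distribution (density L (\<lambda>_. ennreal c))"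
      and ch: "char (density L (\<lambda>_. ennreal c)) t = c * char L t"
      if L: "finite_measure L" "sets L = sets borel" "measure L UNIV = measure M UNIV" for L :: "real measure" and t
    proof -
      interpret L: finite_measure L by fact
      have spL: "space L = UNIV" using sets_eq_imp_space_eq[OF L(2)] by simp
      have "emeasure (density L (\<lambda>_. ennreal c)) UNIV = ennreal c * emeasure L UNIV"
        by (subst emeasure_density) (use L in \<open>auto simp: nn_integral_cmult spL\<close>)
      also have "\<dots> = 1" using L False c
        by (simp add: L.emeasure_eq_measure c_def flip: ennreal_mult)
      finally have "prob_space (density L (\<lambda>_. ennreal c))"
        by (intro prob_spaceI) (simp add: spL)
      then show "real_distribution (density L (\<lambda>_. ennreal c))"
        by (simp add: real_distribution_def real_distribution_axioms_def spL L)
      have "(\<lambda>x. iexp (t * x)) \<in> borel_measurable L"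
        using L by (simp cong: measurable_cong_sets)
      then show "char (density L (\<lambda>_. ennreal c)) t = c * char L t"
        unfolding char_def using c by (subst integral_density) (auto simp: scaleR_conv_of_real)
    qed
    have "density M (\<lambda>_. ennreal c) = density N (\<lambda>_. ennreal c)"
      using D[of M] D[of N] ch[of M] ch[of N] M N mass eq by (intro Levy_uniqueness) auto
    then have *: "emeasure (density M (\<lambda>_. ennreal c)) A = emeasure (density N (\<lambda>_. ennreal c)) A" for A by simp
    have "c * measure M A = c * measure N A" if "A \<in> sets borel" for A
      using *[of A] that M N c measure_density_const[of A M "ennreal c"] measure_density_const[of A N "ennreal c"]
      by (simp add: measure_def)
    then show ?thesis using c M N
      by (intro measure_eqI) (auto simp: M.emeasure_eq_measure N.emeasure_eq_measure)
  qed
qed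

lemma weighted_law:
  fixes f Z :: "'a \<Rightarrow> real"
  assumes L: "finite_measure L" and [measurable]: "f \<in> borel_measurable L" "Z \<in> borel_measurable L"
    and f: "\<And>w. 0 \<le> f w" "\<And>w. f w \<le> c" and B[measurable]: "B \<in> sets borel"
  shows "finite_measure (distr (density L f) borel Z)"
    and "char (distr (density L f) borel Z) u = (CLINT w|L. f w * iexp (u * Z w))"
    and "measure (distr (density L f) borel Z) B = (LINT w|L. f w * indicator B (Z w))"
proof -
  interpret L: finite_measure L by fact
  have int: "integrable L f"
    using f by (intro L.integrable_const_bound[where B=c]) auto
  have "emeasure (density L f) (space L) = (\<integral>\<^sup>+ w. f w \<partial>L)"
    by (subst emeasure_density) (auto intro!: nn_integral_cong)
  also have "\<dots> = ennreal (LINT w|L. f w)"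
    using int f by (intro nn_integral_eq_integral) auto
  finally have "finite_measure (density L f)"
    by (intro finite_measureI) simp
  then show "finite_measure (distr (density L f) borel Z)"
    by (rule finite_measure.finite_measure_distr) simp
  show "char (distr (density L f) borel Z) u = (CLINT w|L. f w * iexp (u * Z w))"
    unfolding char_def
    by (subst integral_distr, simp, simp, subst integral_density)
       (auto simp: f scaleR_conv_of_real)
  have "measure (distr (density L f) borel Z) B = (LINT x|distr (density L f) borel Z. indicator B x)"
    by simp
  also have "\<dots> = (LINT w|L. f w * indicator B (Z w))"
    by (subst integral_distr, simp, simp, subst integral_density) (auto simp: f)
  finally show "measure (distr (density L f) borel Z) B = (LINT w|L. f w * indicator B (Z w))" .
qed

text \<open>
  Uniqueness is available for measures, not for signed measures, hence the weights have to be
  nonnegative.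
\<close>

lemma weighted_law_eqI_char:
  fixes g X :: "'a \<Rightarrow> real" and h Y :: "'b \<Rightarrow> real"
  assumes M: "finite_measure M" and N: "finite_measure N"
    and [measurable]: "g \<in> borel_measurable M" "X \<in> borel_measurable M"
      "h \<in> borel_measurable N" "Y \<in> borel_measurable N"
    and g: "\<And>w. 0 \<le> g w" "\<And>w. g w \<le> c" and h: "\<And>w. 0 \<le> h w" "\<And>w. h w \<le> c"
    and eq: "\<And>u. (CLINT w|M. g w * iexp (u * X w)) = (CLINT w|N. h w * iexp (u * Y w))"
    and B: "B \<in> sets borel"
  shows "(LINT w|M. g w * indicator B (X w)) = (LINT w|N. h w * indicator B (Y w))"
proof -
  note g' = weighted_law[OF M assms(3,4) g B] and h' = weighted_law[OF N assms(5,6) h B]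
  have "distr (density M g) borel X = distr (density N h) borel Y"
    using eq by (intro finite_measure_eqI_char g' h') (simp_all add: g' h')
  then show ?thesis using g'(3) h'(3) by simp
qed

text \<open>
  This interpolates between the joint characteristic function (\<open>j = 0\<close>) and the probability of a
  box (\<open>j = K\<close>).
\<close>

definition box_char :: "'a measure \<Rightarrow> (nat \<Rightarrow> 'a \<Rightarrow> real) \<Rightarrow> nat \<Rightarrow> nat \<Rightarrow> (nat \<Rightarrow> real set) \<Rightarrow> (nat \<Rightarrow> real) \<Rightarrow> complex"
  where "box_char M X K j B t =
    (CLINT w|M. (\<Prod>i<j. indicat_real (B i) (X i w)) * iexp (\<Sum>i\<in>{j..<K}. t i * X i w))"

text \<open>
  To convert one more coordinate from a frequency into a Borel set, the factor \<open>exp (\<i> S)\<close> of the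
  remaining coordinates has to be turned into nonnegative weights. The weights \<open>1\<close>, \<open>1 + cos S\<close>
  and \<open>1 + sin S\<close> suffice: their transforms in the new coordinate are combinations of earlier
  values of \<^const>\<open>box_char\<close>, and they recover \<open>exp (\<i> S)\<close>.
\<close>

lemma box_char_step:
  fixes X :: "nat \<Rightarrow> 'a \<Rightarrow> real" and t :: "nat \<Rightarrow> real"
  assumes M: "prob_space M" and X: "\<forall>i<K. X i \<in> borel_measurable M"
    and j: "j < K" and B: "\<forall>i. B i \<in> sets borel"
    and p_def: "p = (\<lambda>w. \<Prod>i<j. indicat_real (B i) (X i w))"
    and S_def: "S = (\<lambda>w. \<Sum>i\<in>{Suc j..<K}. t i * X i w)"
  shows "p \<in> borel_measurable M" "S \<in> borel_measurable M" "0 \<le> p w" "p w \<le> 1"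
    and "(CLINT w|M. (p w :: real) * iexp (u * X j w)) = box_char M X K j B ((\<lambda>_. 0)(j := u))"
    and "(CLINT w|M. (p w * (1 + cos (S w)) :: real) * iexp (u * X j w))
       = box_char M X K j B ((\<lambda>_. 0)(j := u)) + (box_char M X K j B (t(j := u)) + box_char M X K j B ((\<lambda>i. - t i)(j := u))) / 2"
    and "(CLINT w|M. (p w * (1 + sin (S w)) :: real) * iexp (u * X j w))
       = box_char M X K j B ((\<lambda>_. 0)(j := u)) + (box_char M X K j B (t(j := u)) - box_char M X K j B ((\<lambda>i. - t i)(j := u))) / (2 * \<i>)"
    and "box_char M X K (Suc j) B t = 
      of_real ((LINT w|M. (p w * (1 + cos (S w))) * indicator (B j) (X j w)) - (LINT w|M. p w * indicator (B j) (X j w)))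
      + \<i> * of_real ((LINT w|M. (p w * (1 + sin (S w))) * indicator (B j) (X j w)) - (LINT w|M. p w * indicator (B j) (X j w)))"
proof -
  interpret prob_space M by fact
  have [measurable]: "B i \<in> sets borel" "i < K \<Longrightarrow> X i \<in> borel_measurable M" for i using B X by auto
  have X': "X i \<in> borel_measurable M" if "i < j" for i using that j X by auto
  show p[measurable]: "p \<in> borel_measurable M" unfolding p_def using X' by measurable
  show S[measurable]: "S \<in> borel_measurable M" unfolding S_def by measurable
  note [measurable] = X[rule_format, OF j]
  show p01: "0 \<le> p w" "p w \<le> 1" for w
    by (auto simp: p_def intro!: prod_nonneg prod_le_1)
  have int[simp]: "integrable M (\<lambda>w. complex_of_real (p w) * iexp (f w))"
    if [measurable]: "f \<in> borel_measurable M" for f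
    using p01 by (intro integrable_const_bound[where B=1]) (auto simp: norm_mult)
  have mx: "box_char M X K j B s = (CLINT w|M. p w * iexp (s j * X j w + (\<Sum>i\<in>{Suc j..<K}. s i * X i w)))" for s
    unfolding box_char_def p_def using j by (simp add: sum.atLeast_Suc_lessThan)
  have mx0: "box_char M X K j B ((\<lambda>_. 0)(j := u)) = (CLINT w|M. p w * iexp (u * X j w))" for u
    unfolding mx by (intro Bochner_Integration.integral_cong) (auto)
  have mx1: "box_char M X K j B (t(j := u)) = (CLINT w|M. p w * iexp (u * X j w + S w))" for u
    unfolding mx S_def by (intro Bochner_Integration.integral_cong) (auto)
  have mx2: "box_char M X K j B ((\<lambda>i. - t i)(j := u)) = (CLINT w|M. p w * iexp (u * X j w - S w))" for u
    unfolding mx S_def by (intro Bochner_Integration.integral_cong) (auto simp: sum_negf)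
  show "(CLINT w|M. (p w :: real) * iexp (u * X j w)) = box_char M X K j B ((\<lambda>_. 0)(j := u))"
    by (simp add: mx0)
  have e: "iexp (a + b) = iexp a * iexp b" "iexp (a - b) = iexp a * exp (- (\<i> * complex_of_real b))" for a b :: real
    by (simp_all only: of_real_add of_real_diff distrib_left right_diff_distrib exp_add exp_diff
        exp_minus divide_inverse)
  have alg: "P * (1 + (y + z) / 2) * a = P * a + (P * (a * y) + P * (a * z)) / 2"
    "P * (1 + (y - z) / (2 * \<i>)) * a = P * a + (P * (a * y) - P * (a * z)) / (2 * \<i>)" for P y z a :: complex
    by (simp_all add: field_simps)
  show "(CLINT w|M. (p w * (1 + cos (S w)) :: real) * iexp (u * X j w))
       = box_char M X K j B ((\<lambda>_. 0)(j := u)) + (box_char M X K j B (t(j := u)) + box_char M X K j B ((\<lambda>i. - t i)(j := u))) / 2"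
  proof -
    have "(CLINT w|M. (p w * (1 + cos (S w)) :: real) * iexp (u * X j w))
      = (CLINT w|M. p w * iexp (u * X j w) + (p w * iexp (u * X j w + S w) + p w * iexp (u * X j w - S w)) / 2)"
      by (intro Bochner_Integration.integral_cong refl)
         (simp only: e, simp only: of_real_mult of_real_add of_real_1 cos_of_real[symmetric] cos_exp_eq alg)
    also have "\<dots> = box_char M X K j B ((\<lambda>_. 0)(j := u)) + (box_char M X K j B (t(j := u)) + box_char M X K j B ((\<lambda>i. - t i)(j := u))) / 2"
      unfolding mx0 mx1 mx2 by (simp del: of_real_add of_real_diff of_real_mult)
    finally show ?thesis .
  qed
  show "(CLINT w|M. (p w * (1 + sin (S w)) :: real) * iexp (u * X j w))
       = box_char M X K j B ((\<lambda>_. 0)(j := u)) + (box_char M X K j B (t(j := u)) - box_char M X K j B ((\<lambda>i. - t i)(j := u))) / (2 * \<i>)"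
  proof -
    have "(CLINT w|M. (p w * (1 + sin (S w)) :: real) * iexp (u * X j w))
      = (CLINT w|M. p w * iexp (u * X j w) + (p w * iexp (u * X j w + S w) - p w * iexp (u * X j w - S w)) / (2 * \<i>))"
      by (intro Bochner_Integration.integral_cong refl)
         (simp only: e, simp only: of_real_mult of_real_add of_real_1 sin_of_real[symmetric] sin_exp_eq alg)
    also have "\<dots> = box_char M X K j B ((\<lambda>_. 0)(j := u)) + (box_char M X K j B (t(j := u)) - box_char M X K j B ((\<lambda>i. - t i)(j := u))) / (2 * \<i>)"
      unfolding mx0 mx1 mx2 by (simp del: of_real_add of_real_diff of_real_mult)
    finally show ?thesis .
  qed
  have intr: "integrable M (\<lambda>w. p w * f w * indicat_real (B j) (X j w))"
    if [measurable]: "f \<in> borel_measurable M" and f: "\<And>w. \<bar>f w\<bar> \<le> 1" for f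
    using p01 f by (intro integrable_const_bound[where B=1])
      (auto simp: abs_mult indicator_def intro!: mult_le_one)
  have intr1: "integrable M (\<lambda>w. p w * indicat_real (B j) (X j w))" using intr[of "\<lambda>_. 1"] by simp
  have cs: "integrable M (\<lambda>w. p w * cos (S w) * indicat_real (B j) (X j w))"
     "integrable M (\<lambda>w. p w * sin (S w) * indicat_real (B j) (X j w))"
    by (intro intr; simp)+
  have E: "iexp x = of_real (cos x) + \<i> * of_real (sin x)" for x :: real
    by (simp only: exp_Euler cos_of_real sin_of_real)
  have "box_char M X K (Suc j) B t = (CLINT w|M. of_real (p w * indicator (B j) (X j w)) * iexp (S w))"
    unfolding box_char_def p_def S_def prod.lessThan_Suc by (rule refl)
  also have "\<dots> = (CLINT w|M. of_real (p w * cos (S w) * indicator (B j) (X j w))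
      + \<i> * of_real (p w * sin (S w) * indicator (B j) (X j w)))"
    by (intro Bochner_Integration.integral_cong refl, subst E) (simp only: of_real_mult ring_distribs mult_ac)
  also have "\<dots> = of_real (LINT w|M. p w * cos (S w) * indicator (B j) (X j w))
     + \<i> * of_real (LINT w|M. p w * sin (S w) * indicator (B j) (X j w))"
    using cs by (simp add: integral_complex_of_real del: of_real_mult)
  also have "(LINT w|M. p w * cos (S w) * indicator (B j) (X j w)) = (LINT w|M. (p w * (1 + cos (S w))) * indicator (B j) (X j w)) - (LINT w|M. p w * indicator (B j) (X j w))"
    using cs intr1 by (simp add: algebra_simps)
  also have "(LINT w|M. p w * sin (S w) * indicator (B j) (X j w)) = (LINT w|M. (p w * (1 + sin (S w))) * indicator (B j) (X j w)) - (LINT w|M. p w * indicator (B j) (X j w))"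
    using cs intr1 by (simp add: algebra_simps)
  finally show "box_char M X K (Suc j) B t = 
      of_real ((LINT w|M. (p w * (1 + cos (S w))) * indicator (B j) (X j w)) - (LINT w|M. p w * indicator (B j) (X j w)))
      + \<i> * of_real ((LINT w|M. (p w * (1 + sin (S w))) * indicator (B j) (X j w)) - (LINT w|M. p w * indicator (B j) (X j w)))" .
qed

lemma measure_distr_box:
  fixes Z :: "nat \<Rightarrow> 'a \<Rightarrow> real"
  assumes L: "prob_space L" and Z[measurable]: "\<And>i. i < K \<Longrightarrow> Z i \<in> borel_measurable L"
    and A: "\<And>i. i < K \<Longrightarrow> A i \<in> sets borel"
  shows "complex_of_real (measure (distr L (\<Pi>\<^sub>M i\<in>{..<K}. borel) (\<lambda>w. \<lambda>i\<in>{..<K}. Z i w)) (Pi\<^sub>E {..<K} A))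
    = box_char L Z K K (\<lambda>i. if i < K then A i else {}) (\<lambda>_. 0)"
proof -
  interpret prob_space L by fact
  have [measurable]: "(\<lambda>w. \<lambda>i\<in>{..<K}. Z i w) \<in> L \<rightarrow>\<^sub>M (\<Pi>\<^sub>M i\<in>{..<K}. borel)"
    by (rule measurable_restrict) (use Z in auto)
  have box: "Pi\<^sub>E {..<K} A \<in> sets (\<Pi>\<^sub>M i\<in>{..<K}. (borel :: real measure))"
    by (rule sets_PiM_I_finite) (use A in simp_all)
  have eq: "(\<lambda>w. \<lambda>i\<in>{..<K}. Z i w) -` Pi\<^sub>E {..<K} A \<inter> space L = {w \<in> space L. \<forall>i<K. Z i w \<in> A i}"
    by (auto simp: PiE_def Pi_def extensional_def)
  have "measure (distr L (\<Pi>\<^sub>M i\<in>{..<K}. borel) (\<lambda>w. \<lambda>i\<in>{..<K}. Z i w)) (Pi\<^sub>E {..<K} A)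
     = prob {w \<in> space L. \<forall>i<K. Z i w \<in> A i}"
    by (subst measure_distr[OF _ box]) (simp_all only: eq, measurable)
  also have "\<dots> = (LINT w|L. indicator {w \<in> space L. \<forall>i<K. Z i w \<in> A i} w)"
    by (subst Bochner_Integration.integral_indicator)
       (rule arg_cong[where f=prob], blast)
  also have "\<dots> = (LINT w|L. (\<Prod>i<K. indicat_real (if i < K then A i else {}) (Z i w)))"
  proof (intro Bochner_Integration.integral_cong refl)
    fix w assume "w \<in> space L"
    show "indicator {w \<in> space L. \<forall>i<K. Z i w \<in> A i} w = (\<Prod>i<K. indicat_real (if i < K then A i else {}) (Z i w))"
    proof (cases "\<forall>i<K. Z i w \<in> A i")
      case True
      then show ?thesis using \<open>w \<in> space L\<close> by simp
    next
      case False
      then obtain i where "i < K" "Z i w \<notin> A i" by auto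
      then have "(\<Prod>i<K. indicat_real (if i < K then A i else {}) (Z i w)) = 0"
        by (intro prod_zero) (auto intro!: bexI[of _ i])
      then show ?thesis using False by simp
    qed
  qed
  finally have "measure (distr L (\<Pi>\<^sub>M i\<in>{..<K}. borel) (\<lambda>w. \<lambda>i\<in>{..<K}. Z i w)) (Pi\<^sub>E {..<K} A)
    = (LINT w|L. (\<Prod>i<K. indicat_real (if i < K then A i else {}) (Z i w)))" .
  then show ?thesis unfolding box_char_def by (simp only: integral_complex_of_real[symmetric]) simp
qed

text \<open>
  The multivariate uniqueness theorem for characteristic functions, obtained from the
  one-dimensional one by exchanging one coordinate at a time.
\<close>

lemma distr_eqI_char:
  fixes X :: "nat \<Rightarrow> 'a \<Rightarrow> real" and Y :: "nat \<Rightarrow> 'b \<Rightarrow> real"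
  assumes M: "prob_space M" and N: "prob_space N"
    and X[measurable]: "\<And>i. i < K \<Longrightarrow> X i \<in> borel_measurable M"
    and Y[measurable]: "\<And>i. i < K \<Longrightarrow> Y i \<in> borel_measurable N"
    and eq: "\<And>t :: nat \<Rightarrow> real. (CLINT w|M. iexp (\<Sum>i<K. t i * X i w)) = (CLINT w|N. iexp (\<Sum>i<K. t i * Y i w))"
  shows "distr M (\<Pi>\<^sub>M i\<in>{..<K}. borel) (\<lambda>w. \<lambda>i\<in>{..<K}. X i w)
       = distr N (\<Pi>\<^sub>M i\<in>{..<K}. borel) (\<lambda>w. \<lambda>i\<in>{..<K}. Y i w)" (is "?P = ?Q")
proof -
  interpret M: prob_space M by fact
  interpret N: prob_space N by fact
  have fin: "finite_measure M" "finite_measure N" by unfold_locales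
  have meas[measurable]: "(\<lambda>w. \<lambda>i\<in>{..<K}. X i w) \<in> M \<rightarrow>\<^sub>M (\<Pi>\<^sub>M i\<in>{..<K}. borel)"
    "(\<lambda>w. \<lambda>i\<in>{..<K}. Y i w) \<in> N \<rightarrow>\<^sub>M (\<Pi>\<^sub>M i\<in>{..<K}. borel)"
    by (rule measurable_restrict, use X Y in auto)+
  have box_char: "box_char M X K j B t = box_char N Y K j B t"
    if "j \<le> K" "\<And>i. B i \<in> sets borel" for j B t
    using that
  proof (induction j arbitrary: t)
    case 0
    then show ?case using eq[of t] by (simp add: box_char_def atLeast0LessThan del: of_real_sum)
  next
    case (Suc j)
    then have j: "j < K" "j \<le> K" and B: "\<And>i. B i \<in> sets borel" by auto
    have X': "\<forall>i<K. X i \<in> borel_measurable M" and Y': "\<forall>i<K. Y i \<in> borel_measurable N"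
      and B': "\<forall>i. B i \<in> sets borel" using X Y B by auto
    note IH = Suc.IH[OF j(2) B]
    define p where "p = (\<lambda>w. \<Prod>i<j. indicat_real (B i) (X i w))"
    define S where "S = (\<lambda>w. \<Sum>i\<in>{Suc j..<K}. t i * X i w)"
    define q where "q = (\<lambda>w. \<Prod>i<j. indicat_real (B i) (Y i w))"
    define R where "R = (\<lambda>w. \<Sum>i\<in>{Suc j..<K}. t i * Y i w)"
    note x = box_char_step[OF M X' j(1) B' p_def S_def]
    note y = box_char_step[OF N Y' j(1) B' q_def R_def]
    note [measurable] = x(1) x(2) y(1) y(2) X[OF j(1)] Y[OF j(1)]
    have le2: "a * (1 + b) \<le> 2" "0 \<le> a * (1 + b)" if "0 \<le> a" "a \<le> 1" "-1 \<le> b" "b \<le> 1" for a b :: real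
      using mult_mono[of a 1 "1 + b" 2] that by auto
    have 0: "(LINT w|M. p w * indicator (B j) (X j w)) = (LINT w|N. q w * indicator (B j) (Y j w))"
    proof (rule weighted_law_eqI_char[where c=1])
      show "(CLINT w|M. (p w :: real) * iexp (u * X j w)) = (CLINT w|N. (q w :: real) * iexp (u * Y j w))" for u
        unfolding x(5) y(5) by (simp only: IH)
    qed (auto simp: fin x(3-4) y(3-4) B)
    have 1: "(LINT w|M. (p w * (1 + cos (S w))) * indicator (B j) (X j w)) = (LINT w|N. (q w * (1 + cos (R w))) * indicator (B j) (Y j w))"
    proof (rule weighted_law_eqI_char[where c=2])
      show "(CLINT w|M. (p w * (1 + cos (S w)) :: real) * iexp (u * X j w)) = (CLINT w|N. (q w * (1 + cos (R w)) :: real) * iexp (u * Y j w))" for u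
        unfolding x(6) y(6) by (simp only: IH)
    qed (auto simp: fin x(3-4) y(3-4) B intro!: le2)
    have 2: "(LINT w|M. (p w * (1 + sin (S w))) * indicator (B j) (X j w)) = (LINT w|N. (q w * (1 + sin (R w))) * indicator (B j) (Y j w))"
    proof (rule weighted_law_eqI_char[where c=2])
      show "(CLINT w|M. (p w * (1 + sin (S w)) :: real) * iexp (u * X j w)) = (CLINT w|N. (q w * (1 + sin (R w)) :: real) * iexp (u * Y j w))" for u
        unfolding x(7) y(7) by (simp only: IH)
    qed (auto simp: fin x(3-4) y(3-4) B intro!: le2)
    show ?case
      unfolding x(8) y(8) 0 1 2 by (rule refl)
  qed
  show ?thesis
  proof (rule measure_eqI_PiM_finite[where I="{..<K}" and M="\<lambda>_. borel" and A="\<lambda>_. UNIV \<inter> space (\<Pi>\<^sub>M i\<in>{..<K}. borel)"])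
    fix A :: "nat \<Rightarrow> real set" assume A: "\<And>i. i \<in> {..<K} \<Longrightarrow> A i \<in> sets borel"
    have A': "\<And>i. i < K \<Longrightarrow> A i \<in> sets borel" using A by auto
    define B where "B i = (if i < K then A i else {})" for i
    have B[measurable]: "B i \<in> sets borel" for i using A by (simp add: B_def)
    have "measure ?P (Pi\<^sub>E {..<K} A) = measure ?Q (Pi\<^sub>E {..<K} A)"
      using box_char[of K B "\<lambda>_. 0", OF order.refl B] measure_distr_box[OF M X A'] measure_distr_box[OF N Y A']
      unfolding B_def of_real_eq_iff[where 'a=complex, symmetric] by (simp only:)
    then show "emeasure ?P (Pi\<^sub>E {..<K} A) = emeasure ?Q (Pi\<^sub>E {..<K} A)"
      using finite_measure.emeasure_eq_measure[OF M.finite_measure_distr[OF meas(1)]]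
       finite_measure.emeasure_eq_measure[OF N.finite_measure_distr[OF meas(2)]] by simp
  next
    show "range (\<lambda>_::nat. UNIV \<inter> space (\<Pi>\<^sub>M i\<in>{..<K}. borel :: real measure)) \<subseteq> prod_algebra {..<K} (\<lambda>_. borel)"
      by (auto simp: space_PiM intro!: prod_algebraI_finite)
  qed (auto simp: M.emeasure_eq_measure emeasure_distr)
qed

section \<open>Independent standard normal coordinates\<close>

abbreviation N01 :: "real measure" where
  "N01 \<equiv> std_normal_distribution"

abbreviation SG :: "nat \<Rightarrow> (nat \<Rightarrow> real) measure" where
  "SG m \<equiv> \<Pi>\<^sub>M i\<in>{..<m}. N01"

lemma product_prob_space_std_normal: "product_prob_space (\<lambda>_ :: nat. N01)"
proof -
  interpret prob_space N01 by (rule prob_space_normal_density) simp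
  show ?thesis by unfold_locales
qed

lemma prob_space_SG: "prob_space (PiM I (\<lambda>_ :: nat. N01))"
proof -
  interpret product_prob_space "\<lambda>_ :: nat. N01" I by (rule product_prob_space_std_normal)
  show ?thesis by unfold_locales
qed

lemma finite_measure_std_normal: "finite_measure N01"
  by (rule prob_space.finite_measure) (rule prob_space_normal_density, simp)

lemma finite_measure_SG: "finite_measure (PiM I (\<lambda>_ :: nat. N01))"
  by (rule prob_space.finite_measure[OF prob_space_SG])

lemma sets_SG: "sets (PiM I (\<lambda>_ :: nat. N01)) = sets (\<Pi>\<^sub>M i\<in>I. borel)"
  by (intro sets_PiM_cong) simp_all

lemma measurable_SG_component [measurable]:
  "i \<in> I \<Longrightarrow> (\<lambda>w. w i) \<in> borel_measurable (PiM I (\<lambda>_ :: nat. N01))"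
  using measurable_component_singleton[of i I "\<lambda>_. N01"] by simp

lemma char_SG:
  "(CLINT w|SG m. iexp (\<Sum>j<m. a j * w j)) = of_real (exp (- (\<Sum>j<m. (a j)\<^sup>2) / 2))"
proof -
  interpret product_prob_space "\<lambda>_ :: nat. N01" "{..<m}" by (rule product_prob_space_std_normal)
  interpret S: prob_space N01 by (rule prob_space_normal_density) simp
  have "(CLINT w|SG m. iexp (\<Sum>j<m. a j * w j)) = (CLINT w|SG m. (\<Prod>j<m. iexp (a j * w j)))"
    by (intro Bochner_Integration.integral_cong refl) (simp add: sum_distrib_left exp_sum)
  also have "\<dots> = (\<Prod>j<m. (CLINT x|N01. iexp (a j * x)))"
    by (rule product_integral_prod) (auto intro!: finite_measure.integrable_const_bound[OF finite_measure_std_normal, where B=1])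
  also have "\<dots> = (\<Prod>j<m. char N01 (a j))"
    by (simp add: char_def)
  also have "\<dots> = (\<Prod>j<m. complex_of_real (exp (- ((a j)\<^sup>2) / 2)))"
    by (simp only: char_std_normal_distribution)
  also have "\<dots> = of_real (exp (\<Sum>j<m. - ((a j)\<^sup>2) / 2))"
    by (simp only: exp_sum[OF finite_lessThan] of_real_prod)
  also have "(\<Sum>j<m. - ((a j)\<^sup>2) / 2) = - (\<Sum>j<m. (a j)\<^sup>2) / 2"
    by (simp add: sum_negf sum_divide_distrib)
  finally show ?thesis .
qed

text \<open>
  The characteristic function of a linear image of independent standard normal coordinates
  involves the coefficients only through their inner products, which are the covariances. This one
  fact yields uniqueness of normal laws with a given covariance, invariance under orthonormal
  changes of coordinates, and independence of uncorrelated linear forms.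
\<close>

lemma linear_law_eqI:
  fixes a a' :: "nat \<Rightarrow> nat \<Rightarrow> real"
  assumes cov: "\<And>i l. i < K \<Longrightarrow> l < K \<Longrightarrow> (\<Sum>j<m. a i j * a l j) = (\<Sum>j<m'. a' i j * a' l j)"
  shows "distr (SG m) (\<Pi>\<^sub>M i\<in>{..<K}. borel) (\<lambda>w. \<lambda>i\<in>{..<K}. \<Sum>j<m. a i j * w j)
       = distr (SG m') (\<Pi>\<^sub>M i\<in>{..<K}. borel) (\<lambda>w. \<lambda>i\<in>{..<K}. \<Sum>j<m'. a' i j * w j)"
proof (rule distr_eqI_char[OF prob_space_SG prob_space_SG])
  fix t :: "nat \<Rightarrow> real"
  have ch: "(CLINT w|SG n. iexp (\<Sum>i<K. t i * (\<Sum>j<n. b i j * w j)))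
    = of_real (exp (- (\<Sum>i<K. \<Sum>l<K. t i * t l * (\<Sum>j<n. b i j * b l j)) / 2))" for n b
  proof -
    have "(\<Sum>i<K. t i * (\<Sum>j<n. b i j * w j)) = (\<Sum>j<n. (\<Sum>i<K. t i * b i j) * w j)" for w :: "nat \<Rightarrow> real"
      unfolding sum_distrib_left sum_distrib_right by (subst sum.swap) (simp add: mult_ac)
    moreover have "(\<Sum>j<n. (\<Sum>i<K. t i * b i j)\<^sup>2) = (\<Sum>i<K. \<Sum>l<K. t i * t l * (\<Sum>j<n. b i j * b l j))"
    proof -
      have "(\<Sum>j<n. (\<Sum>i<K. t i * b i j)\<^sup>2) = (\<Sum>j<n. \<Sum>i<K. \<Sum>l<K. t i * t l * (b i j * b l j))"
        by (simp add: power2_eq_square sum_product mult_ac)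
      also have "\<dots> = (\<Sum>i<K. \<Sum>j<n. \<Sum>l<K. t i * t l * (b i j * b l j))"
        by (rule sum.swap)
      also have "\<dots> = (\<Sum>i<K. \<Sum>l<K. \<Sum>j<n. t i * t l * (b i j * b l j))"
        by (intro sum.cong refl sum.swap)
      finally show ?thesis by (simp only: sum_distrib_left)
    qed
    ultimately show ?thesis by (simp only: char_SG)
  qed
  show "(CLINT w|SG m. iexp (\<Sum>i<K. t i * (\<Sum>j<m. a i j * w j))) =
    (CLINT w|SG m'. iexp (\<Sum>i<K. t i * (\<Sum>j<m'. a' i j * w j)))"
    unfolding ch using cov by simp
qed measurable

lemma linear_law_eqI':
  fixes a a' :: "nat \<Rightarrow> nat \<Rightarrow> real"
  assumes cov: "\<And>i l. i < K \<Longrightarrow> l < K \<Longrightarrow> (\<Sum>j<m. a i j * a l j) = (\<Sum>j<m'. a' i j * a' l j)"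
    and F: "F \<in> (\<Pi>\<^sub>M i\<in>{..<K}. borel) \<rightarrow>\<^sub>M N"
  shows "distr (SG m) N (\<lambda>w. F (\<lambda>i\<in>{..<K}. \<Sum>j<m. a i j * w j))
       = distr (SG m') N (\<lambda>w. F (\<lambda>i\<in>{..<K}. \<Sum>j<m'. a' i j * w j))"
proof -
  have meas: "(\<lambda>w. \<lambda>i\<in>{..<K}. \<Sum>j<n. b i j * w j) \<in> SG n \<rightarrow>\<^sub>M (\<Pi>\<^sub>M i\<in>{..<K}. borel)" for n and b :: "nat \<Rightarrow> nat \<Rightarrow> real"
    by (rule measurable_restrict) measurable
  from arg_cong[OF linear_law_eqI[where K=K and a=a and a'=a', OF cov], where f="\<lambda>M. distr M N F"] show ?thesis
    by (simp add: distr_distr[OF F meas] comp_def)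
qed

lemma std_gauss_linear:
  assumes L: "L \<in> carrier_mat k m"
  shows "distr (std_gauss m) (borel_vec k) (\<lambda>z. L *\<^sub>v z)
    = distr (SG m) (borel_vec k) (\<lambda>w. vec k (\<lambda>i. \<Sum>j<m. L $$ (i, j) * w j))"
proof -
  have 1: "vec m \<in> SG m \<rightarrow>\<^sub>M borel_vec m"
    by (rule measurable_borel_vecI) auto
  have 2: "(\<lambda>z. L *\<^sub>v z) \<in> borel_vec m \<rightarrow>\<^sub>M borel_vec k"
  proof (rule measurable_borel_vecI)
    fix i assume i: "i < k"
    have eq: "(L *\<^sub>v z) $ i = (\<Sum>j<m. L $$ (i, j) * z $ j)" if "z \<in> space (borel_vec m)" for z
      using that L i by (auto simp: scalar_prod_def atLeast0LessThan)
    show "(\<lambda>z. (L *\<^sub>v z) $ i) \<in> borel_measurable (borel_vec m)"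
      by (subst measurable_cong[OF eq], assumption) measurable
  qed (use L in auto)
  have eq: "L *\<^sub>v vec m w = vec k (\<lambda>i. \<Sum>j<m. L $$ (i, j) * w j)" for w
    using L by (intro eq_vecI) (auto simp: scalar_prod_def atLeast0LessThan)
  show ?thesis unfolding std_gauss_def
    by (subst distr_distr[OF 2 1]) (simp add: comp_def eq)
qed

text \<open>
  \<^const>\<open>gauss\<close> picks an arbitrary factorization of the covariance matrix; any other one gives the same
  law.
\<close>

lemma gauss_eq:
  assumes L: "L \<in> carrier_mat k m" "L * L\<^sup>T = \<Sigma>"
  shows "gauss k \<Sigma> = distr (SG m) (borel_vec k) (\<lambda>w. vec k (\<lambda>i. \<Sum>j<m. L $$ (i, j) * w j))"
proof -
  define M0 where "M0 = distr (SG m) (borel_vec k) (\<lambda>w. vec k (\<lambda>i. \<Sum>j<m. L $$ (i, j) * w j))"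
  have uniq: "M = M0" if "L' \<in> carrier_mat k m'" "L' * L'\<^sup>T = \<Sigma>"
     "M = distr (std_gauss m') (borel_vec k) (\<lambda>z. L' *\<^sub>v z)" for M m' L'
  proof -
    have F: "vec k \<in> (\<Pi>\<^sub>M i\<in>{..<k}. borel) \<rightarrow>\<^sub>M borel_vec k"
      by (rule measurable_borel_vecI) auto
    have v: "vec k (\<lambda>i. f i) = vec k (\<lambda>i\<in>{..<k}. f i)" for f :: "nat \<Rightarrow> real"
      by (intro eq_vecI) auto
    have cov: "(\<Sum>j<m'. L' $$ (i, j) * L' $$ (l, j)) = (\<Sum>j<m. L $$ (i, j) * L $$ (l, j))" if "i < k" "l < k" for i l
    proof -
      have "(L' * L'\<^sup>T) $$ (i, l) = (L * L\<^sup>T) $$ (i, l)" using \<open>L' * L'\<^sup>T = \<Sigma>\<close> L by simp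
      then show ?thesis using \<open>L' \<in> carrier_mat k m'\<close> L(1) that
        by (simp add: scalar_prod_def atLeast0LessThan)
    qed
    show ?thesis
      using linear_law_eqI'[OF cov F] std_gauss_linear[OF that(1)] that(3)
      unfolding M0_def by (simp flip: v)
  qed
  have "\<exists>M. \<exists>m. \<exists>L \<in> carrier_mat k m. L * L\<^sup>T = \<Sigma> \<and> M = distr (std_gauss m) (borel_vec k) (\<lambda>z. L *\<^sub>v z)"
    using L by auto
  from someI_ex[OF this, folded gauss_def] have "gauss k \<Sigma> = M0"
    by (elim exE bexE conjE) (rule uniq)
  then show ?thesis by (simp add: M0_def)
qed

text \<open>
  Both branches of the definition of \<^const>\<open>Delta\<close> are scalings of one standard normal variable.
\<close>

lemma Delta_eq:
  assumes "0 \<le> s"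
  shows "Delta s a b = measure N01 {x. \<bar>s * x - a\<bar> < b}"
proof (cases "s = 0")
  case True
  interpret S: prob_space N01 by (rule prob_space_normal_density) simp
  have "{x::real. \<bar>a\<bar> < b} = (if \<bar>a\<bar> < b then UNIV else {})" by auto
  then show ?thesis using True S.prob_space
    by (simp add: Delta_def measure_return indicator_def)
next
  case False
  then have s: "s > 0" using assms by simp
  interpret S: prob_space N01 by (rule prob_space_normal_density) simp
  have "distributed N01 lborel (\<lambda>x. x) (normal_density 0 1)"
    unfolding distributed_def by (auto simp: distr_id2)
  from S.normal_density_affine[OF this, of s 0] s
  have "distributed N01 lborel (\<lambda>x. s * x) (normal_density 0 s)" by simp
  from distributed_distr_eq_density[OF this]
  have "density lborel (normal_density 0 s) = distr N01 lborel (\<lambda>x. s * x)" by simp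
  then show ?thesis using s
    by (simp add: Delta_def measure_distr)
qed

section \<open>Total variation of triangular perturbations\<close>

definition normal_L1_dist :: "real \<Rightarrow> real \<Rightarrow> real" where
  "normal_L1_dist d h = (LINT x|lborel. \<bar>normal_density h d x - std_normal_density x\<bar>)"

lemma affine_std_normal_tv:
  assumes d: "d > 0" and [measurable]: "B \<in> sets borel"
  shows "\<bar>measure N01 {x. d * x + h \<in> B} - measure N01 B\<bar> \<le> normal_L1_dist d h"
proof -
  interpret S: prob_space N01 by (rule prob_space_normal_density) simp
  interpret D: prob_space "density lborel (normal_density h d)" by (rule prob_space_normal_density) (use d in simp)
  have "distributed N01 lborel (\<lambda>x. x) (normal_density 0 1)"
    unfolding distributed_def by (auto simp: distr_id2)
  from S.normal_density_affine[OF this, of d h] d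
  have "distributed N01 lborel (\<lambda>x. h + d * x) (normal_density h d)" by simp
  from distributed_distr_eq_density[OF this]
  have eq: "density lborel (normal_density h d) = distr N01 lborel (\<lambda>x. h + d * x)" by simp
  have "measure N01 {x. d * x + h \<in> B} = measure (density lborel (normal_density h d)) B"
    unfolding eq by (subst measure_distr) (auto simp: add.commute vimage_def)
  moreover have m: "measure (density lborel (normal_density \<mu> s)) B = (LINT x|lborel. normal_density \<mu> s x * indicator B x)"
    if "s > 0" for \<mu> s
  proof -
    have "measure (density lborel (normal_density \<mu> s)) B = (LINT x|density lborel (normal_density \<mu> s). indicator B x)"
      by simp
    also have "\<dots> = (LINT x|lborel. normal_density \<mu> s x * indicator B x)"
      using that by (subst integral_density) (auto simp: normal_density_nonneg)
    finally show ?thesis .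
  qed
  moreover have i: "integrable lborel (\<lambda>x. normal_density \<mu> s x * indicator B x)" if "s > 0" for \<mu> s
    using that by (intro integrable_real_mult_indicator) auto
  ultimately have "measure N01 {x. d * x + h \<in> B} - measure N01 B
     = (LINT x|lborel. (normal_density h d x - std_normal_density x) * indicator B x)"
    using d by (simp add: left_diff_distrib)
  also have "\<bar>\<dots>\<bar> \<le> (LINT x|lborel. \<bar>(normal_density h d x - std_normal_density x) * indicator B x\<bar>)"
    by (rule integral_abs_bound)
  also have "\<dots> \<le> normal_L1_dist d h" unfolding normal_L1_dist_def
    using d i[of d h] i[of 1 0]
    by (intro integral_mono) (auto simp: left_diff_distrib abs_mult indicator_def intro!: integrable_abs Bochner_Integration.integrable_diff)
  finally show ?thesis .
qed

lemma normal_L1_dist_bounds: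
  assumes "d > 0" shows "0 \<le> normal_L1_dist d h" "normal_L1_dist d h \<le> 2"
proof -
  show "0 \<le> normal_L1_dist d h" by (simp add: normal_L1_dist_def)
  have "normal_L1_dist d h \<le> (LINT x|lborel. normal_density h d x + std_normal_density x)"
    unfolding normal_L1_dist_def using assms
  proof (intro integral_mono)
    fix x
    have "\<bar>a - b\<bar> \<le> a + b" if "0 \<le> a" "0 \<le> b" for a b :: real using that by auto
    then show "\<bar>normal_density h d x - std_normal_density x\<bar> \<le> normal_density h d x + std_normal_density x"
      using normal_density_nonneg by blast
  qed (use assms in \<open>auto intro!: integrable_abs\<close>)
  also have "\<dots> = 2" using assms by simp
  finally show "normal_L1_dist d h \<le> 2" .
qed

text \<open>Scheffe's lemma applies, since all densities have integral 1 and converge pointwise.\<close>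

lemma normal_L1_dist_tendsto_0:
  assumes d: "d \<longlonglongrightarrow> 1" "\<And>n. d n > 0" and h: "h \<longlonglongrightarrow> 0"
  shows "(\<lambda>n. normal_L1_dist (d n) (h n)) \<longlonglongrightarrow> 0"
proof -
  have nn: "(\<integral>\<^sup>+ x. ennreal (norm (normal_density \<mu> s x)) \<partial>lborel) = 1" if "s > 0" for \<mu> s
    using that by (simp add: normal_density_nonneg nn_integral_eq_integral)
  have "(\<lambda>n. \<integral>\<^sup>+ x. norm (normal_density (h n) (d n) x - std_normal_density x) \<partial>lborel) \<longlonglongrightarrow> 0"
  proof (rule Scheffe_lemma2)
    show "AE x in lborel. (\<lambda>n. normal_density (h n) (d n) x) \<longlonglongrightarrow> std_normal_density x"
      unfolding normal_density_def using d h
      by (intro AE_I2 tendsto_intros tendsto_eq_intros) (auto intro!: tendsto_eq_intros)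
    show "(\<integral>\<^sup>+ x. norm (normal_density (h n) (d n) x) \<partial>lborel) \<le> (\<integral>\<^sup>+ x. norm (std_normal_density x) \<partial>lborel)" for n
      using nn[OF d(2)] nn[of 1 0] by simp
  qed auto
  moreover have "(\<integral>\<^sup>+ x. norm (normal_density (h n) (d n) x - std_normal_density x) \<partial>lborel) = ennreal (normal_L1_dist (d n) (h n))" for n
    unfolding normal_L1_dist_def real_norm_def using d(2)[of n]
    by (intro nn_integral_eq_integral) (auto intro!: integrable_abs)
  ultimately have "(\<lambda>n. ennreal (normal_L1_dist (d n) (h n))) \<longlonglongrightarrow> ennreal 0" by simp
  then show ?thesis
    by (rule tendsto_ennrealD) (auto simp: normal_L1_dist_bounds d(2))
qed

lemma measurable_normal_L1_dist [measurable]: "normal_L1_dist d \<in> borel_measurable borel"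
proof -
  have "(\<lambda>h. LINT x|lborel. \<bar>normal_density h d x - std_normal_density x\<bar>) \<in> borel_measurable borel"
    unfolding normal_density_def by measurable
  then show ?thesis unfolding normal_L1_dist_def[abs_def] .
qed

lemma measurable_SG_update:
  assumes "i < P" "h \<in> borel_measurable (SG P)"
  shows "(\<lambda>w. w(i := h w)) \<in> SG P \<rightarrow>\<^sub>M SG P"
proof -
  have "(\<lambda>w. w(i := h w)) \<in> SG P \<rightarrow>\<^sub>M PiM (insert i {..<P}) (\<lambda>_. N01)"
    by (rule measurable_fun_upd[where J="{..<P}"]) (use assms in auto)
  then show ?thesis using assms by (simp add: insert_absorb)
qed

text \<open>
  Given the other coordinates, the update is an affine map of one standard normal variable. Its
  effect on probabilities is at most the \<open>L\<^sup>1\<close> distance of two normal densities, which is at most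
  2 and tends to 0 pointwise, so its mean tends to 0 by dominated convergence. The bound does not
  depend on the set \<open>B\<close>.
\<close>

lemma coordinate_update_tv:
  fixes d :: "nat \<Rightarrow> real" and m :: "nat \<Rightarrow> nat \<Rightarrow> real"
  assumes i: "i < P" and J: "J \<subseteq> {..<P} - {i}"
    and d: "d \<longlonglongrightarrow> 1" "\<And>n. d n > 0" and m: "\<And>j. j \<in> J \<Longrightarrow> (\<lambda>n. m n j) \<longlonglongrightarrow> 0"
  shows "\<exists>\<epsilon>. \<epsilon> \<longlonglongrightarrow> 0 \<and> (\<forall>n. \<forall>B\<in>sets (SG P).
    \<bar>measure (SG P) {w \<in> space (SG P). w(i := d n * w i + (\<Sum>j\<in>J. m n j * w j)) \<in> B} - measure (SG P) B\<bar> \<le> \<epsilon> n)"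
proof -
  define I where "I = {..<P} - {i}"
  have I: "finite I" "i \<notin> I" "insert i I = {..<P}" using i by (auto simp: I_def)
  have fJ: "finite J" using J finite_subset by blast
  interpret PP: product_prob_space "\<lambda>_ :: nat. N01" "{..<P}" by (rule product_prob_space_std_normal)
  interpret S: prob_space N01 by (rule prob_space_normal_density) simp
  interpret SGI: prob_space "PiM I (\<lambda>_. N01)" by (rule prob_space_SG)
  interpret SG: prob_space "SG P" by (rule prob_space_SG)
  define h where "h n w = (\<Sum>j\<in>J. m n j * w j)" for n and w :: "nat \<Rightarrow> real"
  have hm[measurable]: "h n \<in> borel_measurable (PiM I' (\<lambda>_. N01))" if "J \<subseteq> I'" for n I'
    unfolding h_def using that by (intro borel_measurable_sum borel_measurable_times) auto
  have JI: "J \<subseteq> I" "J \<subseteq> {..<P}" using J by (auto simp: I_def)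
  note [measurable] = hm[OF JI(1)] hm[OF JI(2)]
  define \<epsilon> where "\<epsilon> n = (LINT w|PiM I (\<lambda>_. N01). normal_L1_dist (d n) (h n w))" for n
  have "\<epsilon> \<longlonglongrightarrow> (LINT w|PiM I (\<lambda>_. N01). 0)" unfolding \<epsilon>_def
  proof (rule integral_dominated_convergence[where w="\<lambda>_. 2"])
    show "AE w in PiM I (\<lambda>_. N01). (\<lambda>n. normal_L1_dist (d n) (h n w)) \<longlonglongrightarrow> 0"
      unfolding h_def by (intro AE_I2 normal_L1_dist_tendsto_0 d tendsto_null_sum tendsto_mult_left_zero m)
  qed (auto simp: normal_L1_dist_bounds d(2))
  then have "\<epsilon> \<longlonglongrightarrow> 0" by simp
  moreover have "\<bar>measure (SG P) {w \<in> space (SG P). w(i := d n * w i + h n w) \<in> B} - measure (SG P) B\<bar> \<le> \<epsilon> n"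
    if B[measurable]: "B \<in> sets (SG P)" for n B
  proof -
    have [measurable]: "(\<lambda>w. w(i := d n * w i + h n w)) \<in> SG P \<rightarrow>\<^sub>M SG P"
      using i by (intro measurable_SG_update) measurable
    have ins: "(LINT w|SG P. f w) = (LINT x|PiM I (\<lambda>_. N01). LINT y|N01. f (x(i := y)))"
      if "integrable (SG P) f" for f :: "_ \<Rightarrow> real"
      using PP.product_integral_insert[OF I(1,2), of f] that I(3) by simp
    \<comment> \<open>Fix the other coordinates \<open>x\<close> and compare the two laws on the section of \<open>B\<close> at \<open>x\<close>.\<close>
    define sec where "sec x = {y. x(i := y) \<in> B}" for x
    have [measurable]: "sec x \<in> sets borel" if "x \<in> space (PiM I (\<lambda>_. N01))" for x
    proof -
      have "(\<lambda>y. x(i := y)) \<in> N01 \<rightarrow>\<^sub>M PiM (insert i I) (\<lambda>_. N01)"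
        using that I by (intro measurable_component_update)
      from measurable_sets[OF this, of B] show ?thesis using B I(3) by (simp add: sec_def vimage_def)
    qed
    have secd[measurable]: "{y. d n * y + r \<in> sec x} \<in> sets borel" if "x \<in> space (PiM I (\<lambda>_. N01))" for x r
    proof -
      have "(\<lambda>y. d n * y + r) -` sec x \<inter> space borel \<in> sets borel"
        by (rule measurable_sets[of _ borel borel]) (use that in measurable)
      then show ?thesis by (simp add: vimage_def)
    qed
    have hupd: "h n (x(i := y)) = h n x" for x y using J unfolding h_def by (intro sum.cong) auto
    have SG_ind: "measure (SG P) C = (LINT w|SG P. indicator C w)" if "C \<subseteq> space (SG P)" for C
      using that by (simp add: Int_absorb2)
    have 1: "measure (SG P) {w \<in> space (SG P). w(i := d n * w i + h n w) \<in> B}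
      = (LINT x|PiM I (\<lambda>_. N01). measure N01 {y. d n * y + h n x \<in> sec x})"
    proof -
      have "measure (SG P) {w \<in> space (SG P). w(i := d n * w i + h n w) \<in> B}
         = (LINT w|SG P. indicator B (w(i := d n * w i + h n w)))"
        using SG_ind[of "{w \<in> space (SG P). w(i := d n * w i + h n w) \<in> B}"]
        by (auto simp: indicator_def intro!: Bochner_Integration.integral_cong)
      also have "\<dots> = (LINT x|PiM I (\<lambda>_. N01). LINT y|N01.
           indicator B ((x(i := y))(i := d n * (x(i := y)) i + h n (x(i := y)))))"
        by (rule ins) (auto intro!: finite_measure.integrable_const_bound[OF finite_measure_SG, where B=1])
      also have "\<dots> = (LINT x|PiM I (\<lambda>_. N01). LINT y|N01.
           indicator {y. d n * y + h n x \<in> sec x} y)"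
        by (intro Bochner_Integration.integral_cong refl) (simp add: hupd sec_def indicator_def)
      finally show ?thesis by simp
    qed
    have 2: "measure (SG P) B = (LINT x|PiM I (\<lambda>_. N01). measure N01 (sec x))"
    proof -
      have "measure (SG P) B = (LINT w|SG P. indicator B w)" using sets.sets_into_space[OF B] by (simp add: Int_absorb2)
      also have "\<dots> = (LINT x|PiM I (\<lambda>_. N01). LINT y|N01. indicator B (x(i := y)))"
        by (rule ins) (auto intro!: finite_measure.integrable_const_bound[OF finite_measure_SG, where B=1])
      also have "\<dots> = (LINT x|PiM I (\<lambda>_. N01). LINT y|N01. indicator (sec x) y)"
        by (intro Bochner_Integration.integral_cong refl) (simp add: sec_def indicator_def)
      finally show ?thesis by simp
    qed
    have m1[measurable]: "(\<lambda>x. measure N01 {y. d n * y + h n x \<in> sec x}) \<in> borel_measurable (PiM I (\<lambda>_. N01))"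
    proof -
      have [measurable]: "(\<lambda>p. (fst p)(i := d n * snd p + h n (fst p))) \<in> PiM I (\<lambda>_. N01) \<Otimes>\<^sub>M N01 \<rightarrow>\<^sub>M SG P"
        by (rule measurable_fun_upd[where J=I]) (use I(3) in auto)
      have "measure N01 {y. d n * y + h n x \<in> sec x}
        = (LINT y|N01. indicator B ((fst (x, y))(i := d n * snd (x, y) + h n (fst (x, y)))))" for x
      proof -
        have "measure N01 ({y. d n * y + h n x \<in> sec x}) = (LINT y|N01. indicator ({y. d n * y + h n x \<in> sec x}) y)"
          by simp
        then show ?thesis by (simp add: sec_def indicator_def)
      qed
      then show ?thesis by simp
    qed
    have m2[measurable]: "(\<lambda>x. measure N01 (sec x)) \<in> borel_measurable (PiM I (\<lambda>_. N01))"
    proof -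
      have [measurable]: "(\<lambda>p. (fst p)(i := snd p)) \<in> PiM I (\<lambda>_. N01) \<Otimes>\<^sub>M N01 \<rightarrow>\<^sub>M SG P"
        by (rule measurable_fun_upd[where J=I]) (use I(3) in auto)
      have "measure N01 (sec x)
        = (LINT y|N01. indicator B ((fst (x, y))(i := snd (x, y))))" for x
      proof -
        have "measure N01 (sec x) = (LINT y|N01. indicator (sec x) y)"
          by simp
        then show ?thesis by (simp add: sec_def indicator_def)
      qed
      then show ?thesis by simp
    qed
    have int: "integrable (PiM I (\<lambda>_. N01)) (\<lambda>x. measure N01 {y. d n * y + h n x \<in> sec x})"
      "integrable (PiM I (\<lambda>_. N01)) (\<lambda>x. measure N01 (sec x))"
      by (auto intro!: finite_measure.integrable_const_bound[OF finite_measure_SG, where B=1])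
    have "\<bar>measure (SG P) {w \<in> space (SG P). w(i := d n * w i + h n w) \<in> B} - measure (SG P) B\<bar>
      = \<bar>LINT x|PiM I (\<lambda>_. N01). measure N01 {y. d n * y + h n x \<in> sec x} - measure N01 (sec x)\<bar>"
      unfolding 1 2 using int by simp
    also have "\<dots> \<le> (LINT x|PiM I (\<lambda>_. N01). \<bar>measure N01 {y. d n * y + h n x \<in> sec x} - measure N01 (sec x)\<bar>)"
      by (rule integral_abs_bound)
    also have "\<dots> \<le> \<epsilon> n" unfolding \<epsilon>_def
    proof (rule integral_mono)
      show "integrable (PiM I (\<lambda>_. N01)) (\<lambda>w. normal_L1_dist (d n) (h n w))"
        by (intro finite_measure.integrable_const_bound[OF finite_measure_SG, where B=2]) (auto simp: normal_L1_dist_bounds d(2))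
    qed (use int affine_std_normal_tv d(2) in auto)
    finally show ?thesis .
  qed
  ultimately show ?thesis unfolding h_def by blast
qed

text \<open>
  An upper triangular map is the composition of updates of the coordinates \<open>0, 1, 2, \<dots>\<close>: the
  update of coordinate \<open>q\<close> reads only larger coordinates, which are still unchanged. Errors add
  up, since applying a further map to both laws does not increase their distance.
\<close>

lemma triangular_tv:
  fixes M :: "nat \<Rightarrow> nat \<Rightarrow> nat \<Rightarrow> real"
  assumes diag: "\<And>i. i < P \<Longrightarrow> (\<lambda>n. M n i i) \<longlonglongrightarrow> 1" "\<And>n i. i < P \<Longrightarrow> M n i i > 0"
    and off: "\<And>i j. i < j \<Longrightarrow> j < P \<Longrightarrow> (\<lambda>n. M n i j) \<longlonglongrightarrow> 0"
  shows "\<exists>\<epsilon>. \<epsilon> \<longlonglongrightarrow> 0 \<and> (\<forall>n. \<forall>B\<in>sets (SG P).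
    \<bar>measure (SG P) {w \<in> space (SG P). (\<lambda>i\<in>{..<P}. \<Sum>j\<in>{i..<P}. M n i j * w j) \<in> B} - measure (SG P) B\<bar> \<le> \<epsilon> n)"
proof -
  \<comment> \<open>The composition of the first \<open>q\<close> updates.\<close>
  define K where "K n q w = (\<lambda>i\<in>{..<P}. if i < q then \<Sum>j\<in>{i..<P}. M n i j * w j else w i)" for n q and w :: "nat \<Rightarrow> real"
  have K[measurable]: "K n q \<in> SG P \<rightarrow>\<^sub>M SG P" for n q
    unfolding K_def
  proof (rule measurable_restrict)
    fix i assume i: "i \<in> {..<P}"
    have "(\<lambda>w. if i < q then \<Sum>j\<in>{i..<P}. M n i j * w j else w i) \<in> borel_measurable (SG P)"
      using i by measurable
    then show "(\<lambda>w. if i < q then \<Sum>j\<in>{i..<P}. M n i j * w j else w i) \<in> SG P \<rightarrow>\<^sub>M N01" by simp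
  qed
  have "q \<le> P \<Longrightarrow> \<exists>\<epsilon>. \<epsilon> \<longlonglongrightarrow> 0 \<and> (\<forall>n. \<forall>B\<in>sets (SG P).
    \<bar>measure (SG P) {w \<in> space (SG P). K n q w \<in> B} - measure (SG P) B\<bar> \<le> \<epsilon> n)" for q
  proof (induction q)
    case 0
    have "K n 0 w = w" if "w \<in> space (SG P)" for n w
      using that by (auto simp: K_def space_PiM PiE_def extensional_def)
    then have "{w \<in> space (SG P). K n 0 w \<in> B} = B" if "B \<in> sets (SG P)" for n B
      using sets.sets_into_space[OF that] by auto
    then show ?case by (intro exI[of _ "\<lambda>_. 0"]) simp
  next
    case (Suc q)
    then obtain \<epsilon> where e: "\<epsilon> \<longlonglongrightarrow> 0" "\<And>n B. B \<in> sets (SG P) \<Longrightarrow>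
      \<bar>measure (SG P) {w \<in> space (SG P). K n q w \<in> B} - measure (SG P) B\<bar> \<le> \<epsilon> n" by auto
    have q: "q < P" using Suc by simp
    define U where "U n w = w(q := M n q q * w q + (\<Sum>j\<in>{Suc q..<P}. M n q j * w j))" for n and w :: "nat \<Rightarrow> real"
    have "\<exists>\<epsilon>'. \<epsilon>' \<longlonglongrightarrow> 0 \<and> (\<forall>n. \<forall>B\<in>sets (SG P).
      \<bar>measure (SG P) {w \<in> space (SG P). U n w \<in> B} - measure (SG P) B\<bar> \<le> \<epsilon>' n)"
      unfolding U_def by (rule coordinate_update_tv[OF q]) (use q diag off in auto)
    then obtain \<epsilon>' where e': "\<epsilon>' \<longlonglongrightarrow> 0" "\<And>n B. B \<in> sets (SG P) \<Longrightarrow>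
      \<bar>measure (SG P) {w \<in> space (SG P). U n w \<in> B} - measure (SG P) B\<bar> \<le> \<epsilon>' n" by auto
    have KU: "K n (Suc q) w = U n (K n q w)" if "w \<in> space (SG P)" for n w
    proof
      fix i
      show "K n (Suc q) w i = U n (K n q w) i"
        using q by (auto simp: K_def U_def sum.atLeast_Suc_lessThan less_Suc_eq intro!: sum.cong)
    qed
    have Um[measurable]: "U n \<in> SG P \<rightarrow>\<^sub>M SG P" for n
      unfolding U_def using q by (intro measurable_SG_update) measurable
    have "\<bar>measure (SG P) {w \<in> space (SG P). K n (Suc q) w \<in> B} - measure (SG P) B\<bar> \<le> \<epsilon> n + \<epsilon>' n"
      if B[measurable]: "B \<in> sets (SG P)" for n B
    proof -
      define B' where "B' = {w \<in> space (SG P). U n w \<in> B}"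
      have B': "B' \<in> sets (SG P)" unfolding B'_def by measurable
      have eq: "{w \<in> space (SG P). K n (Suc q) w \<in> B} = {w \<in> space (SG P). K n q w \<in> B'}"
        using measurable_space[OF K] by (auto simp: B'_def KU)
      show ?thesis using e(2)[OF B', of n] e'(2)[OF B, of n, folded B'_def] unfolding eq by linarith
    qed
    moreover have "(\<lambda>n. \<epsilon> n + \<epsilon>' n) \<longlonglongrightarrow> 0" using tendsto_add[OF e(1) e'(1)] by simp
    ultimately show ?case by (intro exI[of _ "\<lambda>n. \<epsilon> n + \<epsilon>' n"]) auto
  qed
  from this[of P] have "\<exists>\<epsilon>. \<epsilon> \<longlonglongrightarrow> 0 \<and> (\<forall>n. \<forall>B\<in>sets (SG P).
    \<bar>measure (SG P) {w \<in> space (SG P). K n P w \<in> B} - measure (SG P) B\<bar> \<le> \<epsilon> n)" by simp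
  moreover have "K n P w = (\<lambda>i\<in>{..<P}. \<Sum>j\<in>{i..<P}. M n i j * w j)" for n w
    unfolding K_def by (rule restrict_ext) simp
  ultimately show ?thesis by simp
qed

section \<open>Positive definite matrices and their leading blocks\<close>

definition pos_def_mat :: "nat \<Rightarrow> real mat \<Rightarrow> bool" where
  "pos_def_mat P R \<longleftrightarrow> R \<in> carrier_mat P P \<and> (\<forall>i<P. \<forall>j<P. R $$ (i, j) = R $$ (j, i)) \<and>
    (\<forall>x. (\<exists>i<P. x i \<noteq> 0) \<longrightarrow> (\<Sum>i<P. \<Sum>j<P. x i * R $$ (i, j) * x j) > 0)"

lemma sum_lessThan_zero_beyond:
  fixes f :: "nat \<Rightarrow> real"
  assumes "p \<le> P" "\<And>i. p \<le> i \<Longrightarrow> i < P \<Longrightarrow> f i = 0"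
  shows "(\<Sum>i<P. f i) = (\<Sum>i<p. f i)"
  using assms by (intro sum.mono_neutral_right) auto

lemma mult_mat_entry:
  fixes A B :: "real mat"
  assumes "A \<in> carrier_mat n m" "B \<in> carrier_mat m p" "i < n" "j < p"
  shows "(A * B) $$ (i, j) = (\<Sum>l<m. A $$ (i, l) * B $$ (l, j))"
  using assms by (simp add: scalar_prod_def atLeast0LessThan)

lemma pos_def_lead_block:
  assumes R: "pos_def_mat P R" and p: "p \<le> P"
  shows "pos_def_mat p (lead_block p R)"
  unfolding pos_def_mat_def
proof (intro conjI allI impI)
  fix x :: "nat \<Rightarrow> real" assume x: "\<exists>i<p. x i \<noteq> 0"
  define y where "y i = (if i < p then x i else 0)" for i
  have "(\<Sum>i<P. \<Sum>j<P. y i * R $$ (i, j) * y j) > 0"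
  proof -
    obtain i where "i < p" "x i \<noteq> 0" using x by blast
    then have "\<exists>i<P. y i \<noteq> 0" using p by (intro exI[of _ i]) (simp add: y_def)
    then show ?thesis using R unfolding pos_def_mat_def by blast
  qed
  also have "(\<Sum>i<P. \<Sum>j<P. y i * R $$ (i, j) * y j) = (\<Sum>i<p. \<Sum>j<p. y i * R $$ (i, j) * y j)"
    using p by (simp add: sum_lessThan_zero_beyond[OF p] y_def)
  also have "\<dots> = (\<Sum>i<p. \<Sum>j<p. x i * lead_block p R $$ (i, j) * x j)"
    by (intro sum.cong refl) (simp add: y_def lead_block_def)
  finally show "0 < (\<Sum>i<p. \<Sum>j<p. x i * lead_block p R $$ (i, j) * x j)" .
qed (use R p in \<open>auto simp: pos_def_mat_def lead_block_def\<close>)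

lemma minv_of_det_nonzero:
  assumes M: "M \<in> carrier_mat p p" "det M \<noteq> 0"
  shows "minv M \<in> carrier_mat p p" "M * minv M = 1\<^sub>m p" "minv M * M = 1\<^sub>m p"
proof -
  have "mat_inverse M \<noteq> None"
    using det_non_zero_imp_unit[OF M, where b="()"] mat_inverse(1)[OF M(1), where b="()"] by blast
  then obtain B where "mat_inverse M = Some B" by blast
  with mat_inverse(2)[OF M(1) this]
  show "minv M \<in> carrier_mat p p" "M * minv M = 1\<^sub>m p" "minv M * M = 1\<^sub>m p"
    by (auto simp: minv_def)
qed

lemma minv_eqI:
  assumes M: "M \<in> carrier_mat p p" and B: "B \<in> carrier_mat p p" "B * M = 1\<^sub>m p"
  shows "minv M = B"
proof -
  have "det B * det M = 1" using det_mult[OF B(1) M] B(2) by simp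
  then have "det M \<noteq> 0" by auto
  note C = minv_of_det_nonzero[OF M this]
  have "B = B * (M * minv M)" using B C by simp
  also have "\<dots> = (B * M) * minv M" by (rule assoc_mult_mat[symmetric, OF B(1) M C(1)])
  finally show ?thesis using B C by simp
qed

lemma minv_inverse:
  assumes S: "pos_def_mat p S"
  shows "minv S \<in> carrier_mat p p" "S * minv S = 1\<^sub>m p" "minv S * S = 1\<^sub>m p" "det S \<noteq> 0"
proof -
  have Sc: "S \<in> carrier_mat p p" using S by (simp add: pos_def_mat_def)
  show det: "det S \<noteq> 0"
  proof
    assume "det S = 0"
    then obtain x where x: "x \<in> carrier_vec p" "x \<noteq> 0\<^sub>v p" "S *\<^sub>v x = 0\<^sub>v p"
      using det_0_iff_vec_prod_zero[OF Sc] by auto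
    have row: "(\<Sum>j<p. S $$ (i, j) * x $ j) = 0" if "i < p" for i
    proof -
      have "(S *\<^sub>v x) $ i = (\<Sum>j<p. S $$ (i, j) * x $ j)"
        using that Sc x(1) by (simp add: scalar_prod_def atLeast0LessThan)
      then show ?thesis using x(3) that by simp
    qed
    have "\<exists>i<p. x $ i \<noteq> 0"
    proof (rule ccontr)
      assume "\<not> ?thesis"
      then have "x = 0\<^sub>v p" using x(1) by (intro eq_vecI) auto
      then show False using x(2) by simp
    qed
    then have "(\<Sum>i<p. \<Sum>j<p. x $ i * S $$ (i, j) * x $ j) > 0"
      using S unfolding pos_def_mat_def by blast
    moreover have "(\<Sum>i<p. \<Sum>j<p. x $ i * S $$ (i, j) * x $ j) = (\<Sum>i<p. x $ i * (\<Sum>j<p. S $$ (i, j) * x $ j))"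
      by (simp add: sum_distrib_left mult_ac)
    ultimately show False by (simp add: row)
  qed
  show "minv S \<in> carrier_mat p p" "S * minv S = 1\<^sub>m p" "minv S * S = 1\<^sub>m p"
    by (rule minv_of_det_nonzero[OF Sc det])+
qed

text \<open>
  Column \<open>q\<close> is the last column of the inverse of the leading block of order \<open>q + 1\<close>, padded by
  zeros and divided by \<open>\<xi>\<close>. The columns form the upper triangular matrix \<open>V\<close> with \<open>V\<^sup>T R V = 1\<close>;
  all leading blocks of it are again of this kind, which is why one matrix serves all candidate
  models.
\<close>

definition inv_factor :: "(nat \<Rightarrow> real mat) \<Rightarrow> nat \<Rightarrow> nat \<Rightarrow> real" where
  "inv_factor S i q = (if i \<le> q then minv (S (Suc q)) $$ (i, q) / xi S (Suc q) else 0)"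

locale leading_blocks =
  fixes P :: nat and R :: "real mat" and S :: "nat \<Rightarrow> real mat"
  assumes R: "pos_def_mat P R"
    and S: "\<And>p. 1 \<le> p \<Longrightarrow> p \<le> P \<Longrightarrow> S p = lead_block p R"
begin

abbreviation v :: "nat \<Rightarrow> nat \<Rightarrow> real" where "v \<equiv> inv_factor S"

lemma R_sym: "i < P \<Longrightarrow> j < P \<Longrightarrow> R $$ (i, j) = R $$ (j, i)"
  using R by (auto simp: pos_def_mat_def)

lemma S_pos_def: "1 \<le> p \<Longrightarrow> p \<le> P \<Longrightarrow> pos_def_mat p (S p)"
  using S pos_def_lead_block[OF R] by simp

lemma S_carrier: "1 \<le> p \<Longrightarrow> p \<le> P \<Longrightarrow> S p \<in> carrier_mat p p"
  using S by (simp add: lead_block_def)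

lemma S_entry: "i < p \<Longrightarrow> j < p \<Longrightarrow> p \<le> P \<Longrightarrow> S p $$ (i, j) = R $$ (i, j)"
  using S[of p] by (simp add: lead_block_def)

lemma minv_column:
  assumes "q < P" "i \<le> q"
  shows "(\<Sum>l\<le>q. R $$ (i, l) * minv (S (Suc q)) $$ (l, q)) = (if i = q then 1 else 0)"
proof -
  have p: "1 \<le> Suc q" "Suc q \<le> P" using assms by auto
  note m = minv_inverse[OF S_pos_def[OF p]] and c = S_carrier[OF p]
  have "(S (Suc q) * minv (S (Suc q))) $$ (i, q) = (\<Sum>l<Suc q. S (Suc q) $$ (i, l) * minv (S (Suc q)) $$ (l, q))"
    using m(1) c assms by (simp add: scalar_prod_def atLeast0LessThan)
  also have "\<dots> = (\<Sum>l<Suc q. R $$ (i, l) * minv (S (Suc q)) $$ (l, q))"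
    using assms p by (intro sum.cong refl) (simp add: S_entry)
  finally show ?thesis using m(2) assms by (simp add: lessThan_Suc_atMost)
qed

text \<open>
  With \<open>u\<close> the last column of the inverse, \<open>R u\<close> is a unit vector on the block, so the quadratic
  form of \<open>R\<close> at \<open>u\<close> is the last entry of \<open>u\<close>.
\<close>

lemma minv_corner_pos:
  assumes q: "q < P" shows "minv (S (Suc q)) $$ (q, q) > 0"
proof -
  define u where "u l = minv (S (Suc q)) $$ (l, q)" for l
  define y where "y l = (if l \<le> q then u l else 0)" for l
  have col: "(\<Sum>l\<le>q. R $$ (i, l) * u l) = (if i = q then 1 else 0)" if "i \<le> q" for i
    using minv_column[OF q that] by (simp add: u_def)
  have "\<exists>i<P. y i \<noteq> 0"
  proof (rule ccontr)
    assume "\<not> ?thesis"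
    then have "\<And>l. l \<le> q \<Longrightarrow> u l = 0" using q unfolding y_def by (metis order_le_less_trans)
    then have "(\<Sum>l\<le>q. R $$ (q, l) * u l) = 0" by simp
    then show False using col[of q] by simp
  qed
  then have "0 < (\<Sum>i<P. \<Sum>l<P. y i * R $$ (i, l) * y l)"
    using R unfolding pos_def_mat_def by blast
  also have "\<dots> = (\<Sum>i<Suc q. \<Sum>l<Suc q. y i * R $$ (i, l) * y l)"
    using q by (simp add: sum_lessThan_zero_beyond[of "Suc q" P] y_def)
  also have "\<dots> = (\<Sum>i\<le>q. u i * (\<Sum>l\<le>q. R $$ (i, l) * u l))"
    unfolding lessThan_Suc_atMost by (auto simp: sum_distrib_left y_def mult_ac intro!: sum.cong)
  also have "\<dots> = (\<Sum>i\<le>q. if i = q then u q else 0)"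
    by (intro sum.cong refl) (simp add: col)
  also have "\<dots> = u q" by (simp add: sum.delta)
  finally show ?thesis by (simp add: u_def)
qed

lemma xi_pos: "q < P \<Longrightarrow> xi S (Suc q) > 0"
  using minv_corner_pos by (simp add: xi_def)

lemma v_diag: "q < P \<Longrightarrow> v q q = xi S (Suc q)"
  using minv_corner_pos[of q] by (simp add: inv_factor_def xi_def real_div_sqrt)

lemma v_upper: "q < i \<Longrightarrow> v i q = 0"
  by (simp add: inv_factor_def)

lemma R_v:
  assumes "q < P" "i \<le> q"
  shows "(\<Sum>l<P. R $$ (i, l) * v l q) = (if i = q then 1 / xi S (Suc q) else 0)"
proof -
  have "(\<Sum>l<P. R $$ (i, l) * v l q) = (\<Sum>l<Suc q. R $$ (i, l) * v l q)"
    using assms by (intro sum_lessThan_zero_beyond) (auto simp: v_upper)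
  also have "\<dots> = (\<Sum>l\<le>q. R $$ (i, l) * minv (S (Suc q)) $$ (l, q)) / xi S (Suc q)"
    unfolding lessThan_Suc_atMost sum_divide_distrib by (intro sum.cong refl) (simp add: inv_factor_def)
  finally show ?thesis using minv_column[OF assms] by simp
qed

text \<open>
  For \<open>q \<le> q'\<close> the vector \<open>R V\<^sub>q\<^sub>'\<close> vanishes in all positions below \<open>q'\<close>, whereas \<open>V\<^sub>q\<close> is
  supported on positions up to \<open>q\<close>.
\<close>

lemma v_orthonormal:
  assumes "q < P" "q' < P"
  shows "(\<Sum>i<P. \<Sum>l<P. v i q * R $$ (i, l) * v l q') = (if q = q' then 1 else 0)"
proof -
  have le: "(\<Sum>i<P. \<Sum>l<P. v i q * R $$ (i, l) * v l q') = (if q = q' then 1 else 0)"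
    if "q \<le> q'" "q' < P" for q q'
  proof -
    have "(\<Sum>i<P. \<Sum>l<P. v i q * R $$ (i, l) * v l q') = (\<Sum>i<P. v i q * (\<Sum>l<P. R $$ (i, l) * v l q'))"
      by (simp add: sum_distrib_left mult_ac)
    also have "\<dots> = (\<Sum>i<P. if i = q' then v q' q / xi S (Suc q') else 0)"
    proof (intro sum.cong refl)
      fix i
      show "v i q * (\<Sum>l<P. R $$ (i, l) * v l q') = (if i = q' then v q' q / xi S (Suc q') else 0)"
      proof (cases "i \<le> q'")
        case True then show ?thesis using R_v[OF that(2) True] by simp
      next
        case False then show ?thesis using that v_upper[of q i] by simp
      qed
    qed
    also have "\<dots> = v q' q / xi S (Suc q')" using that by (simp add: sum.delta)
    also have "\<dots> = (if q = q' then 1 else 0)"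
      using that v_diag[of q'] xi_pos[of q'] v_upper[of q q'] by auto
    finally show ?thesis .
  qed
  show ?thesis
  proof (cases "q \<le> q'")
    case True then show ?thesis using le assms by blast
  next
    case False
    have "(\<Sum>i<P. \<Sum>l<P. v i q * R $$ (i, l) * v l q') = (\<Sum>l<P. \<Sum>i<P. v l q' * R $$ (l, i) * v i q)"
      by (subst sum.swap, intro sum.cong refl) (simp add: R_sym mult_ac)
    then show ?thesis using le[of q' q] False assms by simp
  qed
qed

lemma minv_eq:
  assumes p: "1 \<le> p" "p \<le> P" and ij: "i < p" "j < p"
  shows "minv (S p) $$ (i, j) = (\<Sum>q<p. v i q * v j q)"
proof -
  define V where "V = mat p p (\<lambda>(i, q). v i q)"
  have V: "V \<in> carrier_mat p p" by (simp add: V_def)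
  have Sp: "S p \<in> carrier_mat p p" using S_carrier p by simp
  have 1: "V\<^sup>T * (S p * V) = 1\<^sub>m p"
  proof (rule eq_matI)
    fix q q' assume "q < dim_row (1\<^sub>m p)" "q' < dim_col (1\<^sub>m p)"
    then have q: "q < p" "q' < p" by auto
    have "(V\<^sup>T * (S p * V)) $$ (q, q') = (\<Sum>i<p. v i q * (\<Sum>l<p. R $$ (i, l) * v l q'))"
      using q V Sp p by (simp add: scalar_prod_def atLeast0LessThan V_def S_entry)
    also have "\<dots> = (\<Sum>i<p. \<Sum>l<p. v i q * R $$ (i, l) * v l q')"
      by (simp add: sum_distrib_left mult_ac)
    also have "\<dots> = (\<Sum>i<P. \<Sum>l<P. v i q * R $$ (i, l) * v l q')"
      using q p by (simp add: sum_lessThan_zero_beyond[of p P] v_upper)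
    finally show "(V\<^sup>T * (S p * V)) $$ (q, q') = 1\<^sub>m p $$ (q, q')"
      using q p v_orthonormal[of q q'] by simp
  qed (use V Sp in auto)
  have "(V\<^sup>T * S p) * V = 1\<^sub>m p"
    using 1 V Sp by (simp add: assoc_mult_mat[of "V\<^sup>T" p p "S p" p V p])
  then have "V * (V\<^sup>T * S p) = 1\<^sub>m p"
    using V Sp by (intro mat_mult_left_right_inverse[of "V\<^sup>T * S p" p V]) auto
  then have "(V * V\<^sup>T) * S p = 1\<^sub>m p"
    using V Sp by (simp add: assoc_mult_mat[of V p p "V\<^sup>T" p "S p" p])
  then have "minv (S p) = V * V\<^sup>T"
    using V by (intro minv_eqI[OF Sp]) auto
  then show ?thesis using ij by (simp add: V_def scalar_prod_def atLeast0LessThan)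
qed

lemma v_v_R:
  assumes ij: "i < P" "j < P"
  shows "(\<Sum>q<P. v i q * (\<Sum>l<P. v l q * R $$ (l, j))) = (if i = j then 1 else 0)"
proof -
  have p: "1 \<le> P" "P \<le> P" using ij by auto
  have Sp: "S P \<in> carrier_mat P P" using S_carrier p by simp
  note m = minv_inverse[OF S_pos_def[OF p]]
  have "(\<Sum>q<P. v i q * (\<Sum>l<P. v l q * R $$ (l, j))) = (\<Sum>q<P. \<Sum>l<P. v i q * v l q * R $$ (l, j))"
    by (simp add: sum_distrib_left mult_ac)
  also have "\<dots> = (\<Sum>l<P. \<Sum>q<P. v i q * v l q * R $$ (l, j))" by (rule sum.swap)
  also have "\<dots> = (\<Sum>l<P. minv (S P) $$ (i, l) * S P $$ (l, j))"
    using ij by (intro sum.cong refl) (simp add: minv_eq S_entry sum_distrib_right)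
  also have "\<dots> = (minv (S P) * S P) $$ (i, j)"
    using ij m(1) Sp by (simp add: scalar_prod_def atLeast0LessThan)
  finally show ?thesis using m(3) ij by simp
qed

end

text \<open>
  After row reduction \<open>C = P B\<close>, the matrix that sends the \<open>i\<close>-th unit vector to the unit vector
  at the pivot of row \<open>i\<close> is a generalized inverse \<open>H\<close> of \<open>C\<close>, and \<open>H P\<close> is one of \<open>B\<close>.
\<close>

lemma generalized_inverse_exists:
  fixes B :: "real mat"
  assumes B: "B \<in> carrier_mat n m"
  shows "\<exists>B'. B' \<in> carrier_mat m n \<and> B * B' * B = B"
proof -
  define C where "C = gauss_jordan_single B"
  note gj = gauss_jordan_single[OF B, of C]
  have C: "C \<in> carrier_mat n m" using gj(2) C_def by simp
  obtain P Q where PQ: "C = P * B" "P \<in> carrier_mat n n" "Q \<in> carrier_mat n n" "P * Q = 1\<^sub>m n" "Q * P = 1\<^sub>m n"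
    using gj(4) C_def by metis
  obtain f where "pivot_fun C f m" using gj(3) C_def C unfolding row_echelon_form_def by auto
  note f = pivot_funD[OF _ this, of n]
  define H where "H = mat m n (\<lambda>(j, i). if f i = j then 1 else 0 :: real)"
  have H: "H \<in> carrier_mat m n" by (simp add: H_def)
  have dimC: "dim_row C = n" using C by simp
  have CH: "(C * H) $$ (i, i') = (if f i' < m \<and> i = i' then 1 else 0)" if "i < n" "i' < n" for i i'
  proof -
    have "(C * H) $$ (i, i') = (\<Sum>j<m. C $$ (i, j) * (if f i' = j then 1 else 0))"
      using that C H by (simp add: scalar_prod_def atLeast0LessThan H_def)
    also have "\<dots> = (\<Sum>j<m. if j = f i' then C $$ (i, f i') else 0)" by (intro sum.cong) auto
    also have "\<dots> = (if f i' < m then C $$ (i, f i') else 0)" by (simp add: sum.delta)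
    finally show ?thesis using f(4)[OF dimC that(2)] f(5)[OF dimC that(2), of i] that by auto
  qed
  have CHC: "C * H * C = C"
  proof (rule eq_matI)
    fix i j assume "i < dim_row C" "j < dim_col C"
    then have ij: "i < n" "j < m" using C by auto
    have "(C * H * C) $$ (i, j) = (\<Sum>i'<n. (C * H) $$ (i, i') * C $$ (i', j))"
      by (rule mult_mat_entry[OF mult_carrier_mat[OF C H] C ij])
    also have "\<dots> = (\<Sum>i'<n. if i' = i then (if f i < m then C $$ (i, j) else 0) else 0)"
      using ij by (intro sum.cong refl) (auto simp: CH simp del: index_mult_mat(1))
    also have "\<dots> = (if f i < m then C $$ (i, j) else 0)" using ij by (simp add: sum.delta)
    also have "\<dots> = C $$ (i, j)" using f(1)[OF dimC ij(1)] f(2)[OF dimC ij(1), of j] ij by auto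
    finally show "(C * H * C) $$ (i, j) = C $$ (i, j)" .
  qed (use C H in auto)
  have "B = Q * C" using PQ B by (simp add: assoc_mult_mat[of Q n n P n B m, symmetric])
  have QHC: "Q * (C * H * C) = (Q * C) * (H * P) * (Q * C)"
  proof -
    have QC: "Q * C \<in> carrier_mat n m" using PQ C by simp
    have "P * (Q * C) = P * Q * C" by (rule assoc_mult_mat[symmetric]) (use PQ C in auto)
    then have PQC: "P * (Q * C) = C" using PQ(4) C by simp
    have "(Q * C) * (H * P) * (Q * C) = (Q * C) * ((H * P) * (Q * C))"
      by (rule assoc_mult_mat) (use QC H PQ in auto)
    also have "(H * P) * (Q * C) = H * (P * (Q * C))"
      by (rule assoc_mult_mat) (use QC H PQ in auto)
    also have "\<dots> = H * C" by (simp only: PQC)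
    also have "(Q * C) * (H * C) = Q * (C * (H * C))"
      by (rule assoc_mult_mat[OF PQ(3) C mult_carrier_mat[OF H C]])
    also have "C * (H * C) = C * H * C"
      by (rule assoc_mult_mat[OF C H C, symmetric])
    finally show ?thesis by simp
  qed
  then have "B * (H * P) * B = B" using CHC \<open>B = Q * C\<close> by simp
  moreover have "H * P \<in> carrier_mat m n" using H PQ(2) by simp
  ultimately show ?thesis by blast
qed

lemma ginv:
  assumes "B \<in> carrier_mat n m"
  shows "ginv B \<in> carrier_mat m n" "B * ginv B * B = B"
  using someI_ex[OF generalized_inverse_exists[OF assms]] assms by (auto simp: ginv_def)

lemma mult_transpose_eq_0:
  fixes D :: "real mat"
  assumes D: "D \<in> carrier_mat n m" and 0: "D * D\<^sup>T = 0\<^sub>m n n"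
  shows "D = 0\<^sub>m n m"
proof (rule eq_matI)
  fix i j assume "i < dim_row (0\<^sub>m n m)" "j < dim_col (0\<^sub>m n m)"
  then have ij: "i < n" "j < m" by auto
  have "(\<Sum>j<m. (D $$ (i, j))\<^sup>2) = (D * D\<^sup>T) $$ (i, i)"
    using ij D by (simp add: scalar_prod_def atLeast0LessThan power2_eq_square)
  also have "\<dots> = 0" using 0 ij by simp
  finally have "(D $$ (i, j))\<^sup>2 = 0" using ij by (subst (asm) sum_nonneg_eq_0_iff) auto
  then show "D $$ (i, j) = 0\<^sub>m n m $$ (i, j)" using ij by simp
qed (use D in auto)

text \<open>
  The difference \<open>D\<close> of both sides satisfies \<open>D F\<^sup>T = 0\<close>, because the transpose of a generalized
  inverse of a symmetric matrix is again one; then \<open>D D\<^sup>T = 0\<close>. Thus all generalized inverses act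
  alike on the range of \<open>F\<close>, and their choice in \<^const>\<open>bvec\<close> is immaterial.
\<close>

lemma ginv_transpose_mult:
  fixes F :: "real mat"
  assumes F: "F \<in> carrier_mat k p"
  shows "(F * F\<^sup>T) * (ginv (F * F\<^sup>T))\<^sup>T * F = F"
proof -
  define B where "B = F * F\<^sup>T"
  define G where "G = ginv B"
  have B: "B \<in> carrier_mat k k" using F by (simp add: B_def)
  have Bs: "B\<^sup>T = B" using F by (simp add: B_def transpose_mult[of F k p "F\<^sup>T" k])
  have G: "G \<in> carrier_mat k k" "B * G * B = B" using ginv[OF B] by (auto simp: G_def)
  have GT: "G\<^sup>T \<in> carrier_mat k k" using G by simp
  have BGB: "B * G\<^sup>T * B = B"
  proof -
    have "(B * G * B)\<^sup>T = B\<^sup>T * (B * G)\<^sup>T"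
      by (rule transpose_mult[of _ k k]) (use B G in auto)
    also have "(B * G)\<^sup>T = G\<^sup>T * B\<^sup>T"
      by (rule transpose_mult[of _ k k]) (use B G in auto)
    finally have "B = B * (G\<^sup>T * B)" using G(2) Bs by simp
    also have "\<dots> = B * G\<^sup>T * B"
      by (rule assoc_mult_mat[symmetric]) (use B GT in auto)
    finally show ?thesis by simp
  qed
  define D where "D = B * G\<^sup>T * F - F"
  have BGF: "B * G\<^sup>T * F \<in> carrier_mat k p" using B GT F by auto
  have D: "D \<in> carrier_mat k p" unfolding D_def by (rule minus_carrier_mat[OF F])
  have FT: "F\<^sup>T \<in> carrier_mat p k" using F by simp
  have DF: "D * F\<^sup>T = 0\<^sub>m k k"
  proof -
    have "D * F\<^sup>T = B * G\<^sup>T * F * F\<^sup>T - F * F\<^sup>T"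
      unfolding D_def by (rule minus_mult_distrib_mat[OF BGF F FT])
    also have "B * G\<^sup>T * F * F\<^sup>T = B * G\<^sup>T * B"
      unfolding B_def by (rule assoc_mult_mat) (use F GT in auto)
    finally show ?thesis using BGB B by (simp add: B_def)
  qed
  have "D * D\<^sup>T = 0\<^sub>m k k"
  proof -
    have "D\<^sup>T = F\<^sup>T * (B * G\<^sup>T)\<^sup>T - F\<^sup>T"
    proof -
      have "(B * G\<^sup>T * F)\<^sup>T = F\<^sup>T * (B * G\<^sup>T)\<^sup>T"
        by (rule transpose_mult[of _ k k]) (use B GT F in auto)
      then show ?thesis unfolding D_def by (simp only: transpose_minus[OF BGF F])
    qed
    then have "D * D\<^sup>T = D * (F\<^sup>T * (B * G\<^sup>T)\<^sup>T) - D * F\<^sup>T"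
      using D FT B GT by (simp add: mult_minus_distrib_mat[of D k p "F\<^sup>T * (B * G\<^sup>T)\<^sup>T" k "F\<^sup>T"])
    also have "D * (F\<^sup>T * (B * G\<^sup>T)\<^sup>T) = D * F\<^sup>T * (B * G\<^sup>T)\<^sup>T"
      using D FT B GT by (intro assoc_mult_mat[symmetric]) auto
    finally show ?thesis using DF B GT by simp
  qed
  from mult_transpose_eq_0[OF D this] have D0: "D = 0\<^sub>m k p" .
  show ?thesis
  proof (rule eq_matI)
    fix i j assume ij: "i < dim_row F" "j < dim_col F"
    have "D $$ (i, j) = (B * G\<^sup>T * F) $$ (i, j) - F $$ (i, j)"
      using ij BGF F unfolding D_def by (intro index_minus_mat) auto
    then show "(F * F\<^sup>T * (ginv (F * F\<^sup>T))\<^sup>T * F) $$ (i, j) = F $$ (i, j)"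
      using D0 ij F unfolding B_def G_def by simp
  qed (use F BGF in \<open>auto simp: B_def G_def\<close>)
qed


text \<open>The entries of \<open>A V\<close>: the coefficients of the coordinates in the target.\<close>

definition loading :: "nat \<Rightarrow> real mat \<Rightarrow> (nat \<Rightarrow> real mat) \<Rightarrow> nat \<Rightarrow> nat \<Rightarrow> real" where
  "loading P A S a q = (\<Sum>i<P. A $$ (a, i) * inv_factor S i q)"

locale leading_blocks_target = leading_blocks +
  fixes A :: "real mat" and k :: nat
  assumes A: "A \<in> carrier_mat k P"
begin

abbreviation F :: "nat \<Rightarrow> nat \<Rightarrow> real" where "F \<equiv> loading P A S"

lemma F_eq:
  assumes "q < p" "p \<le> P"
  shows "F a q = (\<Sum>i<p. A $$ (a, i) * v i q)"
  unfolding loading_def using assms by (intro sum_lessThan_zero_beyond) (auto simp: v_upper)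

lemma Cvec_eq:
  assumes p: "1 \<le> p" "p \<le> P"
  shows "Cvec A S p = vec k (\<lambda>a. xi S p * F a (p - 1))"
proof (rule eq_vecI)
  fix a assume "a < dim_vec (vec k (\<lambda>a. xi S p * F a (p - 1)))"
  then have a: "a < k" by simp
  note m = minv_inverse[OF S_pos_def[OF p]]
  have q: "p - 1 < p" "p - 1 < P" using p by auto
  have col: "(minv (S p) *\<^sub>v unit_vec p (p - 1)) $ i = xi S p * v i (p - 1)" if "i < p" for i
  proof -
    have "(minv (S p) *\<^sub>v unit_vec p (p - 1)) $ i = minv (S p) $$ (i, p - 1)"
      using m(1) q that by simp
    also have "\<dots> = xi S p * v i (p - 1)"
      using xi_pos[OF q(2)] that p by (auto simp: inv_factor_def)
    finally show ?thesis .
  qed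
  have "Cvec A S p $ a = (\<Sum>i<p. A $$ (a, i) * (minv (S p) *\<^sub>v unit_vec p (p - 1)) $ i)"
    using A m(1) a by (simp add: Cvec_def first_cols_def scalar_prod_def atLeast0LessThan)
  also have "\<dots> = (\<Sum>i<p. A $$ (a, i) * (xi S p * v i (p - 1)))"
    by (intro sum.cong refl) (simp only: col lessThan_iff)
  also have "\<dots> = xi S p * F a (p - 1)"
    unfolding F_eq[OF q(1) p(2)] sum_distrib_left by (intro sum.cong refl) (simp only: mult_ac)
  finally show "Cvec A S p $ a = vec k (\<lambda>a. xi S p * F a (p - 1)) $ a" using a by simp
qed (use A in \<open>simp add: Cvec_def first_cols_def\<close>)

definition Fmat :: "nat \<Rightarrow> real mat" where
  "Fmat p = mat k p (\<lambda>(a, q). F a q)"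

lemma Fmat_carrier: "Fmat p \<in> carrier_mat k p"
  by (simp add: Fmat_def)

lemma avar_eq:
  assumes p: "1 \<le> p" "p \<le> P"
  shows "avar A S p = Fmat p * (Fmat p)\<^sup>T"
proof -
  note m = minv_inverse[OF S_pos_def[OF p]]
  define V where "V = mat p p (\<lambda>(i, q). v i q)"
  define Ap where "Ap = first_cols p A"
  have V: "V \<in> carrier_mat p p" and Ap: "Ap \<in> carrier_mat k p"
    using A by (simp_all add: V_def Ap_def first_cols_def)
  have "minv (S p) = V * V\<^sup>T"
    using m(1) minv_eq[OF p] V by (intro eq_matI) (auto simp: V_def scalar_prod_def atLeast0LessThan)
  moreover have "Fmat p = Ap * V"
  proof (rule eq_matI)
    fix a q assume "a < dim_row (Ap * V)" "q < dim_col (Ap * V)"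
    then have "a < k" "q < p" using Ap V by auto
    then show "Fmat p $$ (a, q) = (Ap * V) $$ (a, q)"
      using mult_mat_entry[OF Ap V, of a q] A p
      by (simp add: Fmat_def F_eq Ap_def V_def first_cols_def)
  qed (use Ap V in \<open>auto simp: Fmat_def\<close>)
  moreover have "(Ap * V) * (Ap * V)\<^sup>T = Ap * (V * V\<^sup>T) * Ap\<^sup>T"
  proof -
    have "(Ap * V)\<^sup>T = V\<^sup>T * Ap\<^sup>T" by (rule transpose_mult[OF Ap V])
    then have "(Ap * V) * (Ap * V)\<^sup>T = (Ap * V) * (V\<^sup>T * Ap\<^sup>T)" by simp
    also have "\<dots> = (Ap * V * V\<^sup>T) * Ap\<^sup>T"
      by (rule assoc_mult_mat[symmetric, of _ k p _ p _ k]) (use Ap V in auto)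
    also have "Ap * V * V\<^sup>T = Ap * (V * V\<^sup>T)"
      by (rule assoc_mult_mat[of _ k p _ p _ p]) (use Ap V in auto)
    finally show ?thesis .
  qed
  ultimately show ?thesis by (simp add: avar_def Ap_def)
qed

lemma bvec_carrier:
  assumes p: "1 \<le> p" "p \<le> P"
  shows "bvec A S p \<in> carrier_vec k"
proof -
  have "avar A S p \<in> carrier_mat k k" using avar_eq[OF p] Fmat_carrier[of p] by auto
  from ginv(1)[OF this] show ?thesis
    using Cvec_eq[OF p] unfolding bvec_def by (intro mult_mat_vec_carrier[of _ k k]) auto
qed

text \<open>
  The normal equations: in terms of the coefficient vector \<open>g = F\<^sup>T b\<close> of \<open>b \<bullet> Z\<close>, the linear
  forms \<open>b \<bullet> Z\<close> and \<open>\<xi> W\<^sub>p\<^sub>-\<^sub>1\<close> have the same covariances with the partial sum \<open>Z\<close>.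
\<close>

lemma bvec_regression:
  assumes p: "1 \<le> p" "p \<le> P" and a: "a < k"
  shows "(\<Sum>q<p. (\<Sum>c<k. bvec A S p $ c * F c q) * F a q) = xi S p * F a (p - 1)"
proof -
  let ?F = "Fmat p" and ?G = "(ginv (avar A S p))\<^sup>T"
  have F: "?F \<in> carrier_mat k p" by (rule Fmat_carrier)
  have B: "avar A S p \<in> carrier_mat k k" using avar_eq[OF p] F by auto
  have G: "?G \<in> carrier_mat k k" using ginv(1)[OF B] by simp
  have q: "p - 1 < p" using p by auto
  have bc: "bvec A S p \<in> carrier_vec k" by (rule bvec_carrier[OF p])
  have Cv: "Cvec A S p = ?F *\<^sub>v (xi S p \<cdot>\<^sub>v unit_vec p (p - 1))"
  proof (rule eq_vecI)
    fix a assume "a < dim_vec (?F *\<^sub>v (xi S p \<cdot>\<^sub>v unit_vec p (p - 1)))"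
    then have a: "a < k" using F by simp
    have "(?F *\<^sub>v (xi S p \<cdot>\<^sub>v unit_vec p (p - 1))) $ a = xi S p * ?F $$ (a, p - 1)"
      using a q F by (simp add: mult_mat_vec[OF F])
    then show "Cvec A S p $ a = (?F *\<^sub>v (xi S p \<cdot>\<^sub>v unit_vec p (p - 1))) $ a"
      using a q by (simp add: Cvec_eq[OF p] Fmat_def)
  qed (use F in \<open>simp add: Cvec_eq[OF p]\<close>)
  let ?w = "xi S p \<cdot>\<^sub>v unit_vec p (p - 1)"
  have w: "?w \<in> carrier_vec p" by simp
  have "avar A S p *\<^sub>v bvec A S p = (avar A S p * ?G * ?F) *\<^sub>v ?w"
  proof -
    have "avar A S p *\<^sub>v (?G *\<^sub>v (?F *\<^sub>v ?w)) = (avar A S p * ?G) *\<^sub>v (?F *\<^sub>v ?w)"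
      by (rule assoc_mult_mat_vec[symmetric, OF B G]) (use F w in auto)
    also have "\<dots> = (avar A S p * ?G * ?F) *\<^sub>v ?w"
      by (rule assoc_mult_mat_vec[symmetric, OF mult_carrier_mat[OF B G] F w])
    finally show ?thesis unfolding bvec_def Cv .
  qed
  also have "\<dots> = Cvec A S p"
    using ginv_transpose_mult[OF F] Cv by (simp only: avar_eq[OF p])
  finally have key: "avar A S p *\<^sub>v bvec A S p = Cvec A S p" .
  have "(\<Sum>q<p. (\<Sum>c<k. bvec A S p $ c * F c q) * F a q) = (\<Sum>c<k. (\<Sum>q<p. F a q * F c q) * bvec A S p $ c)"
    unfolding sum_distrib_right by (subst sum.swap) (simp add: mult_ac)
  also have "\<dots> = (\<Sum>c<k. avar A S p $$ (a, c) * bvec A S p $ c)"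
    using a mult_mat_entry[OF F, of "?F\<^sup>T" k a] F
    by (intro sum.cong refl) (simp add: avar_eq[OF p] Fmat_def scalar_prod_def atLeast0LessThan)
  also have "\<dots> = (avar A S p *\<^sub>v bvec A S p) $ a"
    using a B bc by (simp add: scalar_prod_def atLeast0LessThan)
  finally show ?thesis using key a by (simp add: Cvec_eq[OF p])
qed

text \<open>
  \<open>\<zeta>\<^sup>2\<close> is the squared length of \<open>\<xi> e\<^sub>p\<^sub>-\<^sub>1 - g\<close>, hence the square root in its definition is never
  taken of a negative number.
\<close>

lemma zeta_squared:
  assumes p: "1 \<le> p" "p \<le> P"
  defines "g \<equiv> \<lambda>q. \<Sum>c<k. bvec A S p $ c * F c q"
  shows "(zeta A S p)\<^sup>2 = (xi S p)\<^sup>2 - xi S p * g (p - 1)"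
    and "(\<Sum>q<p. (g q)\<^sup>2) = xi S p * g (p - 1)" and "0 \<le> zeta A S p"
proof -
  have reg: "(\<Sum>q<p. g q * F a q) = xi S p * F a (p - 1)" if "a < k" for a
    using bvec_regression[OF p that] by (simp add: g_def)
  have bc: "bvec A S p \<in> carrier_vec k" by (rule bvec_carrier[OF p])
  have bC: "bvec A S p \<bullet> Cvec A S p = xi S p * g (p - 1)"
    using bc by (simp add: Cvec_eq[OF p] scalar_prod_def atLeast0LessThan g_def sum_distrib_left mult_ac)
  have "(\<Sum>q<p. (g q)\<^sup>2) = (\<Sum>q<p. \<Sum>c<k. bvec A S p $ c * (g q * F c q))"
    by (simp add: power2_eq_square g_def sum_distrib_left mult_ac)
  also have "\<dots> = (\<Sum>c<k. bvec A S p $ c * (\<Sum>q<p. g q * F c q))"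
    by (subst sum.swap) (simp add: sum_distrib_left)
  also have "\<dots> = (\<Sum>c<k. bvec A S p $ c * (xi S p * F c (p - 1)))"
    by (intro sum.cong refl) (simp add: reg)
  also have "\<dots> = xi S p * g (p - 1)" by (simp add: g_def sum_distrib_left mult_ac)
  finally show sq: "(\<Sum>q<p. (g q)\<^sup>2) = xi S p * g (p - 1)" .
  have "0 \<le> (\<Sum>q<p. (xi S p * (if q = p - 1 then 1 else 0) - g q)\<^sup>2)" by (intro sum_nonneg) simp
  also have "\<dots> = (\<Sum>q<p. (if q = p - 1 then (xi S p)\<^sup>2 - 2 * xi S p * g q else 0)) + (\<Sum>q<p. (g q)\<^sup>2)"
    unfolding sum.distrib[symmetric]
    by (intro sum.cong refl) (simp add: power2_eq_square algebra_simps)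
  also have "\<dots> = (xi S p)\<^sup>2 - xi S p * g (p - 1)"
    using p by (simp add: sq sum.delta)
  finally have nn: "0 \<le> (xi S p)\<^sup>2 - xi S p * g (p - 1)" .
  show "(zeta A S p)\<^sup>2 = (xi S p)\<^sup>2 - xi S p * g (p - 1)" "0 \<le> zeta A S p"
    using nn by (simp_all add: zeta_def bC)
qed

end

section \<open>Continuity of the inverse, and the design and limit matrices\<close>

lemma det_tendsto:
  fixes S :: "nat \<Rightarrow> real mat"
  assumes S: "\<And>n. S n \<in> carrier_mat m m" "T \<in> carrier_mat m m"
    and lim: "\<And>i j. i < m \<Longrightarrow> j < m \<Longrightarrow> (\<lambda>n. S n $$ (i, j)) \<longlonglongrightarrow> T $$ (i, j)"
  shows "(\<lambda>n. det (S n)) \<longlonglongrightarrow> det T"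
  unfolding det_def'[OF S(1)] det_def'[OF S(2)]
proof (intro tendsto_sum tendsto_mult tendsto_const tendsto_prod)
  fix p i assume "p \<in> {p. p permutes {0..<m}}" "i \<in> {0..<m}"
  then have "i < m" "p i < m" using permutes_in_image by fastforce+
  then show "(\<lambda>n. S n $$ (i, p i)) \<longlonglongrightarrow> T $$ (i, p i)" by (rule lim)
qed

text \<open>Cramer's rule exhibits the entries of the inverse as continuous functions of the entries.\<close>

lemma minv_adj:
  assumes S: "pos_def_mat p S" and ij: "i < p" "j < p"
  shows "minv S $$ (i, j) = (-1) ^ (j + i) * det (mat_delete S j i) / det S"
proof -
  note m = minv_inverse[OF S]
  have Sc: "S \<in> carrier_mat p p" using S by (simp add: pos_def_mat_def)
  note adj = adj_mat[OF Sc]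
  have "minv S = (1 / det S) \<cdot>\<^sub>m adj_mat S"
  proof (rule minv_eqI[OF Sc])
    show "1 / det S \<cdot>\<^sub>m adj_mat S \<in> carrier_mat p p" using adj by simp
    have "1 / det S \<cdot>\<^sub>m adj_mat S * S = (1 / det S) \<cdot>\<^sub>m (adj_mat S * S)"
      by (rule mult_smult_assoc_mat[OF adj(1) Sc])
    also have "\<dots> = 1\<^sub>m p" unfolding adj(3) using m(4) by (intro eq_matI) auto
    finally show "1 / det S \<cdot>\<^sub>m adj_mat S * S = 1\<^sub>m p" .
  qed
  then show ?thesis using ij Sc adj(1) by (simp add: adj_mat_def cofactor_def)
qed

lemma minv_tendsto:
  fixes S :: "nat \<Rightarrow> real mat"
  assumes S: "\<And>n. pos_def_mat p (S n)" "pos_def_mat p T"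
    and lim: "\<And>i j. i < p \<Longrightarrow> j < p \<Longrightarrow> (\<lambda>n. S n $$ (i, j)) \<longlonglongrightarrow> T $$ (i, j)"
    and ij: "i < p" "j < p"
  shows "(\<lambda>n. minv (S n) $$ (i, j)) \<longlonglongrightarrow> minv T $$ (i, j)"
  unfolding minv_adj[OF S(1) ij] minv_adj[OF S(2) ij]
proof (intro tendsto_divide tendsto_mult tendsto_const)
  have c: "\<And>n. S n \<in> carrier_mat p p" "T \<in> carrier_mat p p" using S by (simp_all add: pos_def_mat_def)
  show "(\<lambda>n. det (S n)) \<longlonglongrightarrow> det T" by (rule det_tendsto[OF c lim])
  show "det T \<noteq> 0" by (rule minv_inverse(4)[OF S(2)])
  show "(\<lambda>n. det (mat_delete (S n) j i)) \<longlonglongrightarrow> det (mat_delete T j i)"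
  proof (rule det_tendsto[of _ "p - 1"])
    fix a b assume "a < p - 1" "b < p - 1"
    moreover have "dim_row (S n) = p" "dim_col (S n) = p" "dim_row T = p" "dim_col T = p" for n
      using c(1)[of n] c(2) by auto
    ultimately show "(\<lambda>n. mat_delete (S n) j i $$ (a, b)) \<longlonglongrightarrow> mat_delete T j i $$ (a, b)"
      using lim by (simp add: mat_delete_def)
  qed (rule mat_delete_carrier[OF c(1)], rule mat_delete_carrier[OF c(2)])
qed

lemma leading_blocks_tendsto:
  assumes n: "\<And>n. leading_blocks P (R n) (S n)" and T: "leading_blocks P Q T"
    and lim: "\<And>i j. i < P \<Longrightarrow> j < P \<Longrightarrow> (\<lambda>n. R n $$ (i, j)) \<longlonglongrightarrow> Q $$ (i, j)"
    and q: "q < P"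
  shows "(\<lambda>n. xi (S n) (Suc q)) \<longlonglongrightarrow> xi T (Suc q)"
    and "(\<lambda>n. inv_factor (S n) i q) \<longlonglongrightarrow> inv_factor T i q"
proof -
  interpret T: leading_blocks P Q T by fact
  have p: "1 \<le> Suc q" "Suc q \<le> P" using q by auto
  have m: "(\<lambda>n. minv (S n (Suc q)) $$ (i, j)) \<longlonglongrightarrow> minv (T (Suc q)) $$ (i, j)"
    if "i < Suc q" "j < Suc q" for i j
  proof (rule minv_tendsto[OF _ _ _ that])
    show "pos_def_mat (Suc q) (S n (Suc q))" for n by (rule leading_blocks.S_pos_def[OF n p])
    show "pos_def_mat (Suc q) (T (Suc q))" by (rule T.S_pos_def[OF p])
    fix i j assume "i < Suc q" "j < Suc q"
    then show "(\<lambda>n. S n (Suc q) $$ (i, j)) \<longlonglongrightarrow> T (Suc q) $$ (i, j)"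
      using lim[of i j] p by (simp add: leading_blocks.S_entry[OF n] T.S_entry)
  qed
  show x: "(\<lambda>n. xi (S n) (Suc q)) \<longlonglongrightarrow> xi T (Suc q)"
    unfolding xi_def by (intro tendsto_real_sqrt) (use m[of q q] in simp)
  show "(\<lambda>n. inv_factor (S n) i q) \<longlonglongrightarrow> inv_factor T i q"
  proof (cases "i \<le> q")
    case True
    then show ?thesis unfolding inv_factor_def using m[of i q] x T.xi_pos[OF q]
      by (auto intro!: tendsto_divide)
  qed (simp add: inv_factor_def)
qed

text \<open>
  If columns were repeated, the rank would be less than the number of columns; distinct columns of
  full rank are linearly independent.
\<close>

lemma full_column_rank_injective:
  fixes X :: "real mat"
  assumes X: "X \<in> carrier_mat n P" and rank: "vec_space.rank n X = P"
    and x: "x \<in> carrier_vec P" "X *\<^sub>v x = 0\<^sub>v n"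
  shows "x = 0\<^sub>v P"
proof (rule ccontr)
  assume "x \<noteq> 0\<^sub>v P"
  interpret vec_space "TYPE(real)" n .
  have dist: "distinct (cols X)"
  proof (rule ccontr)
    assume nd: "\<not> distinct (cols X)"
    obtain T where T: "maximal T (\<lambda>T. T \<subseteq> set (cols X) \<and> lin_indpt T)"
      using maximal_exists[of "(\<lambda>T. T \<subseteq> set (cols X) \<and> lin_indpt T)" "card (set (cols X))" "{}"]
      by (meson List.finite_set card_mono empty_iff empty_subsetI finite_lin_indpt2 rev_finite_subset)
    then have "card T \<le> card (set (cols X))" by (simp add: card_mono maximal_def)
    also have "card (set (cols X)) < length (cols X)"
      using nd card_length[of "cols X"] card_distinct[of "cols X"] by linarith
    also have "\<dots> = P" using X by simp
    finally show False using rank_card_indpt[OF X T] rank by simp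
  qed
  from full_rank_lin_indpt[OF X rank dist] lin_depI[OF X x(1) \<open>x \<noteq> 0\<^sub>v P\<close> x(2) dist]
  show False by simp
qed

lemma gram_entry:
  assumes "X \<in> carrier_mat n P" "i < p" "j < p" "p \<le> P"
  shows "gram X p $$ (i, j) = (\<Sum>l<n. X $$ (l, i) * X $$ (l, j)) / n"
  using assms by (simp add: gram_def first_cols_def scalar_prod_def atLeast0LessThan)

lemma gram_pos_def:
  assumes X: "X \<in> carrier_mat n P" and rank: "vec_space.rank n X = P" and n: "n > 0"
  shows "pos_def_mat P (gram X P)"
  unfolding pos_def_mat_def
proof (intro conjI allI impI)
  show "gram X P \<in> carrier_mat P P" by (rule carrier_matI) (simp_all add: gram_def first_cols_def)
  show "gram X P $$ (i, j) = gram X P $$ (j, i)" if "i < P" "j < P" for i j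
    using that gram_entry[OF X] by (simp add: mult.commute)
  fix x :: "nat \<Rightarrow> real" assume x: "\<exists>i<P. x i \<noteq> 0"
  define y where "y l = (\<Sum>i<P. X $$ (l, i) * x i)" for l
  have "\<exists>l<n. y l \<noteq> 0"
  proof (rule ccontr)
    assume "\<not> ?thesis"
    then have "X *\<^sub>v vec P x = 0\<^sub>v n"
      using X by (intro eq_vecI) (auto simp: y_def scalar_prod_def atLeast0LessThan)
    from full_column_rank_injective[OF X rank _ this] have "vec P x = 0\<^sub>v P" by simp
    then have "vec P x $ i = 0" if "i < P" for i using that by simp
    then show False using x by auto
  qed
  then obtain l where l: "l < n" "y l \<noteq> 0" by auto
  have "0 < (\<Sum>l<n. (y l)\<^sup>2) / n"
    using l n by (intro divide_pos_pos sum_pos2[of _ l]) auto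
  also have "(\<Sum>l<n. (y l)\<^sup>2) / n = (\<Sum>i<P. \<Sum>j<P. x i * gram X P $$ (i, j) * x j)"
  proof -
    have "(\<Sum>i<P. \<Sum>j<P. x i * gram X P $$ (i, j) * x j)
      = (\<Sum>i<P. \<Sum>j<P. \<Sum>l<n. (X $$ (l, i) * x i) * (X $$ (l, j) * x j) / n)"
      using gram_entry[OF X]
      by (intro sum.cong refl) (simp add: sum_distrib_left sum_distrib_right sum_divide_distrib mult_ac)
    also have "\<dots> = (\<Sum>i<P. \<Sum>l<n. \<Sum>j<P. (X $$ (l, i) * x i) * (X $$ (l, j) * x j) / n)"
      by (intro sum.cong refl sum.swap)
    also have "\<dots> = (\<Sum>l<n. \<Sum>i<P. \<Sum>j<P. (X $$ (l, i) * x i) * (X $$ (l, j) * x j) / n)"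
      by (rule sum.swap)
    also have "\<dots> = (\<Sum>l<n. (y l)\<^sup>2 / n)"
      by (simp add: y_def power2_eq_square sum_product sum_divide_distrib)
    finally show ?thesis by (simp add: sum_divide_distrib)
  qed
  finally show "0 < (\<Sum>i<P. \<Sum>j<P. x i * gram X P $$ (i, j) * x j)" .
qed

lemma gram_leading_blocks:
  assumes X: "X \<in> carrier_mat n P" and rank: "vec_space.rank n X = P" and n: "n > 0"
  shows "leading_blocks P (gram X P) (gram X)"
proof
  show "pos_def_mat P (gram X P)" by (rule gram_pos_def[OF assms])
  show "gram X p = lead_block p (gram X P)" if "1 \<le> p" "p \<le> P" for p
  proof (rule eq_matI)
    fix i j assume "i < dim_row (lead_block p (gram X P))" "j < dim_col (lead_block p (gram X P))"
    then have "i < p" "j < p" by (auto simp: lead_block_def)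
    then show "gram X p $$ (i, j) = lead_block p (gram X P) $$ (i, j)"
      using gram_entry[OF X] that by (simp add: lead_block_def)
  qed (auto simp: gram_def first_cols_def lead_block_def)
qed

text \<open>
  The limit is positive semidefinite. A vector on which its quadratic form vanishes lies in the
  kernel, as the form cannot become negative in the direction of the image \<open>y\<close> of that vector;
  invertibility excludes this.
\<close>

lemma limit_pos_def:
  fixes R :: "nat \<Rightarrow> real mat"
  assumes R: "\<And>n. pos_def_mat P (R n)" and Q: "Q \<in> carrier_mat P P" "invertible_mat Q"
    and lim: "\<And>i j. i < P \<Longrightarrow> j < P \<Longrightarrow> (\<lambda>n. R n $$ (i, j)) \<longlonglongrightarrow> Q $$ (i, j)"
  shows "pos_def_mat P Q"
  unfolding pos_def_mat_def
proof (intro conjI allI impI)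
  show sym: "Q $$ (i, j) = Q $$ (j, i)" if "i < P" "j < P" for i j
  proof (rule LIMSEQ_unique[OF lim[OF that]])
    have "(\<lambda>n. R n $$ (i, j)) = (\<lambda>n. R n $$ (j, i))"
      using R that unfolding pos_def_mat_def by blast
    then show "(\<lambda>n. R n $$ (i, j)) \<longlonglongrightarrow> Q $$ (j, i)" using lim[OF that(2,1)] by simp
  qed
  define q where "q x y = (\<Sum>i<P. \<Sum>j<P. x i * Q $$ (i, j) * y j)" for x y :: "nat \<Rightarrow> real"
  have nn: "0 \<le> q x x" for x
  proof (cases "\<exists>i<P. x i \<noteq> 0")
    case True
    have "(\<lambda>n. \<Sum>i<P. \<Sum>j<P. x i * R n $$ (i, j) * x j) \<longlonglongrightarrow> q x x"
      unfolding q_def by (intro tendsto_sum tendsto_mult tendsto_const) (auto intro: lim)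
    moreover have "0 \<le> (\<Sum>i<P. \<Sum>j<P. x i * R n $$ (i, j) * x j)" for n
      using R[of n] True unfolding pos_def_mat_def by (blast intro: less_imp_le)
    ultimately show ?thesis by (intro LIMSEQ_le_const) auto
  qed (simp add: q_def)
  fix x :: "nat \<Rightarrow> real" assume x: "\<exists>i<P. x i \<noteq> 0"
  have "q x x \<noteq> 0"
  proof
    assume q0: "q x x = 0"
    define y where "y i = (\<Sum>j<P. Q $$ (i, j) * x j)" for i
    have qyx: "q y x = (\<Sum>i<P. (y i)\<^sup>2)"
      by (simp add: q_def y_def power2_eq_square sum_distrib_left mult_ac)
    have qs: "q x y = q y x" unfolding q_def
      by (subst sum.swap) (intro sum.cong refl, simp add: sym mult_ac)
    define s where "s = q y x"
    have s: "0 \<le> s" by (simp add: s_def qyx sum_nonneg)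
    \<comment> \<open>The form at \<open>x + t y\<close>; a small negative \<open>t\<close> would make it negative if \<open>y\<close> were not 0.\<close>
    have quad: "0 \<le> 2 * t * s + t\<^sup>2 * q y y" for t
    proof -
      have "0 \<le> q (\<lambda>i. x i + t * y i) (\<lambda>i. x i + t * y i)" by (rule nn)
      also have "\<dots> = q x x + t * q x y + t * q y x + t\<^sup>2 * q y y"
        unfolding q_def sum_distrib_left sum.distrib[symmetric]
        by (intro sum.cong refl) (simp add: power2_eq_square algebra_simps)
      finally show ?thesis using qs q0 by (simp add: s_def)
    qed
    have "s = 0"
    proof (rule ccontr)
      assume "s \<noteq> 0"
      then have s: "s > 0" using s by simp
      define c where "c = 1 + q y y"
      have c: "c > 0" using nn[of y] by (simp add: c_def)
      have "0 \<le> 2 * (- s / c) * s + (- s / c)\<^sup>2 * q y y" by (rule quad)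
      moreover have "(- s / c)\<^sup>2 * q y y < (- s / c)\<^sup>2 * c"
        using s c by (intro mult_strict_left_mono) (auto simp: c_def)
      moreover have "2 * (- s / c) * s + (- s / c)\<^sup>2 * c = - (s\<^sup>2 / c)"
        using c by (simp add: power2_eq_square field_simps)
      moreover have "0 < s\<^sup>2 / c" using s c by simp
      ultimately show False by linarith
    qed
    then have "y i = 0" if "i < P" for i
      using that unfolding s_def qyx by (subst (asm) sum_nonneg_eq_0_iff) auto
    then have Qx: "Q *\<^sub>v vec P x = 0\<^sub>v P"
      using Q(1) by (intro eq_vecI) (auto simp: y_def scalar_prod_def atLeast0LessThan)
    obtain B where B: "B * Q = 1\<^sub>m (dim_row B)" "Q * B = 1\<^sub>m P"
      using Q unfolding invertible_mat_def inverts_mat_def by auto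
    have Bc: "B \<in> carrier_mat P P"
      using arg_cong[OF B(1), of dim_col] arg_cong[OF B(2), of dim_col] Q(1) by auto
    have "vec P x = (B * Q) *\<^sub>v vec P x" using B(1) Bc by simp
    also have "\<dots> = B *\<^sub>v (Q *\<^sub>v vec P x)" by (rule assoc_mult_mat_vec[OF Bc Q(1)]) simp
    also have "\<dots> = 0\<^sub>v P" unfolding Qx using Bc by (intro eq_vecI) auto
    finally have "vec P x $ i = 0" if "i < P" for i using that by simp
    then show False using x by auto
  qed
  then show "0 < (\<Sum>i<P. \<Sum>j<P. x i * Q $$ (i, j) * x j)" using nn[of x] by (simp add: q_def)
qed (rule Q(1))

section \<open>Sequential selection among independent coordinates\<close>

text \<open>
  Inserting \<open>r\<close> makes the smallest order the default when no test rejects. Coordinates are counted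
  from zero, so the test of order \<open>p\<close> looks at coordinate \<open>p - 1\<close>.
\<close>

definition sel_order :: "(nat \<Rightarrow> real) \<Rightarrow> nat \<Rightarrow> nat \<Rightarrow> (nat \<Rightarrow> real) \<Rightarrow> nat" where
  "sel_order c P r w = Max (insert r {p. r < p \<and> p \<le> P \<and> c p \<le> \<bar>w (p - 1)\<bar>})"

definition partial_sum_vec :: "nat \<Rightarrow> (nat \<Rightarrow> nat \<Rightarrow> real) \<Rightarrow> nat \<Rightarrow> (nat \<Rightarrow> real) \<Rightarrow> real vec" where
  "partial_sum_vec k D p w = vec k (\<lambda>a. \<Sum>q<p. D a q * w q)"

lemma sel_order_finite:
  fixes c :: "nat \<Rightarrow> real"
  shows "finite (insert r {p. r < p \<and> p \<le> P \<and> c p \<le> \<bar>w (p - 1)\<bar>})"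
  by (rule finite.insertI, rule finite_subset[of _ "{..P}"]) auto

lemma sel_order_bounds:
  assumes "r \<le> P" shows "r \<le> sel_order c P r w" "sel_order c P r w \<le> P"
  using assms sel_order_finite[of r P c w] by (auto simp: sel_order_def)

lemma sel_order_eq_iff:
  assumes "r \<le> p" "p \<le> P"
  shows "sel_order c P r w = p \<longleftrightarrow>
    (r < p \<longrightarrow> c p \<le> \<bar>w (p - 1)\<bar>) \<and> (\<forall>q\<in>{Suc p..P}. \<bar>w (q - 1)\<bar> < c q)"
proof
  let ?A = "insert r {p. r < p \<and> p \<le> P \<and> c p \<le> \<bar>w (p - 1)\<bar>}"
  assume eq: "sel_order c P r w = p"
  then have "p \<in> ?A" using Max_in[OF sel_order_finite[of r P c w]] by (auto simp: sel_order_def)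
  moreover have "\<forall>q\<in>?A. q \<le> p" using eq Max_ge[OF sel_order_finite[of r P c w]] by (auto simp: sel_order_def)
  ultimately show "(r < p \<longrightarrow> c p \<le> \<bar>w (p - 1)\<bar>) \<and> (\<forall>q\<in>{Suc p..P}. \<bar>w (q - 1)\<bar> < c q)"
    using assms by (force simp: not_le[symmetric])
next
  assume R: "(r < p \<longrightarrow> c p \<le> \<bar>w (p - 1)\<bar>) \<and> (\<forall>q\<in>{Suc p..P}. \<bar>w (q - 1)\<bar> < c q)"
  show "sel_order c P r w = p" unfolding sel_order_def
  proof (rule Max_eqI[OF sel_order_finite])
    fix q assume q: "q \<in> insert r {p. r < p \<and> p \<le> P \<and> c p \<le> \<bar>w (p - 1)\<bar>}"
    show "q \<le> p"
    proof (rule ccontr)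
      assume "\<not> q \<le> p"
      then have "q \<in> {Suc p..P}" "c q \<le> \<bar>w (q - 1)\<bar>" using q assms by auto
      moreover from this have "\<bar>w (q - 1)\<bar> < c q" using R by blast
      ultimately show False by linarith
    qed
  qed (use R assms in auto)
qed

lemma partial_sum_vec_cong:
  "(\<And>q. q < p \<Longrightarrow> w q = w' q) \<Longrightarrow> partial_sum_vec k D p w = partial_sum_vec k D p w'"
  by (simp add: partial_sum_vec_def)

lemma measurable_partial_sum_vec [measurable]:
  assumes "{..<p} \<subseteq> I"
  shows "partial_sum_vec k D p \<in> PiM I (\<lambda>_. N01) \<rightarrow>\<^sub>M borel_vec k"
proof (rule measurable_borel_vecI)
  fix i assume "i < k"
  have "(\<lambda>w. \<Sum>q<p. D i q * w q) \<in> borel_measurable (PiM I (\<lambda>_. N01))"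
    by (intro borel_measurable_sum borel_measurable_times borel_measurable_const measurable_SG_component)
       (use assms in auto)
  then show "(\<lambda>w. partial_sum_vec k D p w $ i) \<in> borel_measurable (PiM I (\<lambda>_. N01))"
    using \<open>i < k\<close> by (simp add: partial_sum_vec_def)
qed (simp add: partial_sum_vec_def)

lemma measurable_sel_order [measurable]:
  assumes r: "r \<le> P"
  shows "sel_order c P r \<in> SG P \<rightarrow>\<^sub>M count_space UNIV"
proof (rule measurable_count_space_eq2_countable[THEN iffD2, OF _ ])
  show "sel_order c P r \<in> space (SG P) \<rightarrow> UNIV \<and> (\<forall>p\<in>UNIV. sel_order c P r -` {p} \<inter> space (SG P) \<in> sets (SG P))"
  proof (intro conjI ballI)
    fix p :: nat
    show "sel_order c P r -` {p} \<inter> space (SG P) \<in> sets (SG P)"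
    proof (cases "r \<le> p \<and> p \<le> P")
      case True
      have m: "q \<in> {Suc p..P} \<Longrightarrow> (\<lambda>w. w (q - 1)) \<in> borel_measurable (SG P)"
        "r < p \<Longrightarrow> (\<lambda>w. w (p - 1)) \<in> borel_measurable (SG P)" for q
        using True by (auto intro!: measurable_SG_component)
      note [measurable] = m(1)
      have "sel_order c P r -` {p} \<inter> space (SG P) =
        {w \<in> space (SG P). (r < p \<longrightarrow> c p \<le> \<bar>w (p - 1)\<bar>) \<and> (\<forall>q\<in>{Suc p..P}. \<bar>w (q - 1)\<bar> < c q)}"
        using sel_order_eq_iff[of r p P c] True by auto
      also have "\<dots> \<in> sets (SG P)"
      proof (cases "r < p")
        case True
        note [measurable] = m(2)[OF True]
        show ?thesis by measurable
      next
        case False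
        then have "{w \<in> space (SG P). (r < p \<longrightarrow> c p \<le> \<bar>w (p - 1)\<bar>) \<and> (\<forall>q\<in>{Suc p..P}. \<bar>w (q - 1)\<bar> < c q)}
          = {w \<in> space (SG P). (\<forall>q\<in>{Suc p..P}. \<bar>w (q - 1)\<bar> < c q)}" by auto
        moreover have "{w \<in> space (SG P). (\<forall>q\<in>{Suc p..P}. \<bar>w (q - 1)\<bar> < c q)} \<in> sets (SG P)" by measurable
        ultimately show ?thesis by (simp only:)
      qed
      finally show ?thesis .
    next
      case False
      then have "sel_order c P r -` {p} \<inter> space (SG P) = {}" using sel_order_bounds[OF r] by auto
      then show ?thesis by simp
    qed
  qed auto
qed

definition selected_vec :: "nat \<Rightarrow> (nat \<Rightarrow> nat \<Rightarrow> real) \<Rightarrow> (nat \<Rightarrow> real) \<Rightarrow> nat \<Rightarrow> nat \<Rightarrow> (nat \<Rightarrow> real) \<Rightarrow> real vec" where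
  "selected_vec k D c P r w = partial_sum_vec k D (sel_order c P r w) w"

abbreviation selected_prob ::
    "nat \<Rightarrow> (nat \<Rightarrow> nat \<Rightarrow> real) \<Rightarrow> (nat \<Rightarrow> real) \<Rightarrow> nat \<Rightarrow> nat \<Rightarrow> real vec set \<Rightarrow> real" where
  "selected_prob k D c P r E \<equiv> measure (SG P) {w \<in> space (SG P). selected_vec k D c P r w \<in> E}"

abbreviation cell_prob ::
    "nat \<Rightarrow> (nat \<Rightarrow> nat \<Rightarrow> real) \<Rightarrow> (nat \<Rightarrow> real) \<Rightarrow> nat \<Rightarrow> nat \<Rightarrow> nat \<Rightarrow> real vec set \<Rightarrow> real" where
  "cell_prob k D c P r p E \<equiv>
     measure (SG P) {w \<in> space (SG P). sel_order c P r w = p \<and> partial_sum_vec k D p w \<in> E}"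

lemma selected_vec_cell_sets:
  assumes "r \<le> P" "p \<le> P" and E: "E \<in> sets (borel_vec k)"
  shows "{w \<in> space (SG P). sel_order c P r w = p \<and> partial_sum_vec k D p w \<in> E} \<in> sets (SG P)"
proof -
  note [measurable] = measurable_sel_order[OF assms(1)] E
  have [measurable]: "partial_sum_vec k D p \<in> SG P \<rightarrow>\<^sub>M borel_vec k"
    by (rule measurable_partial_sum_vec) (use assms in auto)
  show ?thesis by measurable
qed

lemma selected_vec_cells:
  assumes "r \<le> P"
  shows "{w \<in> space (SG P). selected_vec k D c P r w \<in> E}
    = (\<Union>p\<in>{r..P}. {w \<in> space (SG P). sel_order c P r w = p \<and> partial_sum_vec k D p w \<in> E})"
  using sel_order_bounds[OF assms, of c] by (auto simp: selected_vec_def)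

lemma measurable_selected_vec:
  assumes "r \<le> P"
  shows "selected_vec k D c P r \<in> SG P \<rightarrow>\<^sub>M borel_vec k"
proof (rule measurableI)
  fix E assume E: "E \<in> sets (borel_vec k)"
  have "{w \<in> space (SG P). selected_vec k D c P r w \<in> E} \<in> sets (SG P)"
    unfolding selected_vec_cells[OF assms]
    using selected_vec_cell_sets[OF assms _ E] by (intro sets.finite_UN) auto
  then show "selected_vec k D c P r -` E \<inter> space (SG P) \<in> sets (SG P)"
    by (simp add: vimage_def Int_def conj_commute)
qed (simp add: selected_vec_def partial_sum_vec_def)

lemma measure_selected_vec:
  assumes "r \<le> P" and E: "E \<in> sets (borel_vec k)"
  shows "selected_prob k D c P r E
    = (\<Sum>p\<in>{r..P}. cell_prob k D c P r p E)"
  unfolding selected_vec_cells[OF assms(1)]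
  using selected_vec_cell_sets[OF assms(1) _ E]
  by (intro finite_measure.finite_measure_finite_Union[OF finite_measure_SG])
     (auto simp: disjoint_family_on_def)

lemma measure_SG_Suc:
  assumes C: "C \<in> sets (SG n)" and B: "B \<in> sets borel"
  shows "measure (SG (Suc n)) {w \<in> space (SG (Suc n)). restrict w {..<n} \<in> C \<and> w n \<in> B}
    = measure (SG n) C * measure N01 B"
proof -
  interpret PP: product_prob_space "\<lambda>_ :: nat. N01" "{..<n}" by (rule product_prob_space_std_normal)
  have ins: "insert n {..<n} = {..<Suc n}" by auto
  note [measurable] = C B
  have [measurable]: "(\<lambda>w. restrict w {..<n}) \<in> SG (Suc n) \<rightarrow>\<^sub>M SG n"
    by (rule measurable_restrict_subset) auto
  have [measurable]: "(\<lambda>w. w n) \<in> borel_measurable (SG (Suc n))" by measurable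
  let ?S = "{w \<in> space (SG (Suc n)). restrict w {..<n} \<in> C \<and> w n \<in> B}"
  have S: "?S \<in> sets (SG (Suc n))" by measurable
  have "measure (SG (Suc n)) ?S = (LINT w|SG (Suc n). indicator ?S w)"
    using sets.sets_into_space[OF S] by (simp add: Int_absorb2)
  also have "\<dots> = (LINT x|SG n. LINT y|N01. indicator ?S (x(n := y)))"
    using PP.product_integral_insert[of "{..<n}" n "indicator ?S :: _ \<Rightarrow> real"] S
    by (simp add: ins finite_measure.integrable_const_bound[OF finite_measure_SG, where B=1])
  also have "\<dots> = (LINT x|SG n. LINT y|N01. indicator C x * indicator B y)"
  proof (intro Bochner_Integration.integral_cong refl)
    fix x y assume x: "x \<in> space (SG n)"
    have "x(n := y) \<in> space (SG (Suc n))" using x by (auto simp: space_PiM PiE_def extensional_def)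
    moreover have "restrict (x(n := y)) {..<n} = x" using x by (auto simp: space_PiM PiE_def extensional_def fun_eq_iff)
    ultimately show "indicator ?S (x(n := y)) = (indicator C x * indicator B y :: real)"
      by (simp add: indicator_def)
  qed
  also have "\<dots> = measure (SG n) C * measure N01 B"
    using sets.sets_into_space[OF C] by (simp add: Int_absorb2)
  finally show ?thesis .
qed

lemma measure_SG_tail:
  assumes C: "C \<in> sets (SG p)" and B: "\<And>q. B q \<in> sets borel"
  shows "measure (SG (p + m)) {w \<in> space (SG (p + m)). restrict w {..<p} \<in> C \<and> (\<forall>q\<in>{p..<p + m}. w q \<in> B q)}
    = measure (SG p) C * (\<Prod>q\<in>{p..<p + m}. measure N01 (B q))"
proof (induction m)
  case 0
  have eq: "{w \<in> space (SG (p + 0)). restrict w {..<p} \<in> C \<and> (\<forall>q\<in>{p..<p + 0}. w q \<in> B q)} = C"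
    using sets.sets_into_space[OF C] by (auto simp: space_PiM PiE_restrict)
  show ?case unfolding eq by simp
next
  case (Suc m)
  note [measurable] = C B
  let ?C = "\<lambda>m. {w \<in> space (SG (p + m)). restrict w {..<p} \<in> C \<and> (\<forall>q\<in>{p..<p + m}. w q \<in> B q)}"
  have [measurable]: "(\<lambda>w. restrict w {..<p}) \<in> SG (p + m) \<rightarrow>\<^sub>M SG p"
    by (rule measurable_restrict_subset) auto
  have [measurable]: "q \<in> {p..<p + m} \<Longrightarrow> (\<lambda>w. w q) \<in> borel_measurable (SG (p + m))" for q
    by (rule measurable_SG_component) auto
  have Cm: "?C m \<in> sets (SG (p + m))" by measurable
  have "?C (Suc m) = {w \<in> space (SG (Suc (p + m))). restrict w {..<p + m} \<in> ?C m \<and> w (p + m) \<in> B (p + m)}"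
  proof -
    have "restrict (restrict w {..<p + m}) {..<p} = restrict w {..<p}" for w :: "nat \<Rightarrow> real"
      by (auto simp: restrict_def fun_eq_iff)
    moreover have "restrict w {..<p + m} \<in> space (SG (p + m))" for w
      by (simp add: space_PiM)
    moreover have "(\<forall>q\<in>{p..<p + Suc m}. w q \<in> B q) \<longleftrightarrow> (\<forall>q\<in>{p..<p + m}. restrict w {..<p + m} q \<in> B q) \<and> w (p + m) \<in> B (p + m)" for w
      by (auto simp: less_Suc_eq)
    ultimately show ?thesis by auto
  qed
  then have 1: "measure (SG (p + Suc m)) (?C (Suc m)) = measure (SG (p + m)) (?C m) * measure N01 (B (p + m))"
    using measure_SG_Suc[OF Cm B] by simp
  have 2: "(\<Prod>q\<in>{p..<p + Suc m}. measure N01 (B q))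
     = (\<Prod>q\<in>{p..<p + m}. measure N01 (B q)) * measure N01 (B (p + m))"
    by simp
  show ?case unfolding 1 Suc.IH 2 by (simp only: mult.assoc)
qed

text \<open>
  Selection of \<open>p\<close> restricts the coordinates below \<open>p\<close>, which also determine the partial sum, and
  each later coordinate separately.
\<close>

lemma measure_selected_cell:
  assumes r: "r \<le> p" "p \<le> P" and E: "E \<in> sets (borel_vec k)"
  shows "cell_prob k D c P r p E
    = measure (SG p) {w \<in> space (SG p). (r < p \<longrightarrow> c p \<le> \<bar>w (p - 1)\<bar>) \<and> partial_sum_vec k D p w \<in> E}
      * (\<Prod>q\<in>{Suc p..P}. measure N01 {x. \<bar>x\<bar> < c q})"
proof -
  obtain m where m: "P = p + m" using r le_Suc_ex by blast
  let ?C = "{w \<in> space (SG p). (r < p \<longrightarrow> c p \<le> \<bar>w (p - 1)\<bar>) \<and> partial_sum_vec k D p w \<in> E}"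
  have C: "?C \<in> sets (SG p)"
  proof -
    note [measurable] = E
    have 1: "{w \<in> space (SG p). partial_sum_vec k D p w \<in> E} \<in> sets (SG p)" by measurable
    show ?thesis
    proof (cases "r < p")
      case True
      then have [measurable]: "(\<lambda>w. w (p - 1)) \<in> borel_measurable (SG p)" by (intro measurable_SG_component) auto
      show ?thesis by measurable
    qed (use 1 in simp)
  qed
  have "{w \<in> space (SG P). sel_order c P r w = p \<and> partial_sum_vec k D p w \<in> E}
    = {w \<in> space (SG (p + m)). restrict w {..<p} \<in> ?C \<and> (\<forall>q\<in>{p..<p + m}. w q \<in> {x. \<bar>x\<bar> < c (Suc q)})}"
  proof -
    have "partial_sum_vec k D p (restrict w {..<p}) = partial_sum_vec k D p w" for w
      by (rule partial_sum_vec_cong) simp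
    moreover have "restrict w {..<p} \<in> space (SG p)" for w by (simp add: space_PiM)
    moreover have "(\<forall>q\<in>{Suc p..P}. \<bar>w (q - 1)\<bar> < c q) \<longleftrightarrow> (\<forall>q\<in>{p..<p + m}. w q \<in> {x. \<bar>x\<bar> < c (Suc q)})" for w :: "nat \<Rightarrow> real"
    proof
      assume L: "\<forall>q\<in>{Suc p..P}. \<bar>w (q - 1)\<bar> < c q"
      show "\<forall>q\<in>{p..<p + m}. w q \<in> {x. \<bar>x\<bar> < c (Suc q)}"
      proof
        fix q assume "q \<in> {p..<p + m}"
        then show "w q \<in> {x. \<bar>x\<bar> < c (Suc q)}" using L[rule_format, of "Suc q"] m by auto
      qed
    next
      assume R: "\<forall>q\<in>{p..<p + m}. w q \<in> {x. \<bar>x\<bar> < c (Suc q)}"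
      show "\<forall>q\<in>{Suc p..P}. \<bar>w (q - 1)\<bar> < c q"
      proof
        fix q assume "q \<in> {Suc p..P}"
        then have "q - 1 \<in> {p..<p + m}" "Suc (q - 1) = q" using m by auto
        then show "\<bar>w (q - 1)\<bar> < c q" using R[rule_format, of "q - 1"] by simp
      qed
    qed
    ultimately show ?thesis using sel_order_eq_iff[OF r, of c] m by auto
  qed
  then have "cell_prob k D c P r p E
    = measure (SG p) ?C * (\<Prod>q\<in>{p..<p + m}. measure N01 {x. \<bar>x\<bar> < c (Suc q)})"
    using measure_SG_tail[OF C, of "\<lambda>q. {x. \<bar>x\<bar> < c (Suc q)}" m] m by simp
  also have "(\<Prod>q\<in>{p..<p + m}. measure N01 {x. \<bar>x\<bar> < c (Suc q)})
    = (\<Prod>q\<in>{Suc p..P}. measure N01 {x. \<bar>x\<bar> < c q})"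
    using prod.shift_bounds_Suc_ivl[of "\<lambda>q. measure N01 {x. \<bar>x\<bar> < c q}" p "p + m"] m
    by (simp add: atLeastLessThanSuc_atLeastAtMost)
  finally show ?thesis .
qed

context leading_blocks_target
begin

lemma Phi_eq:
  assumes s: "s > 0" and p: "p \<le> P"
  shows "Phi A S s p = distr (SG p) (borel_vec k) (partial_sum_vec k (\<lambda>a q. s * F a q) p)"
proof (cases "p = 0")
  case True
  have "Phi A S s p = return (borel_vec k) (0\<^sub>v k)" using True A by (simp add: Phi_def)
  also have "\<dots> = distr (SG p) (borel_vec k) (\<lambda>_. 0\<^sub>v k)"
    by (rule prob_space.distr_const[OF prob_space_SG, symmetric]) simp
  also have "(\<lambda>_. 0\<^sub>v k) = partial_sum_vec k (\<lambda>a q. s * F a q) p"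
    using True by (auto simp: partial_sum_vec_def fun_eq_iff)
  finally show ?thesis .
next
  case False
  then have p1: "1 \<le> p" by simp
  let ?L = "s \<cdot>\<^sub>m Fmat p"
  have L: "?L \<in> carrier_mat k p" using Fmat_carrier by simp
  have "?L * ?L\<^sup>T = s\<^sup>2 \<cdot>\<^sub>m avar A S p"
    using Fmat_carrier[of p] by (intro eq_matI) (auto simp: avar_eq[OF p1 p] scalar_prod_def
      sum_distrib_left power2_eq_square mult_ac)
  from gauss_eq[OF L this] have "gauss k (s\<^sup>2 \<cdot>\<^sub>m avar A S p)
    = distr (SG p) (borel_vec k) (\<lambda>w. vec k (\<lambda>i. \<Sum>j<p. ?L $$ (i, j) * w j))" .
  also have "(\<lambda>w. vec k (\<lambda>i. \<Sum>j<p. ?L $$ (i, j) * w j)) = partial_sum_vec k (\<lambda>a q. s * F a q) p"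
    by (auto simp: partial_sum_vec_def fun_eq_iff Fmat_def intro!: eq_vecI sum.cong)
  finally show ?thesis using False s A by (simp add: Phi_def)
qed

text \<open>
  Write \<open>\<xi> W\<^sub>p\<^sub>-\<^sub>1\<close> as its regression \<open>b \<bullet> Z\<close> on the partial sum \<open>Z\<close> plus a residual. By equality
  of covariances, the residual may be replaced by \<open>\<zeta>\<close> times a fresh coordinate, here the one with
  index \<open>p\<close>, which is then integrated out first and leaves \<^const>\<open>Delta\<close>.
\<close>

lemma set_integral_Delta_eq:
  assumes s: "s > 0" and p: "1 \<le> p" "p \<le> P" and E: "E \<in> sets (borel_vec k)"
  shows "(LINT z:E|Phi A S s p. 1 - Delta (s * zeta A S p) (bvec A S p \<bullet> z) (c * s * xi S p))
    = measure (SG p) {w \<in> space (SG p). c \<le> \<bar>w (p - 1)\<bar> \<and> partial_sum_vec k (\<lambda>a q. s * F a q) p w \<in> E}"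
proof -
  let ?D = "\<lambda>a q. s * F a q"
  let ?Z = "partial_sum_vec k ?D p"
  let ?b = "bvec A S p"
  define x where "x = xi S p"
  define ze where "ze = zeta A S p"
  define g where "g q = (\<Sum>c<k. ?b $ c * F c q)" for q
  have x: "x > 0" using xi_pos[of "p - 1"] p by (simp add: x_def)
  have ze: "ze \<ge> 0" "ze\<^sup>2 = x\<^sup>2 - x * g (p - 1)" "(\<Sum>q<p. (g q)\<^sup>2) = x * g (p - 1)"
    using zeta_squared[OF p] by (simp_all add: ze_def x_def g_def)
  have reg: "(\<Sum>q<p. g q * F a q) = x * F a (p - 1)" if "a < k" for a
    using bvec_regression[OF p that] by (simp add: g_def x_def)
  have bc: "?b \<in> carrier_vec k" by (rule bvec_carrier[OF p])
  have bZ: "?b \<bullet> ?Z w = (\<Sum>q<p. s * g q * w q)" for w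
  proof -
    have "?b \<bullet> ?Z w = (\<Sum>a<k. \<Sum>q<p. ?b $ a * (s * F a q * w q))"
      using bc by (simp add: scalar_prod_def partial_sum_vec_def atLeast0LessThan sum_distrib_left)
    also have "\<dots> = (\<Sum>q<p. \<Sum>a<k. ?b $ a * (s * F a q * w q))" by (rule sum.swap)
    finally show ?thesis by (simp add: g_def sum_distrib_left sum_distrib_right mult_ac)
  qed
  note [measurable] = E
  have Zm[measurable]: "?Z \<in> SG p \<rightarrow>\<^sub>M borel_vec k" by (rule measurable_partial_sum_vec) simp
  have Zm'[measurable]: "?Z \<in> SG (Suc p) \<rightarrow>\<^sub>M borel_vec k" by (rule measurable_partial_sum_vec) auto
  have bm[measurable]: "(\<lambda>z. ?b \<bullet> z) \<in> borel_measurable (borel_vec k)"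
  proof -
    have "(\<lambda>z. \<Sum>a<k. ?b $ a * z $ a) \<in> borel_measurable (borel_vec k)" by measurable
    then show ?thesis
      by (rule measurable_cong[THEN iffD1, rotated]) (simp add: scalar_prod_def atLeast0LessThan)
  qed
  \<comment> \<open>The probability of the threshold event given the value \<open>u\<close> of the regression; the residual enters
    with a minus sign because \<^const>\<open>Delta\<close> is about the distance of the normal variable from \<open>u\<close>.\<close>
  define h where "h u = measure N01 {y. c * s * x \<le> \<bar>u - s * ze * y\<bar>}" for u
  have h: "1 - Delta (s * ze) u (c * s * x) = h u" for u
  proof -
    interpret S: prob_space N01 by (rule prob_space_normal_density) simp
    have [measurable]: "{y. \<bar>s * ze * y - u\<bar> < c * s * x} \<in> sets borel" by measurable
    have "1 - Delta (s * ze) u (c * s * x) = 1 - S.prob {y. \<bar>s * ze * y - u\<bar> < c * s * x}"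
      using s ze(1) by (simp add: Delta_eq)
    also have "\<dots> = S.prob (space N01 - {y. \<bar>s * ze * y - u\<bar> < c * s * x})"
      by (subst S.prob_compl) auto
    also have "space N01 - {y. \<bar>s * ze * y - u\<bar> < c * s * x} = {y. c * s * x \<le> \<bar>u - s * ze * y\<bar>}"
      by (auto simp: abs_minus_commute not_less)
    finally show ?thesis by (simp add: h_def)
  qed
  have hm[measurable]: "h \<in> borel_measurable borel"
  proof -
    have "h u = (LINT y|N01. indicator {z. c * s * x \<le> \<bar>z\<bar>} (u - s * ze * y))" for u
    proof -
      have "h u = (LINT y|N01. indicator {y. c * s * x \<le> \<bar>u - s * ze * y\<bar>} y)"
        by (simp add: h_def)
      then show ?thesis by (simp add: indicator_def)
    qed
    moreover have "(\<lambda>u. LINT y|N01. (indicator {z. c * s * x \<le> \<bar>z\<bar>} (u - s * ze * y) :: real)) \<in> borel_measurable borel"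
    proof (rule sigma_finite_measure.borel_measurable_lebesgue_integral)
      show "sigma_finite_measure N01"
        using finite_measure_std_normal by (simp add: finite_measure_def)
      have [measurable]: "{z. c * s * x \<le> \<bar>z\<bar>} \<in> sets borel" by measurable
      have [measurable]: "snd \<in> borel_measurable (borel \<Otimes>\<^sub>M N01)" 
        using measurable_snd[of borel N01] by simp
      show "(\<lambda>(u, y). indicator {z. c * s * x \<le> \<bar>z\<bar>} (u - s * ze * y)) \<in> borel_measurable (borel \<Otimes>\<^sub>M N01)"
        unfolding split_beta by measurable
    qed
    ultimately show ?thesis by (simp add: fun_eq_iff cong: measurable_cong)
  qed
  let ?B = "{w \<in> space (SG (Suc p)). c * s * x \<le> \<bar>?b \<bullet> ?Z w - s * ze * w p\<bar> \<and> ?Z w \<in> E}"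
  have [measurable]: "(\<lambda>w. w p) \<in> borel_measurable (SG (Suc p))" by (rule measurable_SG_component) simp
  have Bm: "?B \<in> sets (SG (Suc p))" by measurable
  have "(LINT z:E|Phi A S s p. 1 - Delta (s * zeta A S p) (?b \<bullet> z) (c * s * xi S p))
    = (LINT z|Phi A S s p. indicator E z * h (?b \<bullet> z))"
    unfolding set_lebesgue_integral_def ze_def[symmetric] x_def[symmetric] h by simp
  also have "\<dots> = (LINT w|SG p. indicator E (?Z w) * h (?b \<bullet> ?Z w))"
    unfolding Phi_eq[OF s p(2)] by (rule integral_distr) measurable
  also have "\<dots> = (LINT w|SG p. LINT y|N01. indicator ?B (w(p := y)))"
  proof (intro Bochner_Integration.integral_cong refl)
    fix w assume w: "w \<in> space (SG p)"
    have "w(p := y) \<in> space (SG (Suc p))" for y using w by (auto simp: space_PiM PiE_def extensional_def)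
    moreover have "?Z (w(p := y)) = ?Z w" for y by (rule partial_sum_vec_cong) simp
    ultimately have "indicator ?B (w(p := y)) = (indicator E (?Z w) * indicator {y. c * s * x \<le> \<bar>?b \<bullet> ?Z w - s * ze * y\<bar>} y :: real)" for y
      by (auto simp: indicator_def)
    then show "indicator E (?Z w) * h (?b \<bullet> ?Z w) = (LINT y|N01. indicator ?B (w(p := y)))"
      by (simp add: h_def)
  qed
  also have "\<dots> = (LINT w|SG (Suc p). indicator ?B w)"
  proof -
    interpret PP: product_prob_space "\<lambda>_ :: nat. N01" "{..<p}" by (rule product_prob_space_std_normal)
    have ins: "insert p {..<p} = {..<Suc p}" by auto
    show ?thesis using PP.product_integral_insert[of "{..<p}" p "indicator ?B :: _ \<Rightarrow> real"] Bm
      by (simp add: ins finite_measure.integrable_const_bound[OF finite_measure_SG, where B=1])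
  qed
  also have "\<dots> = measure (SG (Suc p)) ?B"
    using sets.sets_into_space[OF Bm] by (simp add: Int_absorb2)
  also have "\<dots> = measure (SG p) {w \<in> space (SG p). c \<le> \<bar>w (p - 1)\<bar> \<and> ?Z w \<in> E}"
  proof -
    define al where "al i j = (if i < k then (if j < p then s * F i j else 0) else (if j < p then s * g j else - s * ze))" for i j
    define al' where "al' i j = (if i < k then s * F i j else (if j = p - 1 then s * x else 0))" for i j
    have cov: "(\<Sum>j<Suc p. al i j * al l j) = (\<Sum>j<p. al' i j * al' l j)" if il: "i < Suc k" "l < Suc k" for i l
    proof -
      have ik: "(\<Sum>j<Suc p. al i j * al k j) = (\<Sum>j<p. al' i j * al' k j)" if "i < k" for i
      proof -
        have "(\<Sum>j<Suc p. al i j * al k j) = s\<^sup>2 * (\<Sum>j<p. g j * F i j)"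
          using that by (simp add: al_def sum_distrib_left power2_eq_square mult_ac)
        also have "\<dots> = s * F i (p - 1) * (s * x)" using reg[OF that] by (simp add: power2_eq_square)
        also have "\<dots> = (\<Sum>j<p. if j = p - 1 then s * F i (p - 1) * (s * x) else 0)"
          using p by (simp add: sum.delta)
        also have "\<dots> = (\<Sum>j<p. al' i j * al' k j)"
          using that by (intro sum.cong refl) (auto simp: al'_def)
        finally show ?thesis .
      qed
      have kk: "(\<Sum>j<Suc p. al k j * al k j) = (\<Sum>j<p. al' k j * al' k j)"
      proof -
        have "(\<Sum>j<Suc p. al k j * al k j) = s\<^sup>2 * (\<Sum>j<p. (g j)\<^sup>2) + s\<^sup>2 * ze\<^sup>2"
          by (simp add: al_def sum_distrib_left power2_eq_square mult_ac)
        also have "\<dots> = s * x * (s * x)" unfolding ze by (simp add: power2_eq_square algebra_simps)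
        also have "\<dots> = (\<Sum>j<p. if j = p - 1 then s * x * (s * x) else 0)"
          using p by (simp add: sum.delta)
        also have "\<dots> = (\<Sum>j<p. al' k j * al' k j)"
          by (intro sum.cong refl) (auto simp: al'_def)
        finally show ?thesis .
      qed
      consider "i < k" "l < k" | "i < k" "l = k" | "i = k" "l < k" | "i = k" "l = k" using il by (auto simp: less_Suc_eq)
      then show ?thesis
      proof cases
        case 1 then show ?thesis by (simp add: al_def al'_def)
      next
        case 2 then show ?thesis using ik by simp
      next
        case 3 then show ?thesis using ik[of l] by (simp add: mult.commute)
      next
        case 4 then show ?thesis using kk by simp
      qed
    qed
    define Q where "Q y \<longleftrightarrow> c * s * x \<le> \<bar>y k\<bar> \<and> vec k y \<in> E" for y :: "nat \<Rightarrow> real"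
    have vm[measurable]: "vec k \<in> (\<Pi>\<^sub>M i\<in>{..<Suc k}. borel) \<rightarrow>\<^sub>M borel_vec k"
    proof (rule measurable_borel_vecI)
      fix i assume "i < k"
      then have "(\<lambda>y. y i) \<in> borel_measurable (\<Pi>\<^sub>M i\<in>{..<Suc k}. borel)" by (intro measurable_component_singleton) simp
      then show "(\<lambda>y. vec k y $ i) \<in> borel_measurable (\<Pi>\<^sub>M i\<in>{..<Suc k}. borel)" using \<open>i < k\<close> by simp
    qed simp
    have Qm[measurable]: "Q \<in> (\<Pi>\<^sub>M i\<in>{..<Suc k}. borel) \<rightarrow>\<^sub>M count_space UNIV"
    proof -
      have [measurable]: "(\<lambda>y. y k) \<in> borel_measurable (\<Pi>\<^sub>M i\<in>{..<Suc k}. borel)" by (rule measurable_component_singleton) simp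
      show ?thesis unfolding Q_def by measurable
    qed
    have lin: "(\<lambda>w. \<lambda>i\<in>{..<Suc k}. \<Sum>j<m. b i j * w j) \<in> SG m \<rightarrow>\<^sub>M (\<Pi>\<^sub>M i\<in>{..<Suc k}. borel)" for m and b :: "nat \<Rightarrow> nat \<Rightarrow> real"
      by (rule measurable_restrict) measurable
    have push: "measure (distr (SG m) (count_space UNIV) (\<lambda>w. Q (\<lambda>i\<in>{..<Suc k}. \<Sum>j<m. b i j * w j))) {True}
      = measure (SG m) {w \<in> space (SG m). Q (\<lambda>i\<in>{..<Suc k}. \<Sum>j<m. b i j * w j)}" for m and b :: "nat \<Rightarrow> nat \<Rightarrow> real"
      by (subst measure_distr[OF measurable_compose[OF lin Qm]]) (auto intro!: arg_cong[where f="measure (SG m)"])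
    have "measure (SG (Suc p)) {w \<in> space (SG (Suc p)). Q (\<lambda>i\<in>{..<Suc k}. \<Sum>j<Suc p. al i j * w j)}
       = measure (SG p) {w \<in> space (SG p). Q (\<lambda>i\<in>{..<Suc k}. \<Sum>j<p. al' i j * w j)}"
      using linear_law_eqI'[where K="Suc k" and a=al and a'=al', OF cov Qm] unfolding push[symmetric] by simp
    moreover have "Q (\<lambda>i\<in>{..<Suc k}. \<Sum>j<Suc p. al i j * w j) \<longleftrightarrow> c * s * x \<le> \<bar>?b \<bullet> ?Z w - s * ze * w p\<bar> \<and> ?Z w \<in> E" for w
    proof -
      have "vec k (\<lambda>i\<in>{..<Suc k}. \<Sum>j<Suc p. al i j * w j) = ?Z w"
        by (intro eq_vecI) (auto simp: partial_sum_vec_def al_def)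
      moreover have "(\<lambda>i\<in>{..<Suc k}. \<Sum>j<Suc p. al i j * w j) k = ?b \<bullet> ?Z w - s * ze * w p"
        by (simp add: bZ al_def)
      ultimately show ?thesis by (simp only: Q_def)
    qed
    moreover have "Q (\<lambda>i\<in>{..<Suc k}. \<Sum>j<p. al' i j * w j) \<longleftrightarrow> c \<le> \<bar>w (p - 1)\<bar> \<and> ?Z w \<in> E" for w
    proof -
      have "vec k (\<lambda>i\<in>{..<Suc k}. \<Sum>j<p. al' i j * w j) = ?Z w"
        by (intro eq_vecI) (auto simp: partial_sum_vec_def al'_def)
      moreover have "(\<lambda>i\<in>{..<Suc k}. \<Sum>j<p. al' i j * w j) k = (\<Sum>j<p. if j = p - 1 then s * x * w (p - 1) else 0)"
        by (simp add: al'_def if_distrib[of "\<lambda>z. z * _"] cong: if_cong)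
      moreover have "\<dots> = s * x * w (p - 1)" using p by (simp add: sum.delta)
      moreover have "c * s * x \<le> \<bar>s * x * w (p - 1)\<bar> \<longleftrightarrow> c \<le> \<bar>w (p - 1)\<bar>"
      proof -
        have "\<bar>s * x * w (p - 1)\<bar> = \<bar>w (p - 1)\<bar> * (s * x)" using s x by (simp add: abs_mult)
        moreover have "c * s * x = c * (s * x)" by simp
        moreover have "s * x > 0" using s x by simp
        ultimately show ?thesis by (simp only: mult_le_cancel_right_pos)
      qed
      ultimately show ?thesis by (simp only: Q_def)
    qed
    ultimately show ?thesis by (simp only:)
  qed
  finally show ?thesis .
qed

text \<open>
  The summands of \<^const>\<open>G_expr\<close> are the probabilities of the cells on which the selected order is
  constant.
\<close>

theorem G_expr_eq:
  assumes s: "s > 0" and r: "r \<le> P" and t: "t \<in> carrier_vec k"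
  shows "G_expr c A S s r t
    = selected_prob k (\<lambda>a q. s * F a q) c P r (lower_set k t)"
proof -
  let ?D = "\<lambda>a q. s * F a q"
  note E = sets_lower_set[OF t]
  have dims: "dim_row A = k" "dim_col A = P" using A by auto
  have Dl: "Delta (s * xi S q) 0 (c q * s * xi S q) = measure N01 {x. \<bar>x\<bar> < c q}"
    if "q \<in> {Suc p..P}" for p q
  proof -
    have x: "xi S q > 0" using xi_pos[of "q - 1"] that by auto
    have "\<bar>s * xi S q * y - 0\<bar> < c q * s * xi S q \<longleftrightarrow> \<bar>y\<bar> < c q" for y
    proof -
      have "\<bar>s * xi S q * y - 0\<bar> = \<bar>y\<bar> * (s * xi S q)" using s x by (simp add: abs_mult)
      moreover have "c q * s * xi S q = c q * (s * xi S q)" by simp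
      moreover have "s * xi S q > 0" using s x by simp
      ultimately show ?thesis by (simp only: mult_less_cancel_right_pos)
    qed
    then show ?thesis using s x by (simp add: Delta_eq)
  qed
  have Dp: "(\<Prod>q = p + 1..P. Delta (s * xi S q) 0 (c q * s * xi S q)) = (\<Prod>q\<in>{Suc p..P}. measure N01 {x. \<bar>x\<bar> < c q})" for p
    by (intro prod.cong) (auto simp: Dl)
  have first: "measure (Phi A S s r) (lower_set k t) = measure (SG r) {w \<in> space (SG r). (r < r \<longrightarrow> c r \<le> \<bar>w (r - 1)\<bar>) \<and> partial_sum_vec k ?D r w \<in> lower_set k t}"
    unfolding Phi_eq[OF s r] by (subst measure_distr[OF _ E]) (auto intro!: arg_cong[where f="measure (SG r)"] measurable_partial_sum_vec)
  have cells: "(LINT z:lower_set k t|Phi A S s p. 1 - Delta (s * zeta A S p) (bvec A S p \<bullet> z) (c p * s * xi S p))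
    = measure (SG p) {w \<in> space (SG p). (r < p \<longrightarrow> c p \<le> \<bar>w (p - 1)\<bar>) \<and> partial_sum_vec k ?D p w \<in> lower_set k t}"
    if "p \<in> {Suc r..P}" for p
    using set_integral_Delta_eq[OF s _ _ E, of p "c p"] that by simp
  have cells': "(LINT z:lower_set k t|Phi A S s p. 1 - Delta (s * zeta A S p) (bvec A S p \<bullet> z) (c p * s * xi S p))
      * (\<Prod>q\<in>{Suc p..P}. measure N01 {x. \<bar>x\<bar> < c q})
    = cell_prob k ?D c P r p (lower_set k t)"
    if "p \<in> {Suc r..P}" for p
    unfolding cells[OF that] by (rule measure_selected_cell[symmetric, OF _ _ E]) (use that in auto)
  have "G_expr c A S s r t
    = cell_prob k ?D c P r r (lower_set k t)
    + (\<Sum>p\<in>{Suc r..P}. cell_prob k ?D c P r p (lower_set k t))"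
    unfolding G_expr_def Let_def dims Dp first measure_selected_cell[OF order.refl r E]
    by (intro arg_cong2[where f="(+)"] refl sum.cong) (simp, rule cells')
  also have "\<dots> = (\<Sum>p\<in>{r..P}. cell_prob k ?D c P r p (lower_set k t))"
    using r by (subst (2) sum.atLeast_Suc_atMost) simp_all
  finally show ?thesis by (simp only: measure_selected_vec[OF r E])
qed

lemma cdf_measure_G_expr:
  assumes s: "s > 0" and r: "r \<le> P"
  shows "cdf_measure k (G_expr c A S s r) = distr (SG P) (borel_vec k) (selected_vec k (\<lambda>a q. s * F a q) c P r)"
proof (rule cdf_measure_eqI)
  note m = measurable_selected_vec[OF r, of k "\<lambda>a q. s * F a q" c]
  show "finite_measure (distr (SG P) (borel_vec k) (selected_vec k (\<lambda>a q. s * F a q) c P r))"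
    by (rule finite_measure.finite_measure_distr[OF finite_measure_SG m])
  fix t :: "real vec" assume t: "t \<in> carrier_vec k"
  show "measure (distr (SG P) (borel_vec k) (selected_vec k (\<lambda>a q. s * F a q) c P r)) (lower_set k t) = G_expr c A S s r t"
    unfolding G_expr_eq[OF s r t] by (subst measure_distr[OF m sets_lower_set[OF t]]) (auto intro!: arg_cong[where f="measure (SG P)"])
qed simp

end

section \<open>Total variation continuity of the selected vector\<close>

text \<open>The standard normal density is at most 1.\<close>

lemma std_normal_band:
  assumes e: "0 \<le> e"
  shows "measure N01 {x. \<bar>\<bar>x\<bar> - a\<bar> \<le> e} \<le> 4 * e"
proof -
  interpret S: finite_measure N01 by (rule finite_measure_std_normal)
  have le1: "std_normal_density x \<le> 1" for x
  proof -
    have "1 \<le> sqrt (2 * pi)" using pi_ge_two by simp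
    moreover have "exp (- (x\<^sup>2 / 2)) \<le> 1" by simp
    ultimately have "exp (- (x\<^sup>2 / 2)) \<le> sqrt (2 * pi)" by linarith
    then show ?thesis by (simp add: std_normal_density_def divide_le_eq_1)
  qed
  have int: "measure N01 {l..u} \<le> u - l" if "l \<le> u" for l u
  proof -
    have "emeasure N01 {l..u} = (\<integral>\<^sup>+ x. ennreal (std_normal_density x) * indicator {l..u} x \<partial>lborel)"
      by (simp add: emeasure_density)
    also have "\<dots> \<le> (\<integral>\<^sup>+ x. indicator {l..u} x \<partial>lborel)"
      using le1 by (intro nn_integral_mono) (auto simp: indicator_def)
    also have "\<dots> = ennreal (u - l)" using that by simp
    finally show ?thesis using that by (simp add: S.emeasure_eq_measure)
  qed
  have "measure N01 {x. \<bar>\<bar>x\<bar> - a\<bar> \<le> e} \<le> measure N01 ({a - e..a + e} \<union> {- a - e..- a + e})"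
    by (rule S.finite_measure_mono) auto
  also have "\<dots> \<le> measure N01 {a - e..a + e} + measure N01 {- a - e..- a + e}"
    by (rule measure_Un_le) auto
  also have "\<dots> \<le> 2 * e + 2 * e"
    using int[of "a - e" "a + e"] int[of "- a - e" "- a + e"] e by (intro add_mono) auto
  finally show ?thesis by simp
qed

lemma measure_SG_component:
  assumes i: "i < m" and B: "B \<in> sets borel"
  shows "measure (SG m) {w \<in> space (SG m). w i \<in> B} = measure N01 B"
proof -
  have d: "distr (SG m) N01 (\<lambda>w. w i) = N01"
    by (rule distr_PiM_component) (use i in \<open>auto intro: prob_space_normal_density\<close>)
  have "measure N01 B = measure (distr (SG m) N01 (\<lambda>w. w i)) B" by (simp only: d)
  also have "\<dots> = measure (SG m) {w \<in> space (SG m). w i \<in> B}"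
    using i B measurable_component_singleton[of i "{..<m}" "\<lambda>_. N01"]
    by (subst measure_distr) (auto intro!: arg_cong[where f="measure (SG m)"])
  finally show ?thesis by simp
qed

text \<open>
  The matrix \<open>T\<^sup>T Q S\<close>, with \<open>T\<close> and \<open>S\<close> standing for the triangular factors of two designs, the
  first of which belongs to \<open>Q\<close>. As \<open>T T\<^sup>T Q = 1\<close>, multiplying it by \<open>T\<close> from the left gives \<open>S\<close>.
\<close>

definition transition :: "nat \<Rightarrow> real mat \<Rightarrow> (nat \<Rightarrow> real mat) \<Rightarrow> (nat \<Rightarrow> real mat) \<Rightarrow> nat \<Rightarrow> nat \<Rightarrow> real" where
  "transition P Q T S i j = (\<Sum>l<P. inv_factor T l i * (\<Sum>m<P. Q $$ (l, m) * inv_factor S m j))"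

context leading_blocks
begin

lemma transition_eq:
  assumes "i < P" "j < P"
  shows "transition P R S S' i j = (\<Sum>m<P. (\<Sum>l<P. R $$ (m, l) * v l i) * inv_factor S' m j)"
proof -
  have "transition P R S S' i j = (\<Sum>l<P. \<Sum>m<P. v l i * R $$ (l, m) * inv_factor S' m j)"
    by (simp add: transition_def sum_distrib_left mult_ac)
  also have "\<dots> = (\<Sum>m<P. \<Sum>l<P. v l i * R $$ (l, m) * inv_factor S' m j)" by (rule sum.swap)
  also have "\<dots> = (\<Sum>m<P. \<Sum>l<P. R $$ (m, l) * v l i * inv_factor S' m j)"
    by (intro sum.cong refl) (simp add: R_sym mult_ac)
  finally show ?thesis by (simp add: sum_distrib_right)
qed

lemma transition_upper:
  assumes "j \<le> i" "i < P"
  shows "transition P R S S' i j = inv_factor S' i j / xi S (Suc i)"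
proof -
  have "transition P R S S' i j = (\<Sum>m<P. if m = i then inv_factor S' i j / xi S (Suc i) else 0)"
  proof (subst transition_eq)
    show "(\<Sum>m<P. (\<Sum>l<P. R $$ (m, l) * v l i) * inv_factor S' m j) = (\<Sum>m<P. if m = i then inv_factor S' i j / xi S (Suc i) else 0)"
    proof (intro sum.cong refl)
      fix m
      show "(\<Sum>l<P. R $$ (m, l) * v l i) * inv_factor S' m j = (if m = i then inv_factor S' i j / xi S (Suc i) else 0)"
      proof (cases "m \<le> i")
        case True then show ?thesis using R_v[OF assms(2) True] by simp
      next
        case False then show ?thesis using assms by (simp add: inv_factor_def)
      qed
    qed
  qed (use assms in auto)
  then show ?thesis using assms by (simp add: sum.delta)
qed

lemma v_transition:
  assumes i: "i < P"
  shows "(\<Sum>q<P. v i q * transition P R S S' q j) = inv_factor S' i j"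
proof -
  have "(\<Sum>q<P. v i q * transition P R S S' q j) = (\<Sum>q<P. \<Sum>m<P. v i q * (\<Sum>l<P. v l q * R $$ (l, m)) * inv_factor S' m j)"
  proof (intro sum.cong refl)
    fix q
    have "transition P R S S' q j = (\<Sum>l<P. \<Sum>m<P. v l q * R $$ (l, m) * inv_factor S' m j)"
      by (simp add: transition_def sum_distrib_left mult_ac)
    also have "\<dots> = (\<Sum>m<P. \<Sum>l<P. v l q * R $$ (l, m) * inv_factor S' m j)" by (rule sum.swap)
    finally show "v i q * transition P R S S' q j = (\<Sum>m<P. v i q * (\<Sum>l<P. v l q * R $$ (l, m)) * inv_factor S' m j)"
      by (simp add: sum_distrib_left sum_distrib_right mult_ac)
  qed
  also have "\<dots> = (\<Sum>m<P. \<Sum>q<P. v i q * (\<Sum>l<P. v l q * R $$ (l, m)) * inv_factor S' m j)" by (rule sum.swap)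
  also have "\<dots> = (\<Sum>m<P. (if i = m then 1 else 0) * inv_factor S' m j)"
    using i by (intro sum.cong refl) (simp add: v_v_R flip: sum_distrib_right)
  also have "\<dots> = (\<Sum>m<P. if m = i then inv_factor S' i j else 0)" by (intro sum.cong) auto
  finally show ?thesis using i by (simp add: sum.delta)
qed

text \<open>
  The partial sums of order \<open>p\<close> for one design are those for the other after the leading block of
  order \<open>p\<close> of the transition matrix has been applied to the coordinates.
\<close>

lemma loading_transition:
  assumes p: "j < p" "p \<le> P"
  shows "(\<Sum>q<p. loading P A S a q * transition P R S S' q j) = loading P A S' a j"
proof -
  have "(\<Sum>q<p. loading P A S a q * transition P R S S' q j) = (\<Sum>q<P. loading P A S a q * transition P R S S' q j)"
  proof (rule sum_lessThan_zero_beyond[symmetric, OF p(2)])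
    fix q assume "p \<le> q" "q < P"
    then show "loading P A S a q * transition P R S S' q j = 0"
      using p transition_upper[of j q S'] by (simp add: inv_factor_def)
  qed
  also have "\<dots> = (\<Sum>q<P. \<Sum>i<P. A $$ (a, i) * (v i q * transition P R S S' q j))"
    unfolding loading_def sum_distrib_right by (simp only: mult_ac)
  also have "\<dots> = (\<Sum>i<P. \<Sum>q<P. A $$ (a, i) * (v i q * transition P R S S' q j))" by (rule sum.swap)
  also have "\<dots> = (\<Sum>i<P. A $$ (a, i) * inv_factor S' i j)"
    by (intro sum.cong refl) (simp add: v_transition flip: sum_distrib_left)
  finally show ?thesis by (simp add: loading_def)
qed

end

text \<open>
  The transition matrix, restricted to the first \<open>p\<close> coordinates, moves the partial sum from one
  design to the other and keeps the later coordinates. It multiplies coordinate \<open>p - 1\<close> by a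
  factor near 1; the resulting shift of the critical value has small probability.
\<close>

lemma selected_cell_tv:
  fixes s :: "nat \<Rightarrow> real"
  assumes n: "\<And>n. leading_blocks P (R n) (S n)" and T: "leading_blocks P Q T"
    and lim: "\<And>i j. i < P \<Longrightarrow> j < P \<Longrightarrow> (\<lambda>n. R n $$ (i, j)) \<longlonglongrightarrow> Q $$ (i, j)"
    and s: "\<And>n. s n > 0" "\<sigma> > 0" "s \<longlonglongrightarrow> \<sigma>"
    and r: "r \<le> p" "p \<le> P"
  shows "\<exists>\<epsilon>. \<epsilon> \<longlonglongrightarrow> 0 \<and> (\<forall>n. \<forall>E\<in>sets (borel_vec k).
    \<bar>cell_prob k (\<lambda>a q. s n * loading P A (S n) a q) c P r p E
     - cell_prob k (\<lambda>a q. \<sigma> * loading P A T a q) c P r p E\<bar> \<le> \<epsilon> n)"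
proof -
  interpret T: leading_blocks P Q T by fact
  note xlim = leading_blocks_tendsto(1)[OF n T lim] and vlim = leading_blocks_tendsto(2)[OF n T lim]
  define m where "m n = transition P Q T (S n)" for n
  define M where "M n i j = (if i < p \<and> j < p then s n / \<sigma> * m n i j else if i = j then 1 else 0)" for n i j
  have s1: "(\<lambda>n. s n / \<sigma>) \<longlonglongrightarrow> 1" using tendsto_divide[OF s(3) tendsto_const[of \<sigma>]] s(2) by simp
  have mdiag: "m n i i = xi (S n) (Suc i) / xi T (Suc i)" if "i < P" for n i
    using T.transition_upper[of i i "S n"] that leading_blocks.v_diag[OF n that] by (simp add: m_def)
  have mlow: "m n i j = 0" if "j < i" "i < P" for n i j
    using T.transition_upper[of j i "S n"] that by (simp add: m_def inv_factor_def)
  have mlim: "(\<lambda>n. m n i j) \<longlonglongrightarrow> (if i = j then 1 else 0)" if "i < P" "j < P" for i j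
  proof -
    have "(\<lambda>n. m n i j) \<longlonglongrightarrow> (\<Sum>l<P. inv_factor T l i * (\<Sum>m<P. Q $$ (l, m) * inv_factor T m j))"
      unfolding m_def transition_def using that
      by (intro tendsto_sum tendsto_mult tendsto_const vlim) auto
    also have "(\<Sum>l<P. inv_factor T l i * (\<Sum>m<P. Q $$ (l, m) * inv_factor T m j)) = (if i = j then 1 else 0)"
      using T.v_orthonormal[OF that] by (simp add: sum_distrib_left mult_ac)
    finally show ?thesis .
  qed
  define K where "K n w = (\<lambda>i\<in>{..<P}. \<Sum>j\<in>{i..<P}. M n i j * w j)" for n and w :: "nat \<Rightarrow> real"
  have "\<exists>\<epsilon>. \<epsilon> \<longlonglongrightarrow> 0 \<and> (\<forall>n. \<forall>B\<in>sets (SG P).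
    \<bar>measure (SG P) {w \<in> space (SG P). K n w \<in> B} - measure (SG P) B\<bar> \<le> \<epsilon> n)"
    unfolding K_def
  proof (rule triangular_tv)
    show "(\<lambda>n. M n i i) \<longlonglongrightarrow> 1" if "i < P" for i
      using tendsto_mult[OF s1 mlim[OF that that]] by (cases "i < p") (simp_all add: M_def)
    show "M n i i > 0" if "i < P" for n i
      using s(1)[of n] s(2) mdiag[OF that] leading_blocks.xi_pos[OF n that] T.xi_pos[OF that] by (simp add: M_def)
    show "(\<lambda>n. M n i j) \<longlonglongrightarrow> 0" if "i < j" "j < P" for i j
    proof -
      have "(\<lambda>n. M n i j) = (if i < p \<and> j < p then (\<lambda>n. s n / \<sigma> * m n i j) else (\<lambda>_. 0))"
        using that by (auto simp: M_def fun_eq_iff)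
      moreover have "(\<lambda>n. s n / \<sigma> * m n i j) \<longlonglongrightarrow> 1 * 0"
        by (rule tendsto_mult[OF s1]) (use mlim[of i j] that in simp)
      ultimately show ?thesis by (simp del: times_divide_eq_left)
    qed
  qed
  then obtain \<epsilon> where e: "\<epsilon> \<longlonglongrightarrow> 0" "\<And>n B. B \<in> sets (SG P) \<Longrightarrow>
    \<bar>measure (SG P) {w \<in> space (SG P). K n w \<in> B} - measure (SG P) B\<bar> \<le> \<epsilon> n" by auto
  define d where "d n = M n (p - 1) (p - 1)" for n
  have dlim: "d \<longlonglongrightarrow> 1" if "0 < p"
  proof -
    have "d = (\<lambda>n. s n / \<sigma> * m n (p - 1) (p - 1))"
      using that by (auto simp: M_def d_def fun_eq_iff)
    moreover have "(\<lambda>n. s n / \<sigma> * m n (p - 1) (p - 1)) \<longlonglongrightarrow> 1 * 1"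
      by (rule tendsto_mult[OF s1]) (use mlim[of "p - 1" "p - 1"] that r in simp)
    ultimately show ?thesis by (simp only: mult_1)
  qed
  have dpos: "d n > 0" if "0 < p" for n
    using that r s(1)[of n] s(2) mdiag[of "p - 1" n] leading_blocks.xi_pos[OF n, of "p - 1" n] T.xi_pos[of "p - 1"]
    by (simp add: M_def d_def)
  have Kp: "partial_sum_vec k (\<lambda>a q. \<sigma> * loading P A T a q) p (K n w) = partial_sum_vec k (\<lambda>a q. s n * loading P A (S n) a q) p w" for n w
  proof -
    have "(\<Sum>q<p. \<sigma> * loading P A T a q * K n w q) = (\<Sum>q<p. s n * loading P A (S n) a q * w q)" for a
    proof -
      have "(\<Sum>q<p. \<sigma> * loading P A T a q * K n w q) = (\<Sum>q<p. \<Sum>j<p. s n * (loading P A T a q * m n q j) * w j)"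
      proof (intro sum.cong refl)
        fix q assume "q \<in> {..<p}"
        then have q: "q < p" "q < P" using r by auto
        have "K n w q = (\<Sum>j\<in>{q..<P}. M n q j * w j)" using q by (simp add: K_def)
        also have "\<dots> = (\<Sum>j\<in>{q..<p}. s n / \<sigma> * m n q j * w j)"
          using q r by (intro sum.mono_neutral_cong_right) (auto simp: M_def)
        also have "\<dots> = (\<Sum>j<p. s n / \<sigma> * m n q j * w j)"
          using q by (intro sum.mono_neutral_left) (auto simp: mlow)
        finally show "\<sigma> * loading P A T a q * K n w q = (\<Sum>j<p. s n * (loading P A T a q * m n q j) * w j)"
          using s(2) by (simp add: sum_distrib_left mult_ac)
      qed
      also have "\<dots> = (\<Sum>j<p. \<Sum>q<p. s n * (loading P A T a q * m n q j) * w j)" by (rule sum.swap)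
      also have "\<dots> = (\<Sum>j<p. s n * loading P A (S n) a j * w j)"
      proof (intro sum.cong refl)
        fix j assume "j \<in> {..<p}"
        then have "(\<Sum>q<p. loading P A T a q * m n q j) = loading P A (S n) a j"
          using T.loading_transition[of j p A a "S n"] r by (simp add: m_def)
        then show "(\<Sum>q<p. s n * (loading P A T a q * m n q j) * w j) = s n * loading P A (S n) a j * w j"
          by (simp flip: sum_distrib_left sum_distrib_right)
      qed
      finally show ?thesis .
    qed
    then show ?thesis by (simp add: partial_sum_vec_def)
  qed
  have Ktail: "K n w q = w q" if "p \<le> q" "q < P" for n w q
  proof -
    have "M n q j * w j = (if j = q then w q else 0)" for j
      using that by (simp add: M_def)
    then have "K n w q = (\<Sum>j\<in>{q..<P}. if j = q then w q else 0)"
      unfolding K_def using that by simp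
    then show ?thesis using that by (simp add: sum.delta)
  qed
  have Kdiag: "K n w (p - 1) = d n * w (p - 1)" if "0 < p" for n w
  proof -
    have "M n (p - 1) j * w j = (if j = p - 1 then d n * w (p - 1) else 0)" if "j \<in> {p - 1..<P}" for j
    proof (cases "j = p - 1")
      case False
      then have "\<not> j < p" using that by auto
      then show ?thesis using False by (simp add: M_def)
    qed (simp add: d_def)
    then have "K n w (p - 1) = (\<Sum>j\<in>{p - 1..<P}. if j = p - 1 then d n * w (p - 1) else 0)"
      unfolding K_def using that r by (subst restrict_apply', simp) (rule sum.cong[OF refl], blast)
    then show ?thesis using that r by (simp add: sum.delta)
  qed
  have Kspace: "K n w \<in> space (SG P)" for n w by (simp add: K_def space_PiM)
  \<comment> \<open>The second term is the probability that coordinate \<open>p - 1\<close> lies between the two critical values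
    \<open>c p\<close> and \<open>d n * c p\<close>.\<close>
  define \<epsilon>' where "\<epsilon>' n = \<epsilon> n + (if r < p then 4 * (\<bar>d n - 1\<bar> * \<bar>c p\<bar>) else 0)" for n
  have "\<epsilon>' \<longlonglongrightarrow> 0"
  proof (cases "r < p")
    case True
    then have "(\<lambda>n. \<epsilon> n + 4 * (\<bar>d n - 1\<bar> * \<bar>c p\<bar>)) \<longlonglongrightarrow> 0 + 4 * (\<bar>1 - 1\<bar> * \<bar>c p\<bar>)"
      by (intro tendsto_add e(1) tendsto_mult tendsto_const tendsto_rabs tendsto_diff dlim) auto
    moreover have "\<epsilon>' = (\<lambda>n. \<epsilon> n + 4 * (\<bar>d n - 1\<bar> * \<bar>c p\<bar>))" using True by (simp add: \<epsilon>'_def fun_eq_iff)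
    ultimately show ?thesis by simp
  next
    case False
    then have "\<epsilon>' = \<epsilon>" by (simp add: \<epsilon>'_def fun_eq_iff)
    then show ?thesis using e(1) by simp
  qed
  moreover have "\<bar>cell_prob k (\<lambda>a q. s n * loading P A (S n) a q) c P r p E
     - cell_prob k (\<lambda>a q. \<sigma> * loading P A T a q) c P r p E\<bar> \<le> \<epsilon>' n"
    if E: "E \<in> sets (borel_vec k)" for n E
  proof -
    note [measurable] = E
    define B where "B d = {w \<in> space (SG P). (r < p \<longrightarrow> d * c p \<le> \<bar>w (p - 1)\<bar>) \<and> (\<forall>q\<in>{Suc p..P}. \<bar>w (q - 1)\<bar> < c q)
      \<and> partial_sum_vec k (\<lambda>a q. \<sigma> * loading P A T a q) p w \<in> E}" for d
    have Bm: "B d \<in> sets (SG P)" for d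
    proof -
      have [measurable]: "q \<in> {Suc p..P} \<Longrightarrow> (\<lambda>w. w (q - 1)) \<in> borel_measurable (SG P)" for q
        by (rule measurable_SG_component) auto
      have [measurable]: "partial_sum_vec k (\<lambda>a q. \<sigma> * loading P A T a q) p \<in> SG P \<rightarrow>\<^sub>M borel_vec k"
        using r by (intro measurable_partial_sum_vec) auto
      show ?thesis
      proof (cases "r < p")
        case True
        have [measurable]: "(\<lambda>w. w (p - 1)) \<in> borel_measurable (SG P)"
          using True r by (intro measurable_SG_component) auto
        show ?thesis unfolding B_def by measurable
      next
        case False
        have "{w \<in> space (SG P). (\<forall>q\<in>{Suc p..P}. \<bar>w (q - 1)\<bar> < c q)
          \<and> partial_sum_vec k (\<lambda>a q. \<sigma> * loading P A T a q) p w \<in> E} \<in> sets (SG P)" by measurable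
        then show ?thesis using False unfolding B_def by (simp only: simp_thms)
      qed
    qed
    have 1: "{w \<in> space (SG P). sel_order c P r w = p \<and> partial_sum_vec k (\<lambda>a q. \<sigma> * loading P A T a q) p w \<in> E} = B 1"
      unfolding B_def sel_order_eq_iff[OF r] by auto
    have 2: "{w \<in> space (SG P). sel_order c P r w = p \<and> partial_sum_vec k (\<lambda>a q. s n * loading P A (S n) a q) p w \<in> E}
      = {w \<in> space (SG P). K n w \<in> B (d n)}"
    proof -
      have t: "(r < p \<longrightarrow> c p \<le> \<bar>w (p - 1)\<bar>) \<longleftrightarrow> (r < p \<longrightarrow> d n * c p \<le> \<bar>K n w (p - 1)\<bar>)" for w
      proof (cases "r < p")
        case True
        then have "K n w (p - 1) = d n * w (p - 1)" "0 < d n" using Kdiag dpos by auto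
        then have "\<bar>K n w (p - 1)\<bar> = d n * \<bar>w (p - 1)\<bar>" by (simp add: abs_mult)
        then show ?thesis using \<open>0 < d n\<close> by (simp only: mult_le_cancel_left_pos)
      qed simp
      have u: "(\<forall>q\<in>{Suc p..P}. \<bar>w (q - 1)\<bar> < c q) \<longleftrightarrow> (\<forall>q\<in>{Suc p..P}. \<bar>K n w (q - 1)\<bar> < c q)" for w
        using Ktail by (intro ball_cong) auto
      show ?thesis
      proof (rule Collect_cong)
        fix w
        show "(w \<in> space (SG P) \<and> sel_order c P r w = p \<and> partial_sum_vec k (\<lambda>a q. s n * loading P A (S n) a q) p w \<in> E)
          = (w \<in> space (SG P) \<and> K n w \<in> B (d n))"
          unfolding B_def mem_Collect_eq Kp sel_order_eq_iff[OF r]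
          using t[of w] u[of w] Kspace[of n w] by blast
      qed
    qed
    have 3: "\<bar>measure (SG P) (B (d n)) - measure (SG P) (B 1)\<bar> \<le> (if r < p then 4 * (\<bar>d n - 1\<bar> * \<bar>c p\<bar>) else 0)"
    proof (cases "r < p")
      case True
      let ?N = "{w \<in> space (SG P). w (p - 1) \<in> {x. \<bar>\<bar>x\<bar> - c p\<bar> \<le> \<bar>d n - 1\<bar> * \<bar>c p\<bar>}}"
      interpret SG: finite_measure "SG P" by (rule finite_measure_SG)
      have [measurable]: "(\<lambda>w. w (p - 1)) \<in> borel_measurable (SG P)"
        using True r by (intro measurable_SG_component) auto
      have N: "?N \<in> sets (SG P)" by measurable
      have band: "\<bar>\<bar>x\<bar> - c p\<bar> \<le> \<bar>d n - 1\<bar> * \<bar>c p\<bar>"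
        if "(d n * c p \<le> \<bar>x\<bar>) \<noteq> (c p \<le> \<bar>x\<bar>)" for x :: real
      proof -
        have "\<bar>d n - 1\<bar> * \<bar>c p\<bar> = \<bar>d n * c p - c p\<bar>" by (simp add: left_diff_distrib flip: abs_mult)
        then show ?thesis using that by (auto simp: not_le)
      qed
      have sub: "B (d n) \<subseteq> B 1 \<union> ?N" "B 1 \<subseteq> B (d n) \<union> ?N"
        using band unfolding B_def by auto
      have "measure (SG P) (B (d n)) \<le> measure (SG P) (B 1) + measure (SG P) ?N"
        by (rule order_trans[OF SG.finite_measure_mono[OF sub(1) sets.Un[OF Bm N]] measure_Un_le[OF Bm N]])
      moreover have "measure (SG P) (B 1) \<le> measure (SG P) (B (d n)) + measure (SG P) ?N"
        by (rule order_trans[OF SG.finite_measure_mono[OF sub(2) sets.Un[OF Bm N]] measure_Un_le[OF Bm N]])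
      moreover have "measure (SG P) ?N \<le> 4 * (\<bar>d n - 1\<bar> * \<bar>c p\<bar>)"
        using measure_SG_component[of "p - 1" P "{x. \<bar>\<bar>x\<bar> - c p\<bar> \<le> \<bar>d n - 1\<bar> * \<bar>c p\<bar>}"]
          std_normal_band[of "\<bar>d n - 1\<bar> * \<bar>c p\<bar>" "c p"] True r by simp
      ultimately show ?thesis unfolding if_P[OF True] by linarith
    next
      case False
      then have "B (d n) = B 1" by (simp add: B_def)
      then show ?thesis using False by simp
    qed
    show ?thesis unfolding 1 2 \<epsilon>'_def using e(2)[OF Bm[of "d n"], of n] 3 by linarith
  qed
  ultimately show ?thesis by blast
qed

lemma selected_vec_tv:
  fixes s :: "nat \<Rightarrow> real"
  assumes n: "\<And>n. leading_blocks P (R n) (S n)" and T: "leading_blocks P Q T"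
    and lim: "\<And>i j. i < P \<Longrightarrow> j < P \<Longrightarrow> (\<lambda>n. R n $$ (i, j)) \<longlonglongrightarrow> Q $$ (i, j)"
    and s: "\<And>n. s n > 0" "\<sigma> > 0" "s \<longlonglongrightarrow> \<sigma>"
    and r: "r \<le> P"
  shows "\<exists>\<epsilon>. \<epsilon> \<longlonglongrightarrow> 0 \<and> (\<forall>n. \<forall>E\<in>sets (borel_vec k).
    \<bar>selected_prob k (\<lambda>a q. s n * loading P A (S n) a q) c P r E
     - selected_prob k (\<lambda>a q. \<sigma> * loading P A T a q) c P r E\<bar> \<le> \<epsilon> n)"
proof -
  have "\<forall>p\<in>{r..P}. \<exists>\<epsilon>. \<epsilon> \<longlonglongrightarrow> 0 \<and> (\<forall>n. \<forall>E\<in>sets (borel_vec k).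
    \<bar>cell_prob k (\<lambda>a q. s n * loading P A (S n) a q) c P r p E
     - cell_prob k (\<lambda>a q. \<sigma> * loading P A T a q) c P r p E\<bar> \<le> \<epsilon> n)"
    by (intro ballI selected_cell_tv[OF n T lim s]) auto
  from bchoice[OF this] obtain \<epsilon> where e: "\<And>p. p \<in> {r..P} \<Longrightarrow> \<epsilon> p \<longlonglongrightarrow> 0"
    "\<And>p n E. p \<in> {r..P} \<Longrightarrow> E \<in> sets (borel_vec k) \<Longrightarrow>
    \<bar>cell_prob k (\<lambda>a q. s n * loading P A (S n) a q) c P r p E
     - cell_prob k (\<lambda>a q. \<sigma> * loading P A T a q) c P r p E\<bar> \<le> \<epsilon> p n"
    by blast
  have "(\<lambda>n. \<Sum>p\<in>{r..P}. \<epsilon> p n) \<longlonglongrightarrow> 0" by (intro tendsto_null_sum e(1))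
  moreover have "\<bar>selected_prob k (\<lambda>a q. s n * loading P A (S n) a q) c P r E
     - selected_prob k (\<lambda>a q. \<sigma> * loading P A T a q) c P r E\<bar> \<le> (\<Sum>p\<in>{r..P}. \<epsilon> p n)"
    if E: "E \<in> sets (borel_vec k)" for n E
    unfolding measure_selected_vec[OF r E] sum_subtractf[symmetric]
    by (rule order_trans[OF sum_abs]) (intro sum_mono e(2) E)
  ultimately show ?thesis by blast
qed

text \<open>
  A violation for arbitrarily large \<open>n\<close> and \<open>s\<close> arbitrarily close to \<open>\<sigma>\<close> would provide a sequence
  that contradicts convergence along sequences.
\<close>

lemma selected_vec_tv_uniform:
  assumes n: "\<And>n. leading_blocks P (R n) (S n)" and T: "leading_blocks P Q T"
    and lim: "\<And>i j. i < P \<Longrightarrow> j < P \<Longrightarrow> (\<lambda>n. R n $$ (i, j)) \<longlonglongrightarrow> Q $$ (i, j)"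
    and \<sigma>: "\<sigma> > 0" and r: "r \<le> P" and \<delta>: "\<delta> > 0"
  shows "\<exists>N. \<exists>\<rho>>0. \<forall>n\<ge>N. \<forall>s. \<bar>s - \<sigma>\<bar> < \<rho> \<longrightarrow> (\<forall>E\<in>sets (borel_vec k).
    \<bar>selected_prob k (\<lambda>a q. s * loading P A (S n) a q) c P r E
     - selected_prob k (\<lambda>a q. \<sigma> * loading P A T a q) c P r E\<bar> \<le> \<delta>)"
proof (rule ccontr)
  assume neg: "\<not> ?thesis"
  define gap where "gap n s E = \<bar>selected_prob k (\<lambda>a q. s * loading P A (S n) a q) c P r E
     - selected_prob k (\<lambda>a q. \<sigma> * loading P A T a q) c P r E\<bar>" for n s E
  have "\<forall>j. \<exists>x. case x of (n, s, E) \<Rightarrow> j \<le> n \<and> \<bar>s - \<sigma>\<bar> < \<sigma> / (real j + 1) \<and> E \<in> sets (borel_vec k) \<and> \<delta> < gap n s E"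
  proof
    fix j :: nat
    have "\<sigma> / (real j + 1) > 0" using \<sigma> by simp
    with neg have "\<not> (\<forall>n\<ge>j. \<forall>s. \<bar>s - \<sigma>\<bar> < \<sigma> / (real j + 1) \<longrightarrow> (\<forall>E\<in>sets (borel_vec k). gap n s E \<le> \<delta>))"
      unfolding gap_def by blast
    then obtain n s E where "j \<le> n" "\<bar>s - \<sigma>\<bar> < \<sigma> / (real j + 1)" "E \<in> sets (borel_vec k)" "\<not> gap n s E \<le> \<delta>" by blast
    then show "\<exists>x. case x of (n, s, E) \<Rightarrow> j \<le> n \<and> \<bar>s - \<sigma>\<bar> < \<sigma> / (real j + 1) \<and> E \<in> sets (borel_vec k) \<and> \<delta> < gap n s E"
      by (intro exI[of _ "(n, s, E)"]) simp
  qed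
  from choice[OF this] obtain f where f: "\<And>j. case f j of (n, s, E) \<Rightarrow> j \<le> n \<and> \<bar>s - \<sigma>\<bar> < \<sigma> / (real j + 1) \<and> E \<in> sets (borel_vec k) \<and> \<delta> < gap n s E"
    by blast
  define m where "m j = fst (f j)" for j
  define s where "s j = fst (snd (f j))" for j
  define E where "E j = snd (snd (f j))" for j
  have f': "j \<le> m j" "\<bar>s j - \<sigma>\<bar> < \<sigma> / (real j + 1)" "E j \<in> sets (borel_vec k)" "\<delta> < gap (m j) (s j) (E j)" for j
    using f[of j] by (auto simp: m_def s_def E_def split: prod.splits)
  have mlim: "filterlim m at_top sequentially"
    by (rule filterlim_at_top_mono[OF filterlim_ident]) (use f'(1) in auto)
  have spos: "s j > 0" for j
  proof -
    have "\<sigma> / (real j + 1) \<le> \<sigma>" using \<sigma> by (simp add: field_simps)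
    then show ?thesis using f'(2)[of j] by linarith
  qed
  have slim: "s \<longlonglongrightarrow> \<sigma>"
  proof -
    have "(\<lambda>j. \<sigma> / (real j + 1)) \<longlonglongrightarrow> 0" by real_asymp
    then have "(\<lambda>j. s j - \<sigma>) \<longlonglongrightarrow> 0"
      by (rule Lim_null_comparison[rotated]) (use f'(2) in \<open>auto intro!: always_eventually less_imp_le\<close>)
    then show ?thesis by (simp add: LIM_zero_iff)
  qed
  have Rlim: "(\<lambda>j. R (m j) $$ (i, l)) \<longlonglongrightarrow> Q $$ (i, l)" if "i < P" "l < P" for i l
    using filterlim_compose[OF lim[OF that] mlim] .
  have "\<exists>\<epsilon>. \<epsilon> \<longlonglongrightarrow> 0 \<and> (\<forall>j. \<forall>E\<in>sets (borel_vec k). gap (m j) (s j) E \<le> \<epsilon> j)"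
    unfolding gap_def by (rule selected_vec_tv[OF n T Rlim spos \<sigma> slim r])
  then obtain \<epsilon> where e: "\<epsilon> \<longlonglongrightarrow> 0" "\<And>j E. E \<in> sets (borel_vec k) \<Longrightarrow> gap (m j) (s j) E \<le> \<epsilon> j"
    by auto
  have "eventually (\<lambda>j. \<epsilon> j < \<delta>) sequentially" by (rule order_tendstoD(2)[OF e(1) \<delta>])
  then obtain j where "\<epsilon> j < \<delta>" by (auto simp: eventually_sequentially)
  with e(2)[OF f'(3), of j j] f'(4)[of j] show False by linarith
qed

section \<open>Concentration of sums of squares\<close>

text \<open>
  The variance of a sum of \<open>m\<close> squares is \<open>2 m\<close>, since the centred squares are orthogonal with
  second moment 2.
\<close>

lemma chi_square_chebyshev:
  assumes a: "a > 0"
  shows "measure (SG m) {w \<in> space (SG m). a \<le> \<bar>(\<Sum>i<m. (w i)\<^sup>2) - m\<bar>} \<le> 2 * m / a\<^sup>2"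
proof -
  interpret PP: product_prob_space "\<lambda>_ :: nat. N01" "{..<m}" by (rule product_prob_space_std_normal)
  interpret SG: prob_space "SG m" by (rule prob_space_SG)
  define u where "u x = x\<^sup>2 - 1" for x :: real
  have m2: "(LINT x|N01. x\<^sup>2) = 1" "integrable N01 (\<lambda>x. x\<^sup>2)"
    using std_normal_distribution_even_moments[of 1] by simp_all
  have m4: "(LINT x|N01. x ^ 4) = 3" "integrable N01 (\<lambda>x. x ^ 4)"
    using std_normal_distribution_even_moments[of 2] by (simp_all add: fact_numeral)
  have iu: "integrable N01 u" unfolding u_def using m2 by simp
  have Eu: "(LINT x|N01. u x) = 0" unfolding u_def using m2 PP.M.prob_space by simp
  have uu: "u x * u x = x ^ 4 - 2 * x\<^sup>2 + 1" for x by (simp add: u_def power2_eq_square power4_eq_xxxx algebra_simps)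
  have iuu: "integrable N01 (\<lambda>x. u x * u x)" unfolding uu using m2 m4 by simp
  have Euu: "(LINT x|N01. u x * u x) = 2" unfolding uu using m2 m4 PP.M.prob_space by simp
  have one: "(LINT x|N01. 1 :: real) = 1" using PP.M.prob_space by simp
  have pair: "integrable (SG m) (\<lambda>w. u (w i) * u (w j))"
     "(LINT w|SG m. u (w i) * u (w j)) = (if i = j then 2 else 0)" if ij: "i < m" "j < m" for i j
  proof -
    define f where "f l x = (if l = i then u x else 1) * (if l = j then u x else 1)" for l x
    have fi: "integrable N01 (f l)" for l
      using iu iuu by (cases "l = i"; cases "l = j") (simp_all add: f_def[abs_def])
    have P: "(\<Prod>l<m. f l (w l)) = u (w i) * u (w j)" for w
      using ij by (simp add: f_def prod.distrib prod.delta)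
    show "integrable (SG m) (\<lambda>w. u (w i) * u (w j))"
      using PP.product_integrable_prod[of "{..<m}" f] fi by (simp add: P)
    have "(LINT w|SG m. u (w i) * u (w j)) = (\<Prod>l<m. (LINT x|N01. f l x))"
      using PP.product_integral_prod[of "{..<m}" f] fi by (simp add: P)
    also have "\<dots> = (if i = j then 2 else 0)"
    proof (cases "i = j")
      case True
      have "(LINT x|N01. f l x) = (if l = i then 2 else 1)" for l
        using True Euu one by (simp add: f_def)
      then show ?thesis using True ij by (simp add: prod.delta)
    next
      case False
      have "(LINT x|N01. f i x) = 0" using False Eu by (simp add: f_def)
      then have "(\<Prod>l<m. (LINT x|N01. f l x)) = 0" using ij by (intro prod_zero) auto
      then show ?thesis using False by simp
    qed
    finally show "(LINT w|SG m. u (w i) * u (w j)) = (if i = j then 2 else 0)" .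
  qed
  define V where "V w = ((\<Sum>i<m. (w i)\<^sup>2) - m)\<^sup>2" for w :: "nat \<Rightarrow> real"
  have V: "V w = (\<Sum>i<m. \<Sum>j<m. u (w i) * u (w j))" for w
  proof -
    have "(\<Sum>i<m. (w i)\<^sup>2) - m = (\<Sum>i<m. u (w i))" by (simp add: u_def sum_subtractf)
    then show ?thesis by (simp add: V_def power2_eq_square sum_product)
  qed
  have iV: "integrable (SG m) V" unfolding V[abs_def] by (intro Bochner_Integration.integrable_sum pair) auto
  have EV: "(LINT w|SG m. V w) = 2 * m"
  proof -
    have "(LINT w|SG m. V w) = (\<Sum>i<m. \<Sum>j<m. (LINT w|SG m. u (w i) * u (w j)))"
      unfolding V by (subst Bochner_Integration.integral_sum, intro Bochner_Integration.integrable_sum pair, simp, simp)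
        (intro sum.cong refl Bochner_Integration.integral_sum pair, auto)
    also have "\<dots> = (\<Sum>i<m. \<Sum>j<m. if i = j then 2 else 0)" by (intro sum.cong refl pair) auto
    finally show ?thesis by (simp add: sum.delta)
  qed
  have "{w \<in> space (SG m). a \<le> \<bar>(\<Sum>i<m. (w i)\<^sup>2) - m\<bar>} = {w \<in> space (SG m). a\<^sup>2 \<le> V w}"
    using a by (auto simp: V_def abs_le_square_iff[symmetric])
  also have "measure (SG m) \<dots> \<le> (LINT w|SG m. V w) / a\<^sup>2"
    by (rule integral_Markov_inequality_measure[OF iV, where A="{}"]) (use a in \<open>auto simp: V_def\<close>)
  finally show ?thesis by (simp add: EV)
qed

section \<open>The finite-sample distribution\<close>

locale sample_design =
  fixes P n :: nat and X :: "real mat" and \<theta> :: "real vec" and \<sigma> :: real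
  assumes P: "1 \<le> P" "P < n" and X: "X \<in> carrier_mat n P" and rank: "vec_space.rank n X = P"
    and \<theta>: "\<theta> \<in> carrier_vec P" and \<sigma>: "\<sigma> > 0"
begin

sublocale leading_blocks P "gram X P" "gram X"
  using gram_leading_blocks[OF X rank] P by simp

abbreviation R :: "real mat" where "R \<equiv> gram X P"

lemma n_pos: "real n > 0" using P by simp

text \<open>
  \<open>coord Y q\<close> is \<open>sqrt n\<close> times the last component of the restricted estimator of order \<open>q + 1\<close>,
  divided by \<open>\<xi>\<close>.
\<close>

definition coord :: "real vec \<Rightarrow> nat \<Rightarrow> real" where
  "coord Y q = (\<Sum>j<P. v j q * (\<Sum>l<n. X $$ (l, j) * Y $ l)) / sqrt n"

text \<open>
  The restricted estimators of all orders are partial sums of one and the same sequence, by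
  \<open>minv_eq\<close>.
\<close>

lemma theta_restr_eq:
  assumes p: "p \<le> P" and i: "i < P" and Y: "Y \<in> carrier_vec n"
  shows "theta_restr X Y p $ i = (\<Sum>q<p. v i q * coord Y q) / sqrt n"
proof (cases "i < p")
  case False
  then have "(\<Sum>q<p. v i q * coord Y q) = 0" by (intro sum.neutral) (auto simp: v_upper)
  then show ?thesis using False i X by (simp add: theta_restr_def Let_def)
next
  case True
  then have p1: "1 \<le> p" by simp
  define Xp where "Xp = first_cols p X"
  define N where "N = Xp\<^sup>T * Xp"
  define c where "c j = (\<Sum>l<n. X $$ (l, j) * Y $ l)" for j
  have Xp: "Xp \<in> carrier_mat n p" using X by (simp add: Xp_def first_cols_def)
  have N: "N \<in> carrier_mat p p" using Xp by (simp add: N_def)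
  have g: "gram X p = (1 / real n) \<cdot>\<^sub>m N" using X by (simp add: gram_def N_def Xp_def)
  note mg = minv_inverse[OF S_pos_def[OF p1 p]]
  have mN: "minv N = (1 / real n) \<cdot>\<^sub>m minv (gram X p)"
  proof (rule minv_eqI[OF N])
    show "1 / real n \<cdot>\<^sub>m minv (gram X p) \<in> carrier_mat p p" using mg(1) by simp
    have "1 / real n \<cdot>\<^sub>m minv (gram X p) * N = (1 / real n) \<cdot>\<^sub>m (minv (gram X p) * N)"
      by (rule mult_smult_assoc_mat[OF mg(1) N])
    also have "\<dots> = minv (gram X p) * ((1 / real n) \<cdot>\<^sub>m N)"
      by (rule mult_smult_distrib[OF mg(1) N, symmetric])
    finally show "1 / real n \<cdot>\<^sub>m minv (gram X p) * N = 1\<^sub>m p" using mg(3) g by simp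
  qed
  have XY: "(Xp\<^sup>T *\<^sub>v Y) $ j = c j" if "j < p" for j
    using that Xp Y X by (simp add: scalar_prod_def atLeast0LessThan c_def Xp_def first_cols_def)
  have "theta_restr X Y p $ i = (minv N *\<^sub>v (Xp\<^sup>T *\<^sub>v Y)) $ i"
    using True i X by (simp add: theta_restr_def Let_def Xp_def N_def)
  also have "\<dots> = (\<Sum>j<p. minv N $$ (i, j) * (Xp\<^sup>T *\<^sub>v Y) $ j)"
    using True mN mg(1) Xp by (simp add: scalar_prod_def atLeast0LessThan del: index_mult_mat_vec) (simp add: scalar_prod_def atLeast0LessThan)
  also have "\<dots> = (\<Sum>j<p. (1 / real n) * minv (gram X p) $$ (i, j) * c j)"
    using True mg(1) by (intro sum.cong refl) (simp add: mN XY del: index_mult_mat_vec)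
  also have "\<dots> = (\<Sum>j<p. \<Sum>q<p. v i q * (v j q * c j) / real n)"
    using True p p1 by (intro sum.cong refl) (simp add: minv_eq sum_distrib_left sum_distrib_right sum_divide_distrib mult_ac)
  also have "\<dots> = (\<Sum>q<p. \<Sum>j<p. v i q * (v j q * c j) / real n)" by (rule sum.swap)
  also have "\<dots> = (\<Sum>q<p. v i q * coord Y q / sqrt n)"
  proof (intro sum.cong refl)
    fix q assume "q \<in> {..<p}"
    then have "(\<Sum>j<p. v j q * c j) = (\<Sum>j<P. v j q * c j)"
      using p by (intro sum_lessThan_zero_beyond[symmetric]) (auto simp: v_upper)
    then have "(\<Sum>j<p. v j q * c j) = coord Y q * sqrt n" using n_pos by (simp add: coord_def c_def)
    then have "(\<Sum>j<p. v i q * (v j q * c j) / real n) = v i q * (coord Y q * sqrt n) / real n"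
      by (simp flip: sum_distrib_left sum_divide_distrib)
    also have "\<dots> = v i q * coord Y q * (sqrt n / real n)" by simp
    also have "sqrt n / real n = 1 / sqrt n" using n_pos by (simp add: frac_eq_eq)
    finally show "(\<Sum>j<p. v i q * (v j q * c j) / real n) = v i q * coord Y q / sqrt n" by simp
  qed
  finally show ?thesis by (simp add: sum_divide_distrib)
qed

definition Ymap :: "(nat \<Rightarrow> real) \<Rightarrow> real vec" where
  "Ymap z = vec n (\<lambda>l. (\<Sum>i<P. X $$ (l, i) * \<theta> $ i) + \<sigma> * z l)"

definition Lw :: "nat \<Rightarrow> nat \<Rightarrow> real" where
  "Lw q l = (\<Sum>j<P. v j q * X $$ (l, j)) / sqrt n"

definition W :: "(nat \<Rightarrow> real) \<Rightarrow> nat \<Rightarrow> real" where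
  "W z q = (\<Sum>l<n. Lw q l * z l)"

definition drift :: "nat \<Rightarrow> real" where
  "drift q = (\<Sum>i<P. (\<Sum>j<P. v j q * R $$ (j, i)) * \<theta> $ i)"

lemma Ymap_carrier [simp]: "Ymap z \<in> carrier_vec n" by (simp add: Ymap_def)

lemma R_entry: "i < P \<Longrightarrow> j < P \<Longrightarrow> R $$ (i, j) = (\<Sum>l<n. X $$ (l, i) * X $$ (l, j)) / n"
  using gram_entry[OF X] by simp

lemma coord_Ymap: "coord (Ymap z) q = \<sigma> * W z q + sqrt n * drift q"
proof -
  have "(\<Sum>j<P. v j q * (\<Sum>l<n. X $$ (l, j) * Ymap z $ l))
    = (\<Sum>j<P. v j q * (\<Sum>l<n. X $$ (l, j) * (\<Sum>i<P. X $$ (l, i) * \<theta> $ i))) + \<sigma> * (\<Sum>j<P. v j q * (\<Sum>l<n. X $$ (l, j) * z l))"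
    unfolding sum_distrib_left sum.distrib[symmetric]
    by (intro sum.cong refl) (simp add: Ymap_def algebra_simps sum_distrib_left sum.distrib)
  also have "(\<Sum>j<P. v j q * (\<Sum>l<n. X $$ (l, j) * z l)) = sqrt n * W z q"
  proof -
    have "sqrt n * W z q = (\<Sum>l<n. \<Sum>j<P. v j q * (X $$ (l, j) * z l))"
      using n_pos by (simp add: W_def Lw_def sum_distrib_left sum_distrib_right sum_divide_distrib mult_ac)
    also have "\<dots> = (\<Sum>j<P. \<Sum>l<n. v j q * (X $$ (l, j) * z l))" by (rule sum.swap)
    finally show ?thesis by (simp add: sum_distrib_left)
  qed
  also have "(\<Sum>j<P. v j q * (\<Sum>l<n. X $$ (l, j) * (\<Sum>i<P. X $$ (l, i) * \<theta> $ i))) = n * drift q"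
  proof -
    have "(\<Sum>j<P. v j q * (\<Sum>l<n. X $$ (l, j) * (\<Sum>i<P. X $$ (l, i) * \<theta> $ i)))
      = (\<Sum>j<P. \<Sum>i<P. v j q * (real n * R $$ (j, i)) * \<theta> $ i)"
    proof (intro sum.cong refl)
      fix j assume j: "j \<in> {..<P}"
      have "(\<Sum>l<n. X $$ (l, j) * (\<Sum>i<P. X $$ (l, i) * \<theta> $ i)) = (\<Sum>i<P. \<Sum>l<n. X $$ (l, j) * X $$ (l, i) * \<theta> $ i)"
        unfolding sum_distrib_left by (subst sum.swap) (simp add: mult_ac)
      also have "\<dots> = (\<Sum>i<P. real n * R $$ (j, i) * \<theta> $ i)"
        using j n_pos by (intro sum.cong refl) (simp add: R_entry sum_distrib_right)
      finally show "v j q * (\<Sum>l<n. X $$ (l, j) * (\<Sum>i<P. X $$ (l, i) * \<theta> $ i)) = (\<Sum>i<P. v j q * (real n * R $$ (j, i)) * \<theta> $ i)"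
        by (simp add: sum_distrib_left mult_ac)
    qed
    also have "\<dots> = (\<Sum>i<P. \<Sum>j<P. v j q * (real n * R $$ (j, i)) * \<theta> $ i)" by (rule sum.swap)
    finally show ?thesis by (simp add: drift_def sum_distrib_left sum_distrib_right mult_ac)
  qed
  finally have "coord (Ymap z) q = (real n * drift q + \<sigma> * (sqrt n * W z q)) / sqrt n"
    by (simp add: coord_def)
  also have "\<dots> = drift q * (real n / sqrt n) + \<sigma> * W z q * (sqrt n / sqrt n)"
    by (simp add: add_divide_distrib mult_ac)
  finally show ?thesis using n_pos by (simp add: real_div_sqrt mult_ac)
qed

lemma Lw_orthonormal:
  assumes "q < P" "q' < P"
  shows "(\<Sum>l<n. Lw q l * Lw q' l) = (if q = q' then 1 else 0)"
proof -
  have "(\<Sum>l<n. Lw q l * Lw q' l) = (\<Sum>l<n. (\<Sum>i<P. v i q * X $$ (l, i)) * (\<Sum>j<P. v j q' * X $$ (l, j)) / n)"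
    using n_pos by (simp add: Lw_def)
  also have "\<dots> = (\<Sum>l<n. \<Sum>i<P. \<Sum>j<P. v i q * (X $$ (l, i) * X $$ (l, j)) * v j q' / n)"
    unfolding sum_product sum_divide_distrib by (simp add: mult_ac)
  also have "\<dots> = (\<Sum>i<P. \<Sum>l<n. \<Sum>j<P. v i q * (X $$ (l, i) * X $$ (l, j)) * v j q' / n)" by (rule sum.swap)
  also have "\<dots> = (\<Sum>i<P. \<Sum>j<P. \<Sum>l<n. v i q * (X $$ (l, i) * X $$ (l, j)) * v j q' / n)"
    by (intro sum.cong refl sum.swap)
  also have "\<dots> = (\<Sum>i<P. \<Sum>j<P. v i q * R $$ (i, j) * v j q')"
    by (intro sum.cong refl) (simp add: R_entry sum_distrib_left sum_distrib_right sum_divide_distrib)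
  finally show ?thesis using v_orthonormal[OF assms] by simp
qed

text \<open>The rows of the coefficient matrix are orthonormal.\<close>

lemma law_W:
  assumes B: "B \<in> sets (SG P)"
  shows "measure (SG n) {z \<in> space (SG n). (\<lambda>q\<in>{..<P}. W z q) \<in> B} = measure (SG P) B"
proof -
  have B': "B \<in> sets (\<Pi>\<^sub>M i\<in>{..<P}. (borel :: real measure))" using B by (simp only: sets_SG)
  have meas: "(\<lambda>z. \<lambda>i\<in>{..<P}. \<Sum>j<m. b i j * z j) \<in> SG m \<rightarrow>\<^sub>M (\<Pi>\<^sub>M i\<in>{..<P}. borel)" for m and b :: "nat \<Rightarrow> nat \<Rightarrow> real"
    by (rule measurable_restrict) measurable
  have d: "(\<Sum>j<P. (if j = i then 1 else 0) * f j) = f i" if "i < P" for i and f :: "nat \<Rightarrow> real"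
  proof -
    have "(\<Sum>j<P. (if j = i then 1 else 0) * f j) = (\<Sum>j<P. if j = i then f i else 0)" by (intro sum.cong) auto
    then show ?thesis using that by (simp add: sum.delta)
  qed
  have cov: "(\<Sum>j<n. Lw i j * Lw l j) = (\<Sum>j<P. (if j = i then 1 else 0) * (if j = l then 1 else 0))" if "i < P" "l < P" for i l
    using Lw_orthonormal[OF that] d[OF that(1), of "\<lambda>j. if j = l then 1 else 0"] by simp
  have "measure (distr (SG n) (\<Pi>\<^sub>M i\<in>{..<P}. borel) (\<lambda>z. \<lambda>i\<in>{..<P}. \<Sum>j<n. Lw i j * z j)) B
     = measure (distr (SG P) (\<Pi>\<^sub>M i\<in>{..<P}. borel) (\<lambda>z. \<lambda>i\<in>{..<P}. \<Sum>j<P. (if j = i then 1 else 0) * z j)) B"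
    using linear_law_eqI[where K=P and a=Lw and a'="\<lambda>i j. if j = i then 1 else 0", OF cov] by simp
  moreover have "(\<lambda>z. \<lambda>i\<in>{..<P}. \<Sum>j<P. (if j = i then 1 else 0) * z j) -` B \<inter> space (SG P) = B"
  proof -
    have "(\<lambda>i\<in>{..<P}. \<Sum>j<P. (if j = i then 1 else 0) * z j) = z" if "z \<in> space (SG P)" for z
      using that d[of _ z] by (auto simp: space_PiM PiE_def extensional_def fun_eq_iff restrict_def)
    then show ?thesis using sets.sets_into_space[OF B] by auto
  qed
  moreover have "(\<lambda>z. \<lambda>i\<in>{..<P}. \<Sum>j<n. Lw i j * z j) -` B \<inter> space (SG n) = {z \<in> space (SG n). (\<lambda>q\<in>{..<P}. W z q) \<in> B}"
    by (auto simp: W_def)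
  ultimately show ?thesis by (simp only: measure_distr[OF meas B'])
qed

lemma measurable_W [measurable]: "(\<lambda>z. W z q) \<in> borel_measurable (SG n)"
  unfolding W_def by measurable

lemma measurable_restrict_W [measurable]: "(\<lambda>z. \<lambda>q\<in>{..<P}. W z q) \<in> SG n \<rightarrow>\<^sub>M SG P"
  by (rule measurable_restrict) simp

text \<open>
  The mean of coordinate \<open>q\<close> sees only coefficients from position \<open>q\<close> on, because \<open>R V\<^sub>q\<close> vanishes
  in earlier positions.
\<close>

lemma drift_eq:
  assumes q: "q < P" and z: "\<And>i. q < i \<Longrightarrow> i < P \<Longrightarrow> \<theta> $ i = 0"
  shows "drift q = \<theta> $ q / xi (gram X) (Suc q)"
proof -
  have "drift q = (\<Sum>i<P. if i = q then \<theta> $ q / xi (gram X) (Suc q) else 0)"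
    unfolding drift_def
  proof (intro sum.cong refl)
    fix i assume i: "i \<in> {..<P}"
    show "(\<Sum>j<P. v j q * R $$ (j, i)) * \<theta> $ i = (if i = q then \<theta> $ q / xi (gram X) (Suc q) else 0)"
    proof (cases "i \<le> q")
      case True
      have "(\<Sum>j<P. v j q * R $$ (j, i)) = (\<Sum>j<P. R $$ (i, j) * v j q)"
        using i by (intro sum.cong refl) (simp add: R_sym mult_ac)
      then show ?thesis using R_v[OF q True] by simp
    qed (use z i in simp)
  qed
  then show ?thesis using q by (simp add: sum.delta)
qed

lemma sum_v_drift:
  assumes i: "i < P"
  shows "(\<Sum>q<P. v i q * drift q) = \<theta> $ i"
proof -
  have "(\<Sum>q<P. v i q * drift q) = (\<Sum>q<P. \<Sum>m<P. v i q * (\<Sum>j<P. v j q * R $$ (j, m)) * \<theta> $ m)"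
    by (simp add: drift_def sum_distrib_left mult_ac)
  also have "\<dots> = (\<Sum>m<P. \<Sum>q<P. v i q * (\<Sum>j<P. v j q * R $$ (j, m)) * \<theta> $ m)" by (rule sum.swap)
  also have "\<dots> = (\<Sum>m<P. if m = i then \<theta> $ i else 0)"
    using i by (intro sum.cong refl) (simp add: v_v_R flip: sum_distrib_right)
  finally show ?thesis using i by (simp add: sum.delta)
qed

text \<open>
  In a correct model the means of the coordinates add up to \<open>\<theta>\<close> exactly, so the bias cancels.
\<close>

lemma theta_restr_Ymap:
  assumes p: "p \<le> P" and z: "\<And>i. p \<le> i \<Longrightarrow> i < P \<Longrightarrow> \<theta> $ i = 0" and i: "i < P"
  shows "sqrt n * (theta_restr X (Ymap z) p $ i - \<theta> $ i) = (\<Sum>q<p. v i q * (\<sigma> * W z q))"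
proof -
  have "(\<Sum>q<P. v i q * drift q) = (\<Sum>q<p. v i q * drift q)"
    using drift_eq z by (intro sum_lessThan_zero_beyond[OF p]) auto
  then have th: "\<theta> $ i = (\<Sum>q<p. v i q * drift q)" using sum_v_drift[OF i] by simp
  have "sqrt n * theta_restr X (Ymap z) p $ i = (\<Sum>q<p. v i q * coord (Ymap z) q)"
    using n_pos by (simp add: theta_restr_eq[OF p i])
  also have "\<dots> = (\<Sum>q<p. v i q * (\<sigma> * W z q)) + sqrt n * (\<Sum>q<p. v i q * drift q)"
    by (simp add: coord_Ymap algebra_simps sum.distrib sum_distrib_left)
  finally show ?thesis using th by (simp add: right_diff_distrib)
qed

lemma T_stat_eq:
  assumes p: "1 \<le> p" "p \<le> P" and Y: "Y \<in> carrier_vec n"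
  shows "T_stat X Y p = coord Y (p - 1) / sigma_hat X Y"
proof -
  have q: "p - 1 < P" "Suc (p - 1) = p" using p by auto
  have "theta_restr X Y p $ (p - 1) = (\<Sum>q<p. v (p - 1) q * coord Y q) / sqrt n"
    by (rule theta_restr_eq[OF p(2) q(1) Y])
  also have "(\<Sum>q<p. v (p - 1) q * coord Y q) = (\<Sum>q<p. if q = p - 1 then xi (gram X) p * coord Y (p - 1) else 0)"
    using v_diag[OF q(1)] q(2) by (intro sum.cong refl) (auto simp: v_upper)
  also have "\<dots> = xi (gram X) p * coord Y (p - 1)" using p by (simp add: sum.delta)
  finally show ?thesis using p X n_pos xi_pos[OF q(1)] q(2) by (simp add: T_stat_def)
qed

text \<open>Pythagoras for the projection onto the orthonormal rows of \<open>Lw\<close>.\<close>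

lemma residual_sum_of_squares:
  "(\<Sum>l<n. (z l - (\<Sum>q<P. Lw q l * W z q))\<^sup>2) = (\<Sum>l<n. (z l)\<^sup>2) - (\<Sum>q<P. (W z q)\<^sup>2)"
proof -
  have "(\<Sum>l<n. (z l - (\<Sum>q<P. Lw q l * W z q))\<^sup>2)
    = (\<Sum>l<n. (z l)\<^sup>2) - 2 * (\<Sum>l<n. z l * (\<Sum>q<P. Lw q l * W z q)) + (\<Sum>l<n. (\<Sum>q<P. Lw q l * W z q)\<^sup>2)"
    unfolding sum_distrib_left[of 2] sum_subtractf[symmetric] sum.distrib[symmetric]
    by (intro sum.cong refl) (simp add: power2_eq_square algebra_simps)
  also have "(\<Sum>l<n. z l * (\<Sum>q<P. Lw q l * W z q)) = (\<Sum>q<P. (W z q)\<^sup>2)"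
  proof -
    have "(\<Sum>l<n. z l * (\<Sum>q<P. Lw q l * W z q)) = (\<Sum>q<P. \<Sum>l<n. Lw q l * z l * W z q)"
      unfolding sum_distrib_left by (subst sum.swap) (simp add: mult_ac)
    also have "\<dots> = (\<Sum>q<P. W z q * W z q)"
      unfolding sum_distrib_right[symmetric] W_def[symmetric] ..
    finally show ?thesis by (simp add: power2_eq_square)
  qed
  also have "(\<Sum>l<n. (\<Sum>q<P. Lw q l * W z q)\<^sup>2) = (\<Sum>q<P. (W z q)\<^sup>2)"
  proof -
    have "(\<Sum>l<n. (\<Sum>q<P. Lw q l * W z q)\<^sup>2) = (\<Sum>l<n. \<Sum>q<P. \<Sum>q'<P. W z q * W z q' * (Lw q l * Lw q' l))"
      by (simp add: power2_eq_square sum_product mult_ac)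
    also have "\<dots> = (\<Sum>q<P. \<Sum>l<n. \<Sum>q'<P. W z q * W z q' * (Lw q l * Lw q' l))" by (rule sum.swap)
    also have "\<dots> = (\<Sum>q<P. \<Sum>q'<P. \<Sum>l<n. W z q * W z q' * (Lw q l * Lw q' l))"
      by (intro sum.cong refl sum.swap)
    also have "\<dots> = (\<Sum>q<P. \<Sum>q'<P. if q' = q then (W z q)\<^sup>2 else 0)"
      unfolding sum_distrib_left[symmetric]
      by (intro sum.cong refl) (simp add: Lw_orthonormal power2_eq_square)
    finally show ?thesis by (simp add: sum.delta)
  qed
  finally show ?thesis by simp
qed

lemma sigma_hat_Ymap:
  "sigma_hat X (Ymap z) = \<sigma> * sqrt (((\<Sum>l<n. (z l)\<^sup>2) - (\<Sum>q<P. (W z q)\<^sup>2)) / (real n - real P))"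
proof -
  define t where "t = theta_restr X (Ymap z) P"
  define res where "res = Ymap z - X *\<^sub>v t"
  have t: "t \<in> carrier_vec P" using X by (simp add: t_def theta_restr_def Let_def)
  have ti: "t $ i = \<theta> $ i + \<sigma> * (\<Sum>q<P. v i q * W z q) / sqrt n" if "i < P" for i
  proof -
    have "sqrt n * (t $ i - \<theta> $ i) = \<sigma> * (\<Sum>q<P. v i q * W z q)"
      using theta_restr_Ymap[of P i z] that by (simp add: t_def sum_distrib_left mult_ac)
    then show ?thesis using n_pos by (simp add: field_simps)
  qed
  have res: "res $ l = \<sigma> * (z l - (\<Sum>q<P. Lw q l * W z q))" if l: "l < n" for l
  proof -
    have "(X *\<^sub>v t) $ l = (\<Sum>i<P. X $$ (l, i) * t $ i)"
      using l X t by (simp add: scalar_prod_def atLeast0LessThan)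
    also have "\<dots> = (\<Sum>i<P. X $$ (l, i) * \<theta> $ i) + \<sigma> * (\<Sum>i<P. X $$ (l, i) * ((\<Sum>q<P. v i q * W z q) / sqrt n))"
      unfolding sum_distrib_left[of \<sigma>] sum.distrib[symmetric]
      by (intro sum.cong refl) (simp add: ti algebra_simps)
    also have "(\<Sum>i<P. X $$ (l, i) * ((\<Sum>q<P. v i q * W z q) / sqrt n)) = (\<Sum>q<P. Lw q l * W z q)"
    proof -
      have "(\<Sum>i<P. X $$ (l, i) * ((\<Sum>q<P. v i q * W z q) / sqrt n)) = (\<Sum>i<P. \<Sum>q<P. v i q * X $$ (l, i) / sqrt n * W z q)"
        by (simp add: sum_distrib_left sum_divide_distrib mult_ac)
      also have "\<dots> = (\<Sum>q<P. \<Sum>i<P. v i q * X $$ (l, i) / sqrt n * W z q)" by (rule sum.swap)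
      finally show ?thesis by (simp add: Lw_def sum_distrib_right sum_divide_distrib)
    qed
    finally show ?thesis using l X by (simp add: res_def Ymap_def algebra_simps)
  qed
  have "res \<bullet> res = (\<Sum>l<n. (res $ l)\<^sup>2)"
    using X by (simp add: scalar_prod_def atLeast0LessThan res_def power2_eq_square)
  also have "\<dots> = \<sigma>\<^sup>2 * (\<Sum>l<n. (z l - (\<Sum>q<P. Lw q l * W z q))\<^sup>2)"
    by (simp add: res power_mult_distrib sum_distrib_left)
  finally have "res \<bullet> res = \<sigma>\<^sup>2 * ((\<Sum>l<n. (z l)\<^sup>2) - (\<Sum>q<P. (W z q)\<^sup>2))" by (simp only: residual_sum_of_squares)
  then have "sigma_hat X (Ymap z) = sqrt (\<sigma>\<^sup>2 * (((\<Sum>l<n. (z l)\<^sup>2) - (\<Sum>q<P. (W z q)\<^sup>2)) / (real n - real P)))"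
    using X by (simp add: sigma_hat_def Let_def res_def t_def)
  then show ?thesis using \<sigma> by (simp only: real_sqrt_mult real_sqrt_abs abs_of_pos)
qed

lemma Ymap_measurable [measurable]: "Ymap \<in> SG n \<rightarrow>\<^sub>M borel_vec n"
  by (rule measurable_borel_vecI) (auto simp: Ymap_def)

lemma sample_dist_eq: "sample_dist X \<theta> \<sigma> = distr (SG n) (borel_vec n) Ymap"
proof -
  let ?L = "\<sigma> \<cdot>\<^sub>m 1\<^sub>m n"
  have L: "?L \<in> carrier_mat n n" by simp
  have "?L * ?L\<^sup>T = \<sigma>\<^sup>2 \<cdot>\<^sub>m 1\<^sub>m n"
    by (intro eq_matI) (auto simp: scalar_prod_def power2_eq_square sum.delta if_distrib cong: if_cong)
  note g = gauss_eq[OF L this]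
  have m1: "(\<lambda>w. vec n (\<lambda>i. \<Sum>j<n. ?L $$ (i, j) * w j)) \<in> SG n \<rightarrow>\<^sub>M borel_vec n"
    by (rule measurable_borel_vecI) auto
  have m2: "(\<lambda>u. X *\<^sub>v \<theta> + u) \<in> borel_vec n \<rightarrow>\<^sub>M borel_vec n"
  proof (rule measurable_borel_vecI)
    fix i assume i: "i < n"
    have "(\<lambda>u. (X *\<^sub>v \<theta>) $ i + u $ i) \<in> borel_measurable (borel_vec n)" using i by measurable
    then show "(\<lambda>u. (X *\<^sub>v \<theta> + u) $ i) \<in> borel_measurable (borel_vec n)"
      by (rule measurable_cong[THEN iffD1, rotated]) (use i X in simp)
  qed (simp add: add_carrier_vec[OF mult_mat_vec_carrier[OF X \<theta>]])
  have "sample_dist X \<theta> \<sigma> = distr (distr (SG n) (borel_vec n) (\<lambda>w. vec n (\<lambda>i. \<Sum>j<n. ?L $$ (i, j) * w j))) (borel_vec n) (\<lambda>u. X *\<^sub>v \<theta> + u)"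
    using X g by (simp add: sample_dist_def Let_def)
  also have "\<dots> = distr (SG n) (borel_vec n) (\<lambda>w. X *\<^sub>v \<theta> + vec n (\<lambda>i. \<Sum>j<n. ?L $$ (i, j) * w j))"
    by (subst distr_distr[OF m2 m1]) (simp add: comp_def)
  also have "(\<lambda>w. X *\<^sub>v \<theta> + vec n (\<lambda>i. \<Sum>j<n. ?L $$ (i, j) * w j)) = Ymap"
  proof (rule ext, rule eq_vecI)
    fix w i assume "i < dim_vec (Ymap w)"
    then have i: "i < n" by (simp add: Ymap_def)
    have "(\<Sum>j<n. ?L $$ (i, j) * w j) = (\<Sum>j<n. if j = i then \<sigma> * w i else 0)"
      using i by (intro sum.cong refl) auto
    then show "(X *\<^sub>v \<theta> + vec n (\<lambda>i. \<Sum>j<n. ?L $$ (i, j) * w j)) $ i = Ymap w $ i"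
      using i X \<theta> by (simp add: Ymap_def scalar_prod_def atLeast0LessThan sum.delta)
  qed (simp add: Ymap_def)
  finally show ?thesis .
qed

end

text \<open>The smaller set may be nonmeasurable, in which case its measure is 0 by convention.\<close>

lemma measure_le_superset:
  assumes "finite_measure M" "B \<in> sets M" "A \<subseteq> B"
  shows "measure M A \<le> measure M B"
proof (cases "A \<in> sets M")
  case True
  then show ?thesis using finite_measure.finite_measure_mono[OF assms(1,3,2)] by simp
qed (simp add: measure_notin_sets)

lemma p0_props:
  assumes "\<theta> \<in> carrier_vec P"
  shows "p0 P \<theta> \<le> P" "\<And>i. p0 P \<theta> \<le> i \<Longrightarrow> i < P \<Longrightarrow> \<theta> $ i = 0"
    and "0 < p0 P \<theta> \<Longrightarrow> \<theta> $ (p0 P \<theta> - 1) \<noteq> 0"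
proof -
  define Z where "Z p \<longleftrightarrow> p \<le> P \<and> (\<forall>i. p \<le> i \<and> i < P \<longrightarrow> \<theta> $ i = 0)" for p
  have p0: "p0 P \<theta> = (LEAST p. Z p)" by (simp add: p0_def Z_def)
  have "Z P" by (simp add: Z_def)
  then have Z: "Z (p0 P \<theta>)" unfolding p0 by (rule LeastI)
  then show le: "p0 P \<theta> \<le> P" "\<And>i. p0 P \<theta> \<le> i \<Longrightarrow> i < P \<Longrightarrow> \<theta> $ i = 0" by (auto simp: Z_def)
  assume pos: "0 < p0 P \<theta>"
  show "\<theta> $ (p0 P \<theta> - 1) \<noteq> 0"
  proof
    assume 0: "\<theta> $ (p0 P \<theta> - 1) = 0"
    have "Z (p0 P \<theta> - 1)" unfolding Z_def
    proof (intro conjI allI impI)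
      fix i assume i: "p0 P \<theta> - 1 \<le> i \<and> i < P"
      show "\<theta> $ i = 0"
        using i 0 le(2)[of i] by (cases "i = p0 P \<theta> - 1") auto
    qed (use le in simp)
    then have "p0 P \<theta> \<le> p0 P \<theta> - 1" unfolding p0 by (rule Least_le)
    then show False using pos by simp
  qed
qed

context sample_design
begin

section \<open>Measurability of the estimators\<close>

lemma measurable_coord [measurable]: "(\<lambda>Y. coord Y q) \<in> borel_measurable (borel_vec n)"
  unfolding coord_def by measurable

lemma measurable_theta_restr:
  assumes "p \<le> P" "i < P"
  shows "(\<lambda>Y. theta_restr X Y p $ i) \<in> borel_measurable (borel_vec n)"
proof -
  have "(\<lambda>Y. (\<Sum>q<p. v i q * coord Y q) / sqrt n) \<in> borel_measurable (borel_vec n)" by measurable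
  then show ?thesis
    by (rule measurable_cong[THEN iffD1, rotated]) (use theta_restr_eq[OF assms] in simp)
qed

lemma measurable_sigma_hat [measurable]: "sigma_hat X \<in> borel_measurable (borel_vec n)"
proof -
  have [measurable]: "i < P \<Longrightarrow> (\<lambda>Y. theta_restr X Y P $ i) \<in> borel_measurable (borel_vec n)" for i
    by (rule measurable_theta_restr) auto
  have "(\<lambda>Y. sqrt ((\<Sum>l<n. (Y $ l - (\<Sum>i<P. X $$ (l, i) * theta_restr X Y P $ i)) * (Y $ l - (\<Sum>i<P. X $$ (l, i) * theta_restr X Y P $ i)))
      / (real n - real P))) \<in> borel_measurable (borel_vec n)"
    by measurable
  then show ?thesis
  proof (rule measurable_cong[THEN iffD1, rotated])
    fix Y assume "Y \<in> space (borel_vec n)"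
    then have Y: "Y \<in> carrier_vec n" by simp
    have t: "dim_vec (theta_restr X Y P) = P" using X by (simp add: theta_restr_def Let_def)
    have "(Y - X *\<^sub>v theta_restr X Y P) $ l = Y $ l - (\<Sum>i<P. X $$ (l, i) * theta_restr X Y P $ i)" if "l < n" for l
      using that X Y t by (simp add: scalar_prod_def atLeast0LessThan)
    then show "sqrt ((\<Sum>l<n. (Y $ l - (\<Sum>i<P. X $$ (l, i) * theta_restr X Y P $ i)) * (Y $ l - (\<Sum>i<P. X $$ (l, i) * theta_restr X Y P $ i)))
      / (real n - real P)) = sigma_hat X Y"
      using X by (simp add: sigma_hat_def Let_def scalar_prod_def atLeast0LessThan)
  qed
qed

lemma measurable_T_stat:
  assumes p: "p \<le> P"
  shows "(\<lambda>Y. T_stat X Y p) \<in> borel_measurable (borel_vec n)"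
proof (cases "p = 0")
  case True
  then show ?thesis by (simp add: T_stat_def)
next
  case False
  have "(\<lambda>Y. coord Y (p - 1) / sigma_hat X Y) \<in> borel_measurable (borel_vec n)" by measurable
  then show ?thesis
  proof (rule measurable_cong[THEN iffD1, rotated])
    fix Y assume "Y \<in> space (borel_vec n)"
    then show "coord Y (p - 1) / sigma_hat X Y = T_stat X Y p"
      by (intro T_stat_eq[symmetric]) (use False p in auto)
  qed
qed

lemma measurable_p_hat:
  "p_hat p_min c X \<in> borel_vec n \<rightarrow>\<^sub>M count_space UNIV"
proof -
  have "(\<lambda>Y. Max {p. p_min \<le> p \<and> p \<le> dim_col X \<and> c p \<le> \<bar>T_stat X Y p\<bar>}) \<in> borel_vec n \<rightarrow>\<^sub>M count_space UNIV"
  proof (rule measurable_Max_nat)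
    fix p
    show "Measurable.pred (borel_vec n) (\<lambda>Y. p_min \<le> p \<and> p \<le> dim_col X \<and> c p \<le> \<bar>T_stat X Y p\<bar>)"
    proof (cases "p \<le> P")
      case True
      note [measurable] = measurable_T_stat[OF True]
      show ?thesis by measurable
    qed (use X in simp)
  qed
  moreover have "p_hat p_min c X = (\<lambda>Y. Max {p. p_min \<le> p \<and> p \<le> dim_col X \<and> c p \<le> \<bar>T_stat X Y p\<bar>})"
    by (rule ext) (rule p_hat_def)
  ultimately show ?thesis by (simp only:)
qed

lemma p_hat_bounds:
  assumes "p_min < P" "c p_min = 0"
  shows "p_min \<le> p_hat p_min c X Y" "p_hat p_min c X Y \<le> P"
proof -
  let ?A = "{p. p_min \<le> p \<and> p \<le> dim_col X \<and> c p \<le> \<bar>T_stat X Y p\<bar>}"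
  have "finite ?A" by (rule finite_subset[of _ "{..dim_col X}"]) auto
  moreover have "p_min \<in> ?A" using assms X by simp
  ultimately have "Max ?A \<in> ?A" by (intro Max_in) auto
  then show "p_min \<le> p_hat p_min c X Y" "p_hat p_min c X Y \<le> P" using X by (auto simp: p_hat_def)
qed

definition scaled_error :: "real mat \<Rightarrow> nat \<Rightarrow> (nat \<Rightarrow> real) \<Rightarrow> real vec \<Rightarrow> real vec" where
  "scaled_error A p_min c Y = sqrt n \<cdot>\<^sub>v (A *\<^sub>v (theta_post p_min c X Y - \<theta>))"

lemma scaled_error_index:
  assumes A: "A \<in> carrier_mat k P" and a: "a < k"
  shows "scaled_error A p_min c Y $ a
    = (\<Sum>i<P. A $$ (a, i) * (sqrt n * (theta_restr X Y (p_hat p_min c X Y) $ i - \<theta> $ i)))"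
proof -
  have t: "dim_vec (theta_post p_min c X Y) = P" using X by (simp add: theta_post_def theta_restr_def Let_def)
  then show ?thesis using A a \<theta>
    by (simp add: scaled_error_def scalar_prod_def atLeast0LessThan theta_post_def sum_distrib_left mult_ac)
qed

lemma measurable_scaled_error:
  assumes A: "A \<in> carrier_mat k P" and pm: "p_min < P" "c p_min = 0"
  shows "scaled_error A p_min c \<in> borel_vec n \<rightarrow>\<^sub>M borel_vec k"
proof (rule measurable_borel_vecI)
  show "scaled_error A p_min c Y \<in> carrier_vec k" for Y
    by (rule carrier_vecI) (use A in \<open>simp add: scaled_error_def\<close>)
  fix a assume a: "a < k"
  note [measurable] = measurable_p_hat[of p_min c]
  have th: "(\<lambda>Y. theta_restr X Y (p_hat p_min c X Y) $ i) \<in> borel_measurable (borel_vec n)" if i: "i < P" for i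
  proof -
    have [measurable]: "p \<in> {..P} \<Longrightarrow> (\<lambda>Y. theta_restr X Y p $ i) \<in> borel_measurable (borel_vec n)" for p
      using measurable_theta_restr[OF _ i] by simp
    have "(\<lambda>Y. \<Sum>p\<in>{..P}. if p_hat p_min c X Y = p then theta_restr X Y p $ i else 0) \<in> borel_measurable (borel_vec n)"
      by measurable
    moreover have "(\<Sum>p\<in>{..P}. if p_hat p_min c X Y = p then theta_restr X Y p $ i else 0) = theta_restr X Y (p_hat p_min c X Y) $ i" for Y
      using p_hat_bounds(2)[where p_min=p_min and c=c and Y=Y, OF pm] by (simp add: sum.delta)
    ultimately show ?thesis by simp
  qed
  have "(\<lambda>Y. \<Sum>i<P. A $$ (a, i) * (sqrt n * (theta_restr X Y (p_hat p_min c X Y) $ i - \<theta> $ i))) \<in> borel_measurable (borel_vec n)"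
    using th by (intro borel_measurable_sum borel_measurable_times borel_measurable_diff borel_measurable_const) auto
  then show "(\<lambda>Y. scaled_error A p_min c Y $ a) \<in> borel_measurable (borel_vec n)"
    by (simp only: scaled_error_index[OF A a])
qed

lemma cdf_measure_G_fin:
  assumes A: "A \<in> carrier_mat k P" and pm: "p_min < P" "c p_min = 0"
  shows "cdf_measure k (G_fin p_min c A X \<theta> \<sigma>) = distr (SG n) (borel_vec k) (\<lambda>z. scaled_error A p_min c (Ymap z))"
proof -
  note m = measurable_scaled_error[where p_min=p_min and c=c, OF A pm]
  have m': "(\<lambda>z. scaled_error A p_min c (Ymap z)) \<in> SG n \<rightarrow>\<^sub>M borel_vec k"
    by (rule measurable_compose[OF Ymap_measurable m])
  show ?thesis
  proof (rule cdf_measure_eqI)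
    show "finite_measure (distr (SG n) (borel_vec k) (\<lambda>z. scaled_error A p_min c (Ymap z)))"
      by (rule finite_measure.finite_measure_distr[OF finite_measure_SG m'])
    fix t :: "real vec" assume t: "t \<in> carrier_vec k"
    have "{Y \<in> space (borel_vec n). scaled_error A p_min c Y \<le> t} = scaled_error A p_min c -` lower_set k t \<inter> space (borel_vec n)"
      using measurable_space[OF m] by auto
    then have S: "{Y \<in> space (borel_vec n). scaled_error A p_min c Y \<le> t} \<in> sets (borel_vec n)"
      using measurable_sets[OF m sets_lower_set[OF t]] by simp
    have "G_fin p_min c A X \<theta> \<sigma> t = measure (sample_dist X \<theta> \<sigma>) {Y \<in> space (borel_vec n). scaled_error A p_min c Y \<le> t}"
      using X by (simp add: G_fin_def sample_dist_eq scaled_error_def)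
    also have "\<dots> = measure (SG n) (Ymap -` {Y \<in> space (borel_vec n). scaled_error A p_min c Y \<le> t} \<inter> space (SG n))"
      unfolding sample_dist_eq by (rule measure_distr[OF Ymap_measurable S])
    also have "Ymap -` {Y \<in> space (borel_vec n). scaled_error A p_min c Y \<le> t} \<inter> space (SG n)
      = (\<lambda>z. scaled_error A p_min c (Ymap z)) -` lower_set k t \<inter> space (SG n)"
      using measurable_space[OF m'] measurable_space[OF Ymap_measurable] by auto
    also have "measure (SG n) \<dots> = measure (distr (SG n) (borel_vec k) (\<lambda>z. scaled_error A p_min c (Ymap z))) (lower_set k t)"
      by (rule measure_distr[OF m' sets_lower_set[OF t], symmetric])
    finally show "measure (distr (SG n) (borel_vec k) (\<lambda>z. scaled_error A p_min c (Ymap z))) (lower_set k t) = G_fin p_min c A X \<theta> \<sigma> t"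
      by simp
  qed simp
qed

section \<open>Coupling\<close>

text \<open>
  The ratio of the estimated variance to \<open>\<sigma>\<^sup>2\<close> deviates from 1 by the deviations of the two sums
  of squares from their means \<open>n\<close> and \<open>P\<close>, divided by \<open>n - P\<close>; taking the square root does not
  increase a deviation from 1.
\<close>

lemma sigma_hat_close:
  fixes z :: "nat \<Rightarrow> real"
  assumes a: "\<bar>(\<Sum>l<n. (z l)\<^sup>2) - n\<bar> < \<eta> * (real n - real P) / 2" "\<bar>(\<Sum>q<P. (W z q)\<^sup>2) - P\<bar> < \<eta> * (real n - real P) / 2"
  shows "\<bar>sigma_hat X (Ymap z) - \<sigma>\<bar> < \<eta> * \<sigma>"
proof -
  define d where "d = real n - real P"
  define \<rho> where "\<rho> = ((\<Sum>l<n. (z l)\<^sup>2) - (\<Sum>q<P. (W z q)\<^sup>2)) / d"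
  have d: "d > 0" using P by (simp add: d_def)
  have \<rho>0: "0 \<le> \<rho>" unfolding \<rho>_def residual_sum_of_squares[symmetric] using d by (intro divide_nonneg_pos sum_nonneg) auto
  have "\<rho> - 1 = (((\<Sum>l<n. (z l)\<^sup>2) - n) - ((\<Sum>q<P. (W z q)\<^sup>2) - P)) / d"
    using d unfolding \<rho>_def by (simp add: field_simps) (simp add: d_def)
  moreover have "\<bar>((\<Sum>l<n. (z l)\<^sup>2) - n) - ((\<Sum>q<P. (W z q)\<^sup>2) - P)\<bar> < \<eta> * d" using a unfolding d_def by linarith
  ultimately have "\<bar>\<rho> - 1\<bar> < \<eta>" using d by (simp add: abs_divide divide_less_eq)
  moreover have "\<bar>sqrt \<rho> - 1\<bar> \<le> \<bar>\<rho> - 1\<bar>"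
  proof -
    have "\<rho> - 1 = (sqrt \<rho> - 1) * (sqrt \<rho> + 1)" using \<rho>0 by (simp add: algebra_simps)
    then have "\<bar>\<rho> - 1\<bar> = \<bar>sqrt \<rho> - 1\<bar> * (sqrt \<rho> + 1)" using \<rho>0 by (simp add: abs_mult)
    moreover have "\<bar>sqrt \<rho> - 1\<bar> * 1 \<le> \<bar>sqrt \<rho> - 1\<bar> * (sqrt \<rho> + 1)" using \<rho>0 by (intro mult_left_mono) auto
    ultimately show ?thesis by simp
  qed
  ultimately have "\<sigma> * \<bar>sqrt \<rho> - 1\<bar> < \<sigma> * \<eta>" using \<sigma> by (intro mult_strict_left_mono) auto
  moreover have "sigma_hat X (Ymap z) - \<sigma> = \<sigma> * (sqrt \<rho> - 1)"
    unfolding sigma_hat_Ymap \<rho>_def d_def by (simp add: right_diff_distrib)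
  ultimately show ?thesis using \<sigma> by (simp add: abs_mult mult.commute)
qed

definition sample_tail :: "real \<Rightarrow> (nat \<Rightarrow> real) set" where
  "sample_tail \<eta> = {z \<in> space (SG n). \<eta> * (real n - real P) / 2 \<le> \<bar>(\<Sum>l<n. (z l)\<^sup>2) - n\<bar>}"

definition coord_tail :: "real \<Rightarrow> (nat \<Rightarrow> real) set" where
  "coord_tail a = {w \<in> space (SG P). a \<le> \<bar>(\<Sum>q<P. (w q)\<^sup>2) - P\<bar>}"

definition near_threshold :: "(nat \<Rightarrow> real) \<Rightarrow> real \<Rightarrow> nat \<Rightarrow> (nat \<Rightarrow> real) set" where
  "near_threshold c \<eta> p = {w \<in> space (SG P). w (p - 1) \<in> {x. \<bar>\<bar>x\<bar> - c p\<bar> \<le> \<eta> * \<bar>c p\<bar>}}"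

text \<open>
  The union of the events on which the coupling may fail: the variance estimator is off (two sums
  of squares), some coordinate is unusually large, or some coordinate is close to its critical
  value.
\<close>

definition exceptional :: "(nat \<Rightarrow> real) \<Rightarrow> real \<Rightarrow> real \<Rightarrow> (nat \<Rightarrow> real) set" where
  "exceptional c \<eta> a = sample_tail \<eta> \<union> {z \<in> space (SG n). (\<lambda>q\<in>{..<P}. W z q) \<in>
     coord_tail (\<eta> * (real n - real P) / 2) \<union> coord_tail a \<union> (\<Union>p\<in>{1..P}. near_threshold c \<eta> p)}"

lemma sets_tails [measurable]:
  "sample_tail \<eta> \<in> sets (SG n)" "coord_tail a \<in> sets (SG P)"
  "p \<in> {1..P} \<Longrightarrow> near_threshold c \<eta> p \<in> sets (SG P)"
proof -
  show "sample_tail \<eta> \<in> sets (SG n)" "coord_tail a \<in> sets (SG P)"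
    unfolding sample_tail_def coord_tail_def by measurable
  assume "p \<in> {1..P}"
  then have [measurable]: "(\<lambda>w. w (p - 1)) \<in> borel_measurable (SG P)" by (intro measurable_SG_component) auto
  show "near_threshold c \<eta> p \<in> sets (SG P)" unfolding near_threshold_def by measurable
qed

lemma exceptional_sets: "exceptional c \<eta> a \<in> sets (SG n)"
proof -
  have "coord_tail (\<eta> * (real n - real P) / 2) \<union> coord_tail a \<union> (\<Union>p\<in>{1..P}. near_threshold c \<eta> p) \<in> sets (SG P)"
    by (intro sets.Un sets.finite_UN sets_tails) auto
  from measurable_sets[OF measurable_restrict_W this] show ?thesis
    unfolding exceptional_def by (intro sets.Un sets_tails) (simp add: vimage_def Int_def conj_commute)
qed

lemma sample_tail_le:
  assumes "\<eta> > 0"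
  shows "measure (SG n) (sample_tail \<eta>) \<le> 8 / \<eta>\<^sup>2 * (real n / (real n - real P)\<^sup>2)"
    and "measure (SG P) (coord_tail (\<eta> * (real n - real P) / 2)) \<le> 8 / \<eta>\<^sup>2 * (real P / (real n - real P)\<^sup>2)"
proof -
  have d: "real n - real P > 0" using P by simp
  have pos: "\<eta> * (real n - real P) / 2 > 0" using assms d by simp
  have e: "2 * x / (\<eta> * (real n - real P) / 2)\<^sup>2 = 8 / \<eta>\<^sup>2 * (x / (real n - real P)\<^sup>2)" for x
    by (simp add: power_mult_distrib power_divide)
  show "measure (SG n) (sample_tail \<eta>) \<le> 8 / \<eta>\<^sup>2 * (real n / (real n - real P)\<^sup>2)"
    using chi_square_chebyshev[OF pos, of n] unfolding e sample_tail_def .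
  show "measure (SG P) (coord_tail (\<eta> * (real n - real P) / 2)) \<le> 8 / \<eta>\<^sup>2 * (real P / (real n - real P)\<^sup>2)"
    using chi_square_chebyshev[OF pos, of P] unfolding e coord_tail_def .
qed

lemma exceptional_le:
  assumes \<eta>: "\<eta> > 0" and a: "a > 0"
  shows "measure (SG n) (exceptional c \<eta> a) \<le>
    8 / \<eta>\<^sup>2 * ((real n + real P) / (real n - real P)\<^sup>2) + 2 * P / a\<^sup>2 + 4 * \<eta> * (\<Sum>p\<in>{1..P}. \<bar>c p\<bar>)"
proof -
  let ?B = "coord_tail (\<eta> * (real n - real P) / 2) \<union> coord_tail a \<union> (\<Union>p\<in>{1..P}. near_threshold c \<eta> p)"
  have N: "(\<Union>p\<in>{1..P}. near_threshold c \<eta> p) \<in> sets (SG P)" by (intro sets.finite_UN sets_tails) auto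
  have B: "?B \<in> sets (SG P)" using N by (intro sets.Un sets_tails)
  have C: "{z \<in> space (SG n). (\<lambda>q\<in>{..<P}. W z q) \<in> ?B} \<in> sets (SG n)"
    using measurable_sets[OF measurable_restrict_W B] by (simp add: vimage_def Int_def conj_commute)
  have near: "measure (SG P) (\<Union>p\<in>{1..P}. near_threshold c \<eta> p) \<le> (\<Sum>p\<in>{1..P}. 4 * (\<eta> * \<bar>c p\<bar>))"
  proof -
    have "measure (SG P) (\<Union>p\<in>{1..P}. near_threshold c \<eta> p) \<le> (\<Sum>p\<in>{1..P}. measure (SG P) (near_threshold c \<eta> p))"
      by (rule finite_measure.finite_measure_subadditive_finite[OF finite_measure_SG]) (auto intro: sets_tails)
    also have "\<dots> \<le> (\<Sum>p\<in>{1..P}. 4 * (\<eta> * \<bar>c p\<bar>))"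
    proof (rule sum_mono)
      fix p assume p: "p \<in> {1..P}"
      have "measure (SG P) (near_threshold c \<eta> p) = measure N01 {x. \<bar>\<bar>x\<bar> - c p\<bar> \<le> \<eta> * \<bar>c p\<bar>}"
        unfolding near_threshold_def using p by (intro measure_SG_component) auto
      also have "\<dots> \<le> 4 * (\<eta> * \<bar>c p\<bar>)" using \<eta> by (intro std_normal_band) simp
      finally show "measure (SG P) (near_threshold c \<eta> p) \<le> 4 * (\<eta> * \<bar>c p\<bar>)" .
    qed
    finally show ?thesis .
  qed
  have "measure (SG n) (exceptional c \<eta> a) \<le> measure (SG n) (sample_tail \<eta>) + measure (SG n) {z \<in> space (SG n). (\<lambda>q\<in>{..<P}. W z q) \<in> ?B}"
    unfolding exceptional_def by (rule measure_Un_le[OF sets_tails(1) C])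
  also have "measure (SG n) {z \<in> space (SG n). (\<lambda>q\<in>{..<P}. W z q) \<in> ?B} = measure (SG P) ?B" by (rule law_W[OF B])
  also have "measure (SG P) ?B \<le> measure (SG P) (coord_tail (\<eta> * (real n - real P) / 2)) + measure (SG P) (coord_tail a)
      + measure (SG P) (\<Union>p\<in>{1..P}. near_threshold c \<eta> p)"
    by (rule order_trans[OF measure_Un_le[OF sets.Un[OF sets_tails(2) sets_tails(2)] N] add_right_mono[OF measure_Un_le[OF sets_tails(2) sets_tails(2)]]])
  also have "measure (SG P) (coord_tail a) \<le> 2 * P / a\<^sup>2" using chi_square_chebyshev[OF a, of P] by (simp add: coord_tail_def)
  finally have "measure (SG n) (exceptional c \<eta> a) \<le> measure (SG n) (sample_tail \<eta>) + (measure (SG P) (coord_tail (\<eta> * (real n - real P) / 2))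
      + 2 * P / a\<^sup>2 + measure (SG P) (\<Union>p\<in>{1..P}. near_threshold c \<eta> p))" by simp
  moreover have "8 / \<eta>\<^sup>2 * (real n / (real n - real P)\<^sup>2) + 8 / \<eta>\<^sup>2 * (real P / (real n - real P)\<^sup>2) = 8 / \<eta>\<^sup>2 * ((real n + real P) / (real n - real P)\<^sup>2)"
    by (simp add: add_divide_distrib distrib_left)
  moreover have "(\<Sum>p\<in>{1..P}. 4 * (\<eta> * \<bar>c p\<bar>)) = 4 * \<eta> * (\<Sum>p\<in>{1..P}. \<bar>c p\<bar>)" by (simp add: sum_distrib_left mult_ac)
  ultimately show ?thesis using sample_tail_le[OF \<eta>] near by linarith
qed

text \<open>
  For orders above \<open>r\<close> the test statistic is \<open>\<sigma> W\<^sub>p\<^sub>-\<^sub>1\<close> divided by the estimated standard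
  deviation, and \<open>W\<^sub>p\<^sub>-\<^sub>1\<close> keeps a distance to the critical value that outweighs the estimation
  error. Order \<open>r\<close> itself passes its test: trivially if it is the smallest candidate, by
  assumption \<open>signal\<close> otherwise. Hence orders below \<open>r\<close> are never reached.
\<close>

lemma selection_coupling:
  fixes \<eta> a :: real
  assumes z: "z \<in> space (SG n)" "z \<notin> exceptional c \<eta> a" and \<eta>: "0 < \<eta>" "\<eta> < 1" and a: "a > 0"
    and pm: "p_min < P" "c p_min = 0" and c: "\<And>p. p_min < p \<Longrightarrow> p \<le> P \<Longrightarrow> c p > 0"
    and r: "r = max (p0 P \<theta>) p_min"
    and signal: "p_min < r \<Longrightarrow> \<sigma> * c r * (1 + \<eta>) + \<sigma> * sqrt (P + a) \<le> sqrt n * \<bar>\<theta> $ (r - 1)\<bar> / xi (gram X) r"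
  shows "p_hat p_min c X (Ymap z) = sel_order c P r (\<lambda>q\<in>{..<P}. W z q)"
proof -
  define w where "w = (\<lambda>q\<in>{..<P}. W z q)"
  define s where "s = sigma_hat X (Ymap z)"
  have ws: "w \<in> space (SG P)" by (simp add: w_def space_PiM)
  have sumw: "(\<Sum>q<P. (w q)\<^sup>2) = (\<Sum>q<P. (W z q)\<^sup>2)" by (simp add: w_def)
  have nz: "z \<notin> sample_tail \<eta>" "w \<notin> coord_tail (\<eta> * (real n - real P) / 2)" "w \<notin> coord_tail a"
    "\<And>p. p \<in> {1..P} \<Longrightarrow> w \<notin> near_threshold c \<eta> p"
    using z by (auto simp: exceptional_def w_def)
  have "\<bar>s - \<sigma>\<bar> < \<eta> * \<sigma>" unfolding s_def
    by (rule sigma_hat_close) (use nz(1,2) z(1) ws sumw in \<open>auto simp: sample_tail_def coord_tail_def\<close>)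
  then have s: "\<sigma> * (1 - \<eta>) < s" "s < \<sigma> * (1 + \<eta>)" by (auto simp: algebra_simps abs_less_iff)
  have s0: "s > 0" using s(1) \<sigma> \<eta> by (smt (verit) mult_pos_pos)
  have r': "p_min \<le> r" "p0 P \<theta> \<le> r" "r \<le> P" using r pm p0_props(1)[OF \<theta>] by auto
  have th0: "\<theta> $ i = 0" if "r \<le> i" "i < P" for i using p0_props(2)[OF \<theta>] that r'(2) by simp
  have T: "T_stat X (Ymap z) p = (\<sigma> * w (p - 1) + sqrt n * drift (p - 1)) / s" if "1 \<le> p" "p \<le> P" for p
  proof -
    have "p - 1 < P" using that by simp
    then have "w (p - 1) = W z (p - 1)" by (simp add: w_def)
    then show ?thesis using T_stat_eq[OF that Ymap_carrier, of z] by (simp only: coord_Ymap s_def)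
  qed
  have above: "c p \<le> \<bar>T_stat X (Ymap z) p\<bar> \<longleftrightarrow> c p \<le> \<bar>w (p - 1)\<bar>" if p: "r < p" "p \<le> P" for p
  proof -
    have cp: "c p > 0" using c p r' by simp
    have "drift (p - 1) = \<theta> $ (p - 1) / xi (gram X) (Suc (p - 1))"
      by (rule drift_eq) (use th0 p in auto)
    then have "drift (p - 1) = 0" using th0[of "p - 1"] p by simp
    then have "\<bar>T_stat X (Ymap z) p\<bar> = \<sigma> * \<bar>w (p - 1)\<bar> / s" using T[of p] p s0 \<sigma> by (simp add: abs_mult)
    then have 1: "c p \<le> \<bar>T_stat X (Ymap z) p\<bar> \<longleftrightarrow> c p * s \<le> \<sigma> * \<bar>w (p - 1)\<bar>" using s0 by (simp add: pos_le_divide_eq)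
    have "w \<notin> near_threshold c \<eta> p" using nz(4) p by simp
    then have "\<not> \<bar>\<bar>w (p - 1)\<bar> - c p\<bar> \<le> \<eta> * c p" using ws cp by (simp add: near_threshold_def)
    then have "\<bar>w (p - 1)\<bar> > c p * (1 + \<eta>) \<or> \<bar>w (p - 1)\<bar> < c p * (1 - \<eta>)"
      by (auto simp: algebra_simps abs_le_iff not_le)
    then consider "\<bar>w (p - 1)\<bar> > c p * (1 + \<eta>)" | "\<bar>w (p - 1)\<bar> < c p * (1 - \<eta>)" by blast
    then show ?thesis
    proof cases
      case 1
      have "c p * s \<le> c p * (\<sigma> * (1 + \<eta>))" using s(2) cp by (intro mult_left_mono) auto
      also have "\<dots> = \<sigma> * (c p * (1 + \<eta>))" by simp
      also have "\<dots> \<le> \<sigma> * \<bar>w (p - 1)\<bar>" using 1 \<sigma> by (intro mult_left_mono) auto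
      finally have "c p * s \<le> \<sigma> * \<bar>w (p - 1)\<bar>" .
      moreover have "c p \<le> c p * (1 + \<eta>)" using cp \<eta> by simp
      ultimately show ?thesis using \<open>c p \<le> \<bar>T_stat X (Ymap z) p\<bar> \<longleftrightarrow> c p * s \<le> \<sigma> * \<bar>w (p - 1)\<bar>\<close> 1 by linarith
    next
      case 2
      have "\<sigma> * \<bar>w (p - 1)\<bar> < \<sigma> * (c p * (1 - \<eta>))" using 2 \<sigma> by (intro mult_strict_left_mono) auto
      also have "\<dots> = c p * (\<sigma> * (1 - \<eta>))" by simp
      also have "\<dots> \<le> c p * s" using s(1) cp by (intro mult_left_mono) auto
      finally have "\<not> c p * s \<le> \<sigma> * \<bar>w (p - 1)\<bar>" by simp
      moreover have "c p * (1 - \<eta>) \<le> c p" using cp \<eta> by simp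
      ultimately show ?thesis using \<open>c p \<le> \<bar>T_stat X (Ymap z) p\<bar> \<longleftrightarrow> c p * s \<le> \<sigma> * \<bar>w (p - 1)\<bar>\<close> 2 by linarith
    qed
  qed
  have at: "c r \<le> \<bar>T_stat X (Ymap z) r\<bar>"
  proof (cases "p_min < r")
    case False
    then show ?thesis using r'(1) pm by simp
  next
    case True
    then have r1: "1 \<le> r" "r - 1 < P" "Suc (r - 1) = r" using r' by auto
    define x where "x = sqrt n * \<bar>\<theta> $ (r - 1)\<bar> / xi (gram X) r"
    have "\<bar>w (r - 1)\<bar> \<le> sqrt (P + a)"
    proof (rule real_le_rsqrt)
      have "(w (r - 1))\<^sup>2 \<le> (\<Sum>q<P. (w q)\<^sup>2)" using r1 by (intro member_le_sum) auto
      moreover have "(\<Sum>q<P. (w q)\<^sup>2) - P < a" using nz(3) ws by (auto simp: coord_tail_def)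
      ultimately show "\<bar>w (r - 1)\<bar>\<^sup>2 \<le> P + a" by simp
    qed
    then have sw: "\<sigma> * \<bar>w (r - 1)\<bar> \<le> \<sigma> * sqrt (P + a)" using \<sigma> by simp
    have "drift (r - 1) = \<theta> $ (r - 1) / xi (gram X) (Suc (r - 1))"
      by (rule drift_eq) (use th0 r1 in auto)
    then have "\<bar>sqrt n * drift (r - 1)\<bar> = x" using xi_pos[OF r1(2)] r1(3) by (simp add: x_def abs_mult)
    moreover have "\<bar>sqrt n * drift (r - 1)\<bar> - \<bar>\<sigma> * w (r - 1)\<bar> \<le> \<bar>\<sigma> * w (r - 1) + sqrt n * drift (r - 1)\<bar>" by linarith
    moreover have "\<bar>\<sigma> * w (r - 1)\<bar> = \<sigma> * \<bar>w (r - 1)\<bar>" using \<sigma> by (simp add: abs_mult)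
    ultimately have "\<sigma> * c r * (1 + \<eta>) \<le> \<bar>\<sigma> * w (r - 1) + sqrt n * drift (r - 1)\<bar>"
      using signal[OF True] sw unfolding x_def by linarith
    moreover have "c r * s \<le> c r * (\<sigma> * (1 + \<eta>))" using s(2) c[OF True r'(3)] by (intro mult_left_mono) auto
    moreover have "c r * (\<sigma> * (1 + \<eta>)) = \<sigma> * c r * (1 + \<eta>)" by simp
    ultimately have "c r * s \<le> \<bar>\<sigma> * w (r - 1) + sqrt n * drift (r - 1)\<bar>" by linarith
    then show ?thesis using T[OF r1(1) r'(3)] s0 by (simp add: abs_divide pos_le_divide_eq)
  qed
  \<comment> \<open>\<^const>\<open>p_hat\<close> ranges over all candidate orders, \<^const>\<open>sel_order\<close> over those from \<open>r\<close> on; as \<open>r\<close> passes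
    its test, the maxima agree.\<close>
  define m where "m = sel_order c P r w"
  have m: "r \<le> m" "m \<le> P" using sel_order_bounds[OF r'(3)] by (auto simp: m_def)
  have sel: "(r < m \<longrightarrow> c m \<le> \<bar>w (m - 1)\<bar>)" "\<And>q. m < q \<Longrightarrow> q \<le> P \<Longrightarrow> \<bar>w (q - 1)\<bar> < c q"
    using sel_order_eq_iff[OF m, of c w] by (auto simp: m_def)
  have "p_hat p_min c X (Ymap z) = m" unfolding p_hat_def
  proof (rule Max_eqI)
    show "finite {p. p_min \<le> p \<and> p \<le> dim_col X \<and> c p \<le> \<bar>T_stat X (Ymap z) p\<bar>}"
      by (rule finite_subset[of _ "{..dim_col X}"]) auto
    have "c m \<le> \<bar>T_stat X (Ymap z) m\<bar>" using at above[of m] sel(1) m by (cases "r < m") auto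
    then show "m \<in> {p. p_min \<le> p \<and> p \<le> dim_col X \<and> c p \<le> \<bar>T_stat X (Ymap z) p\<bar>}" using m r' X by auto
    fix q assume q: "q \<in> {p. p_min \<le> p \<and> p \<le> dim_col X \<and> c p \<le> \<bar>T_stat X (Ymap z) p\<bar>}"
    show "q \<le> m"
    proof (rule ccontr)
      assume "\<not> q \<le> m"
      then have "r < q" "m < q" "q \<le> P" using q m X by auto
      then show False using above[of q] sel(2)[of q] q by auto
    qed
  qed
  then show ?thesis by (simp add: m_def w_def)
qed

lemma scaled_error_coupling:
  fixes \<eta> a :: real
  assumes A: "A \<in> carrier_mat k P"
    and z: "z \<in> space (SG n)" "z \<notin> exceptional c \<eta> a" and \<eta>: "0 < \<eta>" "\<eta> < 1" and a: "a > 0"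
    and pm: "p_min < P" "c p_min = 0" and c: "\<And>p. p_min < p \<Longrightarrow> p \<le> P \<Longrightarrow> c p > 0"
    and r: "r = max (p0 P \<theta>) p_min"
    and signal: "p_min < r \<Longrightarrow> \<sigma> * c r * (1 + \<eta>) + \<sigma> * sqrt (P + a) \<le> sqrt n * \<bar>\<theta> $ (r - 1)\<bar> / xi (gram X) r"
  shows "scaled_error A p_min c (Ymap z)
    = selected_vec k (\<lambda>a q. \<sigma> * loading P A (gram X) a q) c P r (\<lambda>q\<in>{..<P}. W z q)"
proof (rule eq_vecI)
  let ?w = "\<lambda>q\<in>{..<P}. W z q"
  define m where "m = sel_order c P r ?w"
  have m: "p_hat p_min c X (Ymap z) = m"
    using selection_coupling[OF z \<eta> a pm c r signal] by (simp add: m_def)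
  have r': "p0 P \<theta> \<le> r" "r \<le> P" using r pm p0_props(1)[OF \<theta>] by auto
  have mb: "r \<le> m" "m \<le> P" using sel_order_bounds[OF r'(2)] by (auto simp: m_def)
  show "dim_vec (scaled_error A p_min c (Ymap z)) = dim_vec (selected_vec k (\<lambda>a q. \<sigma> * loading P A (gram X) a q) c P r ?w)"
    using A by (simp add: scaled_error_def selected_vec_def partial_sum_vec_def)
  fix b assume "b < dim_vec (selected_vec k (\<lambda>a q. \<sigma> * loading P A (gram X) a q) c P r ?w)"
  then have b: "b < k" by (simp add: selected_vec_def partial_sum_vec_def)
  have "scaled_error A p_min c (Ymap z) $ b = (\<Sum>i<P. A $$ (b, i) * (\<Sum>q<m. v i q * (\<sigma> * W z q)))"
    unfolding scaled_error_index[OF A b] m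
    by (intro sum.cong refl arg_cong2[where f="(*)"] theta_restr_Ymap) (use mb r' p0_props(2)[OF \<theta>] in auto)
  also have "\<dots> = (\<Sum>i<P. \<Sum>q<m. \<sigma> * (A $$ (b, i) * v i q) * W z q)" by (simp add: sum_distrib_left mult_ac)
  also have "\<dots> = (\<Sum>q<m. \<Sum>i<P. \<sigma> * (A $$ (b, i) * v i q) * W z q)" by (rule sum.swap)
  also have "\<dots> = (\<Sum>q<m. \<sigma> * loading P A (gram X) b q * ?w q)"
    using mb by (intro sum.cong refl) (simp add: loading_def sum_distrib_left sum_distrib_right mult_ac)
  finally show "scaled_error A p_min c (Ymap z) $ b = selected_vec k (\<lambda>a q. \<sigma> * loading P A (gram X) a q) c P r ?w $ b"
    using b by (simp add: selected_vec_def partial_sum_vec_def m_def)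
qed

lemma finite_sample_tv:
  fixes \<eta> a :: real
  assumes A: "A \<in> carrier_mat k P" and \<eta>: "0 < \<eta>" "\<eta> < 1" and a: "a > 0"
    and pm: "p_min < P" "c p_min = 0" and c: "\<And>p. p_min < p \<Longrightarrow> p \<le> P \<Longrightarrow> c p > 0"
    and r: "r = max (p0 P \<theta>) p_min"
    and signal: "p_min < r \<Longrightarrow> \<sigma> * c r * (1 + \<eta>) + \<sigma> * sqrt (P + a) \<le> sqrt n * \<bar>\<theta> $ (r - 1)\<bar> / xi (gram X) r"
    and E: "E \<in> sets (borel_vec k)"
  shows "\<bar>measure (cdf_measure k (G_fin p_min c A X \<theta> \<sigma>)) E
     - selected_prob k (\<lambda>a q. \<sigma> * loading P A (gram X) a q) c P r E\<bar>
    \<le> measure (SG n) (exceptional c \<eta> a)"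
proof -
  let ?sel = "selected_vec k (\<lambda>a q. \<sigma> * loading P A (gram X) a q) c P r"
  let ?w = "\<lambda>z. \<lambda>q\<in>{..<P}. W z q"
  have rP: "r \<le> P" using r pm p0_props(1)[OF \<theta>] by auto
  note ms = measurable_selected_vec[OF rP, of k "\<lambda>a q. \<sigma> * loading P A (gram X) a q" c]
  have me: "(\<lambda>z. scaled_error A p_min c (Ymap z)) \<in> SG n \<rightarrow>\<^sub>M borel_vec k"
    by (rule measurable_compose[OF Ymap_measurable measurable_scaled_error[where p_min=p_min and c=c, OF A pm]])
  define E1 where "E1 = {z \<in> space (SG n). scaled_error A p_min c (Ymap z) \<in> E}"
  define E2 where "E2 = {z \<in> space (SG n). ?sel (?w z) \<in> E}"
  have E1: "E1 \<in> sets (SG n)"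
    using measurable_sets[OF me E] by (simp add: E1_def vimage_def Int_def conj_commute)
  have E2: "E2 \<in> sets (SG n)"
    using measurable_sets[OF measurable_compose[OF measurable_restrict_W ms] E] by (simp add: E2_def vimage_def Int_def conj_commute)
  have S: "{w \<in> space (SG P). ?sel w \<in> E} \<in> sets (SG P)"
    using measurable_sets[OF ms E] by (simp add: vimage_def Int_def conj_commute)
  have 1: "measure (cdf_measure k (G_fin p_min c A X \<theta> \<sigma>)) E = measure (SG n) E1"
    unfolding cdf_measure_G_fin[where p_min=p_min and c=c, OF A pm]
    by (subst measure_distr[OF me E]) (auto simp: E1_def intro!: arg_cong[where f="measure (SG n)"])
  have 2: "measure (SG P) {w \<in> space (SG P). ?sel w \<in> E} = measure (SG n) E2"
    unfolding law_W[OF S, symmetric] E2_def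
    using measurable_space[OF measurable_restrict_W] by (intro arg_cong[where f="measure (SG n)"]) auto
  note X = exceptional_sets[of c \<eta> a]
  have eq: "scaled_error A p_min c (Ymap z) = ?sel (?w z)" if "z \<in> space (SG n)" "z \<notin> exceptional c \<eta> a" for z
    by (rule scaled_error_coupling[OF A that \<eta> a pm c r signal])
  have sub: "E1 \<subseteq> E2 \<union> exceptional c \<eta> a" "E2 \<subseteq> E1 \<union> exceptional c \<eta> a"
    unfolding E1_def E2_def using eq by auto
  have "measure (SG n) E1 \<le> measure (SG n) E2 + measure (SG n) (exceptional c \<eta> a)"
    by (rule order_trans[OF measure_le_superset[OF finite_measure_SG sets.Un[OF E2 X] sub(1)] measure_Un_le[OF E2 X]])
  moreover have "measure (SG n) E2 \<le> measure (SG n) E1 + measure (SG n) (exceptional c \<eta> a)"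
    by (rule order_trans[OF measure_le_superset[OF finite_measure_SG sets.Un[OF E1 X] sub(2)] measure_Un_le[OF E1 X]])
  ultimately show ?thesis unfolding 1 2 by linarith
qed

lemma sigma_hat_consistent:
  assumes \<eta>: "\<eta> > 0"
  shows "measure (sample_dist X \<theta> \<sigma>) {Y \<in> space (sample_dist X \<theta> \<sigma>). \<eta> * \<sigma> \<le> \<bar>sigma_hat X Y - \<sigma>\<bar>}
    \<le> 8 / \<eta>\<^sup>2 * ((real n + real P) / (real n - real P)\<^sup>2)"
proof -
  let ?C = "coord_tail (\<eta> * (real n - real P) / 2)"
  have S: "{Y \<in> space (borel_vec n). \<eta> * \<sigma> \<le> \<bar>sigma_hat X Y - \<sigma>\<bar>} \<in> sets (borel_vec n)" by measurable
  have C: "{z \<in> space (SG n). (\<lambda>q\<in>{..<P}. W z q) \<in> ?C} \<in> sets (SG n)"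
    using measurable_sets[OF measurable_restrict_W sets_tails(2)] by (simp add: vimage_def Int_def conj_commute)
  have "measure (sample_dist X \<theta> \<sigma>) {Y \<in> space (sample_dist X \<theta> \<sigma>). \<eta> * \<sigma> \<le> \<bar>sigma_hat X Y - \<sigma>\<bar>}
    = measure (SG n) (Ymap -` {Y \<in> space (borel_vec n). \<eta> * \<sigma> \<le> \<bar>sigma_hat X Y - \<sigma>\<bar>} \<inter> space (SG n))"
    unfolding sample_dist_eq space_distr by (rule measure_distr[OF Ymap_measurable S])
  also have "\<dots> \<le> measure (SG n) (sample_tail \<eta> \<union> {z \<in> space (SG n). (\<lambda>q\<in>{..<P}. W z q) \<in> ?C})"
  proof (rule measure_le_superset[OF finite_measure_SG sets.Un[OF sets_tails(1) C]])
    show "Ymap -` {Y \<in> space (borel_vec n). \<eta> * \<sigma> \<le> \<bar>sigma_hat X Y - \<sigma>\<bar>} \<inter> space (SG n)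
      \<subseteq> sample_tail \<eta> \<union> {z \<in> space (SG n). (\<lambda>q\<in>{..<P}. W z q) \<in> ?C}"
    proof
      fix z assume "z \<in> Ymap -` {Y \<in> space (borel_vec n). \<eta> * \<sigma> \<le> \<bar>sigma_hat X Y - \<sigma>\<bar>} \<inter> space (SG n)"
      then have z: "z \<in> space (SG n)" "\<not> \<bar>sigma_hat X (Ymap z) - \<sigma>\<bar> < \<eta> * \<sigma>" by auto
      then have "\<eta> * (real n - real P) / 2 \<le> \<bar>(\<Sum>l<n. (z l)\<^sup>2) - n\<bar> \<or> \<eta> * (real n - real P) / 2 \<le> \<bar>(\<Sum>q<P. (W z q)\<^sup>2) - P\<bar>"
        using sigma_hat_close[of z \<eta>] by linarith
      then show "z \<in> sample_tail \<eta> \<union> {z \<in> space (SG n). (\<lambda>q\<in>{..<P}. W z q) \<in> ?C}"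
        using z(1) by (auto simp: sample_tail_def coord_tail_def space_PiM)
    qed
  qed
  also have "\<dots> \<le> measure (SG n) (sample_tail \<eta>) + measure (SG P) ?C"
    using measure_Un_le[OF sets_tails(1) C] law_W[OF sets_tails(2)] by simp
  also have "\<dots> \<le> 8 / \<eta>\<^sup>2 * (real n / (real n - real P)\<^sup>2) + 8 / \<eta>\<^sup>2 * (real P / (real n - real P)\<^sup>2)"
    by (rule add_mono[OF sample_tail_le[OF \<eta>]])
  finally show ?thesis by (simp add: add_divide_distrib distrib_left)
qed

end

section \<open>Consistency of the estimated distribution\<close>

locale asymptotic_design =
  fixes P k p_min :: nat and X :: "nat \<Rightarrow> real mat" and Q A :: "real mat" and c :: "nat \<Rightarrow> real"
    and pbar :: "real vec \<Rightarrow> real mat \<Rightarrow> nat" and \<theta> :: "real vec" and \<sigma> :: real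
  assumes P: "1 \<le> P" and pm: "p_min < P"
    and X_dim: "\<And>n. n > P \<Longrightarrow> X n \<in> carrier_mat n P"
    and X_rank: "\<And>n. n > P \<Longrightarrow> vec_space.rank n (X n) = P"
    and Q_dim: "Q \<in> carrier_mat P P"
    and Q_lim: "\<And>i j. i < P \<Longrightarrow> j < P \<Longrightarrow>
       (\<lambda>n. ((1 / real n) \<cdot>\<^sub>m ((X n)\<^sup>T * X n)) $$ (i, j)) \<longlonglongrightarrow> Q $$ (i, j)"
    and Q_inv: "invertible_mat Q"
    and c_min: "c p_min = 0"
    and c_pos: "\<And>p. p_min < p \<Longrightarrow> p \<le> P \<Longrightarrow> c p > 0"
    and A: "A \<in> carrier_mat k P"
    and pbar_meas: "\<And>n. n > P \<Longrightarrow> (\<lambda>Y. pbar Y (X n)) \<in> borel_vec n \<rightarrow>\<^sub>M count_space UNIV"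
    and \<theta>: "\<theta> \<in> carrier_vec P" and \<sigma>: "\<sigma> > 0"
    and pbar_consistent: "(\<lambda>n. measure (sample_dist (X n) \<theta> \<sigma>)
          {Y \<in> space (sample_dist (X n) \<theta> \<sigma>). pbar Y (X n) = p0 P \<theta>}) \<longlonglongrightarrow> 1"
begin

text \<open>
  Designs are available for \<open>n > P\<close> only; the shifted index makes every member of the sequence a
  proper design.
\<close>

definition sample_size :: "nat \<Rightarrow> nat" where "sample_size m = m + Suc P"

abbreviation Xs :: "nat \<Rightarrow> real mat" where "Xs m \<equiv> X (sample_size m)"

lemma sample_size_gt: "P < sample_size m" by (simp add: sample_size_def)

sublocale design: sample_design P "sample_size m" "Xs m" \<theta> \<sigma> for m
  by unfold_locales (use P sample_size_gt X_dim X_rank \<theta> \<sigma> in auto)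

lemma gram_lim:
  assumes "i < P" "j < P"
  shows "(\<lambda>m. gram (Xs m) P $$ (i, j)) \<longlonglongrightarrow> Q $$ (i, j)"
proof -
  have "gram (Xs m) P = (1 / real (sample_size m)) \<cdot>\<^sub>m ((Xs m)\<^sup>T * Xs m)" for m
  proof -
    have "Xs m \<in> carrier_mat (sample_size m) P" by (rule X_dim[OF sample_size_gt])
    moreover from this have "first_cols P (Xs m) = Xs m" by (intro eq_matI) (auto simp: first_cols_def)
    ultimately show ?thesis by (simp add: gram_def)
  qed
  then show ?thesis using LIMSEQ_ignore_initial_segment[OF Q_lim[OF assms], of "Suc P"] by (simp add: sample_size_def)
qed

lemma Q_pos_def: "pos_def_mat P Q"
  by (rule limit_pos_def[OF design.R Q_dim Q_inv gram_lim])

sublocale limit: leading_blocks_target P Q "\<lambda>p. lead_block p Q" A k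
  by unfold_locales (use Q_pos_def A in auto)

definition r :: nat where "r = max (p0 P \<theta>) p_min"

lemma r_le: "r \<le> P" using p0_props(1)[OF \<theta>] pm by (simp add: r_def)

definition limit_law :: "real vec set \<Rightarrow> real" where
  "limit_law E = selected_prob k (\<lambda>a q. \<sigma> * loading P A (\<lambda>p. lead_block p Q) a q) c P r E"

definition plug_in_law :: "nat \<Rightarrow> real \<Rightarrow> real vec set \<Rightarrow> real" where
  "plug_in_law m s E = measure (SG P) {w \<in> space (SG P). selected_vec k (\<lambda>a q. s * loading P A (gram (Xs m)) a q) c P r w \<in> E}"

lemma measure_distr_selected:
  assumes "E \<in> sets (borel_vec k)"
  shows "measure (distr (SG P) (borel_vec k) (selected_vec k D c P r)) E
    = selected_prob k D c P r E"
  by (subst measure_distr[OF measurable_selected_vec[OF r_le] assms]) (auto intro!: arg_cong[where f="measure (SG P)"])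

lemma limit_law_eq:
  assumes "E \<in> sets (borel_vec k)"
  shows "measure (cdf_measure k (G_inf p_min c A Q \<theta> \<sigma>)) E = limit_law E"
proof -
  have "G_inf p_min c A Q \<theta> \<sigma> = G_expr c A (\<lambda>p. lead_block p Q) \<sigma> r"
    using Q_dim by (simp add: G_inf_def r_def fun_eq_iff)
  then show ?thesis
    using limit.cdf_measure_G_expr[OF \<sigma> r_le] measure_distr_selected[OF assms] by (simp add: limit_law_def)
qed

lemma plug_in_law_eq:
  assumes E: "E \<in> sets (borel_vec k)" and s: "sigma_hat (Xs m) Y > 0" and p: "pbar Y (Xs m) = p0 P \<theta>"
  shows "measure (cdf_measure k (G_check p_min c A pbar (Xs m) Y)) E = plug_in_law m (sigma_hat (Xs m) Y) E"
proof -
  interpret T: leading_blocks_target P "gram (Xs m) P" "gram (Xs m)" A k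
    by unfold_locales (rule A)
  have "G_check p_min c A pbar (Xs m) Y = G_expr c A (gram (Xs m)) (sigma_hat (Xs m) Y) r"
    using p by (simp add: G_check_def r_def fun_eq_iff)
  then show ?thesis
    using T.cdf_measure_G_expr[OF s r_le] measure_distr_selected[OF E] by (simp add: plug_in_law_def)
qed

lemma plug_in_law_uniform:
  assumes "\<delta> > 0"
  shows "\<exists>N. \<exists>\<rho>>0. \<forall>m\<ge>N. \<forall>s. \<bar>s - \<sigma>\<bar> < \<rho> \<longrightarrow> (\<forall>E\<in>sets (borel_vec k). \<bar>plug_in_law m s E - limit_law E\<bar> \<le> \<delta>)"
  unfolding plug_in_law_def limit_law_def
  by (rule selected_vec_tv_uniform[OF design.leading_blocks_axioms limit.leading_blocks_axioms gram_lim \<sigma> r_le assms])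

lemma ratio_tendsto_0: "(\<lambda>m. (real (sample_size m) + real P) / (real (sample_size m) - real P)\<^sup>2) \<longlonglongrightarrow> 0"
proof -
  have "(\<lambda>m::nat. (real m + (1 + 2 * real P)) / (real m + 1)\<^sup>2) \<longlonglongrightarrow> 0" by real_asymp
  moreover have "(real m + (1 + 2 * real P)) / (real m + 1)\<^sup>2 = (real (sample_size m) + real P) / (real (sample_size m) - real P)\<^sup>2" for m
    by (simp add: sample_size_def algebra_simps)
  ultimately show ?thesis by simp
qed

text \<open>
  If the true order exceeds the smallest candidate, its last coefficient is nonzero and its
  standardized size grows like \<open>sqrt n\<close>.
\<close>

lemma signal_eventually:
  assumes "p_min < r"
  shows "eventually (\<lambda>m. K \<le> sqrt (sample_size m) * \<bar>\<theta> $ (r - 1)\<bar> / xi (gram (Xs m)) r) sequentially"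
proof -
  have r0: "r = p0 P \<theta>" "0 < p0 P \<theta>" using assms by (auto simp: r_def max_def split: if_splits)
  have r1: "r - 1 < P" "Suc (r - 1) = r" using r_le r0 by auto
  have nz: "\<bar>\<theta> $ (r - 1)\<bar> > 0" using p0_props(3)[OF \<theta> r0(2)] r0(1) by simp
  have xl: "(\<lambda>m. xi (gram (Xs m)) r) \<longlonglongrightarrow> xi (\<lambda>p. lead_block p Q) r"
    using leading_blocks_tendsto(1)[OF design.leading_blocks_axioms limit.leading_blocks_axioms gram_lim r1(1)] r1(2) by simp
  have xp: "xi (\<lambda>p. lead_block p Q) r > 0" using limit.xi_pos[OF r1(1)] r1(2) by simp
  have "filterlim (\<lambda>m. \<bar>\<theta> $ (r - 1)\<bar> / xi (gram (Xs m)) r * sqrt (sample_size m)) at_top sequentially"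
  proof (rule filterlim_tendsto_pos_mult_at_top)
    show "(\<lambda>m. \<bar>\<theta> $ (r - 1)\<bar> / xi (gram (Xs m)) r) \<longlonglongrightarrow> \<bar>\<theta> $ (r - 1)\<bar> / xi (\<lambda>p. lead_block p Q) r"
      by (intro tendsto_divide tendsto_const xl) (use xp in simp)
    show "0 < \<bar>\<theta> $ (r - 1)\<bar> / xi (\<lambda>p. lead_block p Q) r" using nz xp by simp
    show "filterlim (\<lambda>m. sqrt (sample_size m)) at_top sequentially" unfolding sample_size_def by real_asymp
  qed
  then have "eventually (\<lambda>m. K \<le> \<bar>\<theta> $ (r - 1)\<bar> / xi (gram (Xs m)) r * sqrt (sample_size m)) sequentially"
    unfolding filterlim_at_top by blast
  then show ?thesis by (rule eventually_mono) (simp add: mult_ac)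
qed

text \<open>
  The probability of the exceptional event is made small term by term: \<open>\<eta>\<close> controls the bands
  around the critical values, \<open>a\<close> the size of the coordinates, and the sample size the rest.
\<close>

lemma finite_sample_law_tendsto:
  assumes \<delta>: "\<delta> > 0"
  shows "eventually (\<lambda>m. \<forall>E\<in>sets (borel_vec k).
    \<bar>measure (cdf_measure k (G_fin p_min c A (Xs m) \<theta> \<sigma>)) E - limit_law E\<bar> \<le> \<delta>) sequentially"
proof -
  \<comment> \<open>Each of the three terms in the bound on the exceptional event is at most \<open>\<delta> / 4\<close>; another \<open>\<delta> / 4\<close>
    accounts for replacing the finite-sample design by the limit.\<close>
  define C where "C = (\<Sum>p\<in>{1..P}. \<bar>c p\<bar>)"
  have C: "C \<ge> 0" by (simp add: C_def sum_nonneg)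
  define \<eta> where "\<eta> = min (1 / 2) (\<delta> / (16 * (C + 1)))"
  have \<eta>: "0 < \<eta>" "\<eta> < 1" using \<delta> C by (auto simp: \<eta>_def min_def)
  have \<eta>C: "4 * \<eta> * C \<le> \<delta> / 4"
  proof -
    have "\<eta> \<le> \<delta> / (16 * (C + 1))" by (simp add: \<eta>_def)
    then have "\<eta> * (16 * (C + 1)) \<le> \<delta>" using C by (simp add: pos_le_divide_eq)
    then show ?thesis using \<eta> C by (simp add: algebra_simps)
  qed
  define a where "a = sqrt (8 * P / \<delta>)"
  have a: "a > 0" "2 * P / a\<^sup>2 = \<delta> / 4" using P \<delta> by (auto simp: a_def)
  have "(\<lambda>m. 8 / \<eta>\<^sup>2 * ((real (sample_size m) + real P) / (real (sample_size m) - real P)\<^sup>2)) \<longlonglongrightarrow> 8 / \<eta>\<^sup>2 * 0"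
    by (intro tendsto_mult tendsto_const ratio_tendsto_0)
  then have ev1: "eventually (\<lambda>m. 8 / \<eta>\<^sup>2 * ((real (sample_size m) + real P) / (real (sample_size m) - real P)\<^sup>2) < \<delta> / 4) sequentially"
    using \<delta> by (intro order_tendstoD) auto
  define K where "K = \<sigma> * c r * (1 + \<eta>) + \<sigma> * sqrt (P + a)"
  have ev2: "eventually (\<lambda>m. p_min < r \<longrightarrow> K \<le> sqrt (sample_size m) * \<bar>\<theta> $ (r - 1)\<bar> / xi (gram (Xs m)) r) sequentially"
    using signal_eventually[of K] by (cases "p_min < r") auto
  have dpos: "\<delta> / 4 > 0" using \<delta> by simp
  obtain N \<rho> where Np: "\<rho> > 0" and "\<forall>m\<ge>N. \<forall>s. \<bar>s - \<sigma>\<bar> < \<rho> \<longrightarrow> (\<forall>E\<in>sets (borel_vec k). \<bar>plug_in_law m s E - limit_law E\<bar> \<le> \<delta> / 4)"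
    using plug_in_law_uniform[OF dpos] by blast
  then have Nb: "\<bar>plug_in_law m s E - limit_law E\<bar> \<le> \<delta> / 4"
    if "N \<le> m" "\<bar>s - \<sigma>\<bar> < \<rho>" "E \<in> sets (borel_vec k)" for m s E using that by blast
  show ?thesis using ev1 ev2 eventually_ge_at_top[of N]
  proof eventually_elim
    case (elim m)
    show ?case
    proof
      fix E assume E: "E \<in> sets (borel_vec k)"
      have "\<bar>measure (cdf_measure k (G_fin p_min c A (Xs m) \<theta> \<sigma>)) E - plug_in_law m \<sigma> E\<bar>
        \<le> measure (SG (sample_size m)) (design.exceptional m c \<eta> a)"
        unfolding plug_in_law_def
        by (rule design.finite_sample_tv[where p_min=p_min and c=c, OF A \<eta> a(1) pm c_min c_pos r_def _ E])
          (use elim(2) in \<open>auto simp: K_def\<close>)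
      also have "\<dots> \<le> 8 / \<eta>\<^sup>2 * ((real (sample_size m) + real P) / (real (sample_size m) - real P)\<^sup>2) + 2 * P / a\<^sup>2 + 4 * \<eta> * C"
        unfolding C_def by (rule design.exceptional_le[OF \<eta>(1) a(1)])
      also have "\<dots> \<le> \<delta> / 4 + \<delta> / 4 + \<delta> / 4" using elim(1) a(2) \<eta>C by linarith
      finally have "\<bar>measure (cdf_measure k (G_fin p_min c A (Xs m) \<theta> \<sigma>)) E - plug_in_law m \<sigma> E\<bar> \<le> \<delta> / 4 + \<delta> / 4 + \<delta> / 4" .
      moreover have "\<bar>plug_in_law m \<sigma> E - limit_law E\<bar> \<le> \<delta> / 4" using Nb[OF elim(3) _ E, of \<sigma>] Np by simp
      ultimately show "\<bar>measure (cdf_measure k (G_fin p_min c A (Xs m) \<theta> \<sigma>)) E - limit_law E\<bar> \<le> \<delta>" by linarith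
    qed
  qed
qed

text \<open>
  Both claims of the theorem are instances: all that matters of the target is that it approaches
  the limit law in total variation.
\<close>

lemma G_check_consistent_for:
  assumes \<delta>: "\<delta> > 0"
    and H: "\<And>\<epsilon>. \<epsilon> > 0 \<Longrightarrow> eventually (\<lambda>m. \<forall>E\<in>sets (borel_vec k). \<bar>measure (cdf_measure k (H (sample_size m))) E - limit_law E\<bar> \<le> \<epsilon>) sequentially"
  shows "(\<lambda>n. measure (sample_dist (X n) \<theta> \<sigma>)
      {Y \<in> space (sample_dist (X n) \<theta> \<sigma>). tv_dist k (G_check p_min c A pbar (X n) Y) (H n) > \<delta>}) \<longlonglongrightarrow> 0"
proof -
  define bad where "bad m = {Y \<in> space (sample_dist (Xs m) \<theta> \<sigma>). tv_dist k (G_check p_min c A pbar (Xs m) Y) (H (sample_size m)) > \<delta>}" for m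
  define wrong where "wrong m = {Y \<in> space (sample_dist (Xs m) \<theta> \<sigma>). pbar Y (Xs m) \<noteq> p0 P \<theta>}" for m
  have dpos: "\<delta> / 2 > 0" using \<delta> by simp
  obtain N \<rho> where Np: "\<rho> > 0" and "\<forall>m\<ge>N. \<forall>s. \<bar>s - \<sigma>\<bar> < \<rho> \<longrightarrow> (\<forall>E\<in>sets (borel_vec k). \<bar>plug_in_law m s E - limit_law E\<bar> \<le> \<delta> / 2)"
    using plug_in_law_uniform[OF dpos] by blast
  then have Nb: "\<bar>plug_in_law m s E - limit_law E\<bar> \<le> \<delta> / 2"
    if "N \<le> m" "\<bar>s - \<sigma>\<bar> < \<rho>" "E \<in> sets (borel_vec k)" for m s E using that by blast
  \<comment> \<open>The bound 1 keeps the estimated standard deviation positive.\<close>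
  define \<eta> where "\<eta> = min 1 (\<rho> / \<sigma>)"
  have \<eta>: "\<eta> > 0" "\<eta> * \<sigma> \<le> \<sigma>" "\<eta> * \<sigma> \<le> \<rho>" using Np \<sigma> by (auto simp: \<eta>_def min_def field_simps)
  define off where "off m = {Y \<in> space (sample_dist (Xs m) \<theta> \<sigma>). \<eta> * \<sigma> \<le> \<bar>sigma_hat (Xs m) Y - \<sigma>\<bar>}" for m
  have sd: "space (sample_dist (Xs m) \<theta> \<sigma>) = carrier_vec (sample_size m)" "sets (sample_dist (Xs m) \<theta> \<sigma>) = sets (borel_vec (sample_size m))"
    "prob_space (sample_dist (Xs m) \<theta> \<sigma>)" for m
    unfolding design.sample_dist_eq by (auto intro!: prob_space.prob_space_distr prob_space_SG design.Ymap_measurable)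
  have good_sets: "{Y \<in> space (sample_dist (Xs m) \<theta> \<sigma>). pbar Y (Xs m) = p0 P \<theta>} \<in> sets (sample_dist (Xs m) \<theta> \<sigma>)" for m
  proof -
    note [measurable] = pbar_meas[OF sample_size_gt[of m]]
    have "{Y \<in> space (borel_vec (sample_size m)). pbar Y (Xs m) = p0 P \<theta>} \<in> sets (borel_vec (sample_size m))" by measurable
    then show ?thesis by (simp add: sd)
  qed
  have wrong: "wrong m \<in> sets (sample_dist (Xs m) \<theta> \<sigma>)"
    "measure (sample_dist (Xs m) \<theta> \<sigma>) (wrong m) = 1 - measure (sample_dist (Xs m) \<theta> \<sigma>) {Y \<in> space (sample_dist (Xs m) \<theta> \<sigma>). pbar Y (Xs m) = p0 P \<theta>}" for m
  proof -
    have eq: "wrong m = space (sample_dist (Xs m) \<theta> \<sigma>) - {Y \<in> space (sample_dist (Xs m) \<theta> \<sigma>). pbar Y (Xs m) = p0 P \<theta>}"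
      by (auto simp: wrong_def)
    show "wrong m \<in> sets (sample_dist (Xs m) \<theta> \<sigma>)" unfolding eq by (rule sets.compl_sets[OF good_sets])
    show "measure (sample_dist (Xs m) \<theta> \<sigma>) (wrong m) = 1 - measure (sample_dist (Xs m) \<theta> \<sigma>) {Y \<in> space (sample_dist (Xs m) \<theta> \<sigma>). pbar Y (Xs m) = p0 P \<theta>}"
      unfolding eq by (rule prob_space.prob_compl[OF sd(3) good_sets])
  qed
  have off: "off m \<in> sets (sample_dist (Xs m) \<theta> \<sigma>)" for m
  proof -
    note [measurable] = design.measurable_sigma_hat[of m]
    have "{Y \<in> space (borel_vec (sample_size m)). \<eta> * \<sigma> \<le> \<bar>sigma_hat (Xs m) Y - \<sigma>\<bar>} \<in> sets (borel_vec (sample_size m))" by measurable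
    then show ?thesis by (simp add: off_def sd)
  qed
  have "(\<lambda>m. 1 - measure (sample_dist (Xs m) \<theta> \<sigma>) {Y \<in> space (sample_dist (Xs m) \<theta> \<sigma>). pbar Y (Xs m) = p0 P \<theta>}
      + 8 / \<eta>\<^sup>2 * ((real (sample_size m) + real P) / (real (sample_size m) - real P)\<^sup>2)) \<longlonglongrightarrow> 1 - 1 + 8 / \<eta>\<^sup>2 * 0"
    using LIMSEQ_ignore_initial_segment[OF pbar_consistent, of "Suc P"] unfolding sample_size_def[symmetric]
    by (intro tendsto_add tendsto_diff tendsto_mult tendsto_const ratio_tendsto_0)
  then have bound0: "(\<lambda>m. measure (sample_dist (Xs m) \<theta> \<sigma>) (wrong m) + 8 / \<eta>\<^sup>2 * ((real (sample_size m) + real P) / (real (sample_size m) - real P)\<^sup>2)) \<longlonglongrightarrow> 0"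
    by (simp add: wrong)
  have "(\<lambda>m. measure (sample_dist (Xs m) \<theta> \<sigma>) (bad m)) \<longlonglongrightarrow> 0"
  proof (rule tendsto_sandwich[OF _ _ tendsto_const bound0])
    show "eventually (\<lambda>m. 0 \<le> measure (sample_dist (Xs m) \<theta> \<sigma>) (bad m)) sequentially" by simp
    show "eventually (\<lambda>m. measure (sample_dist (Xs m) \<theta> \<sigma>) (bad m)
      \<le> measure (sample_dist (Xs m) \<theta> \<sigma>) (wrong m) + 8 / \<eta>\<^sup>2 * ((real (sample_size m) + real P) / (real (sample_size m) - real P)\<^sup>2)) sequentially"
      using H[OF dpos] eventually_ge_at_top[of N]
    proof (eventually_elim)
      case (elim m)
      have "bad m \<subseteq> wrong m \<union> off m"
      proof
        fix Y assume Y: "Y \<in> bad m"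
        show "Y \<in> wrong m \<union> off m"
        proof (rule ccontr)
          assume neg: "Y \<notin> wrong m \<union> off m"
          have p: "pbar Y (Xs m) = p0 P \<theta>" and s: "\<bar>sigma_hat (Xs m) Y - \<sigma>\<bar> < \<eta> * \<sigma>"
            using Y neg by (auto simp: bad_def wrong_def off_def)
          have s0: "sigma_hat (Xs m) Y > 0" and s1: "\<bar>sigma_hat (Xs m) Y - \<sigma>\<bar> < \<rho>"
            using s \<eta> by linarith+
          have "tv_dist k (G_check p_min c A pbar (Xs m) Y) (H (sample_size m)) \<le> \<delta>"
          proof (rule tv_dist_leI[OF refl refl])
            fix E assume E: "E \<in> sets (borel_vec k)"
            have "\<bar>plug_in_law m (sigma_hat (Xs m) Y) E - limit_law E\<bar> \<le> \<delta> / 2" by (rule Nb[OF elim(2) s1 E])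
            moreover have "\<bar>measure (cdf_measure k (H (sample_size m))) E - limit_law E\<bar> \<le> \<delta> / 2" using elim(1) E by blast
            ultimately show "\<bar>measure (cdf_measure k (G_check p_min c A pbar (Xs m) Y)) E - measure (cdf_measure k (H (sample_size m))) E\<bar> \<le> \<delta>"
              unfolding plug_in_law_eq[OF E s0 p] by linarith
          qed
          then show False using Y by (simp add: bad_def)
        qed
      qed
      then have "measure (sample_dist (Xs m) \<theta> \<sigma>) (bad m) \<le> measure (sample_dist (Xs m) \<theta> \<sigma>) (wrong m \<union> off m)"
        by (rule measure_le_superset[OF prob_space.finite_measure[OF sd(3)] sets.Un[OF wrong(1) off]])
      also have "\<dots> \<le> measure (sample_dist (Xs m) \<theta> \<sigma>) (wrong m) + measure (sample_dist (Xs m) \<theta> \<sigma>) (off m)"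
        by (rule measure_Un_le[OF wrong(1) off])
      also have "measure (sample_dist (Xs m) \<theta> \<sigma>) (off m) \<le> 8 / \<eta>\<^sup>2 * ((real (sample_size m) + real P) / (real (sample_size m) - real P)\<^sup>2)"
        unfolding off_def by (rule design.sigma_hat_consistent[OF \<eta>(1)])
      finally show ?case by simp
    qed
  qed
  then show ?thesis unfolding bad_def sample_size_def by (rule LIMSEQ_offset)
qed

end

theorem proposition2p2:
  fixes P k p_min :: nat
    and X :: "nat \<Rightarrow> real mat" and Q A :: "real mat"
    and c :: "nat \<Rightarrow> real"
    and pbar :: "real vec \<Rightarrow> real mat \<Rightarrow> nat"
  assumes "1 \<le> P" and "p_min < P"
    and X_dim: "\<And>n. n > P \<Longrightarrow> X n \<in> carrier_mat n P"
    and X_rank: "\<And>n. n > P \<Longrightarrow> vec_space.rank n (X n) = P"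
    and Q_dim: "Q \<in> carrier_mat P P"
    and Q_lim: "\<And>i j. i < P \<Longrightarrow> j < P \<Longrightarrow>
       (\<lambda>n. ((1 / real n) \<cdot>\<^sub>m ((X n)\<^sup>T * X n)) $$ (i, j)) \<longlonglongrightarrow> Q $$ (i, j)"
    and Q_inv: "invertible_mat Q"
    and c_min: "c p_min = 0"
    and c_pos: "\<And>p. p_min < p \<Longrightarrow> p \<le> P \<Longrightarrow> c p > 0"
    and k: "1 \<le> k" "k \<le> P"
    and A_dim: "A \<in> carrier_mat k P"
    and A_rank: "vec_space.rank k A = k"
    and pbar_meas: "\<And>n. n > P \<Longrightarrow> (\<lambda>Y. pbar Y (X n)) \<in> borel_vec n \<rightarrow>\<^sub>M count_space UNIV"
    and pbar_le: "\<And>n Y. n > P \<Longrightarrow> Y \<in> carrier_vec n \<Longrightarrow> pbar Y (X n) \<le> P"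
    and pbar_consistent: "\<And>\<theta> \<sigma>. \<theta> \<in> carrier_vec P \<Longrightarrow> \<sigma> > 0 \<Longrightarrow>
       (\<lambda>n. measure (sample_dist (X n) \<theta> \<sigma>)
          {Y \<in> space (sample_dist (X n) \<theta> \<sigma>). pbar Y (X n) = p0 P \<theta>}) \<longlonglongrightarrow> 1"
  shows "\<forall>\<theta> \<in> carrier_vec P. \<forall>\<sigma>>0. \<forall>\<delta>>0.
       (\<lambda>n. measure (sample_dist (X n) \<theta> \<sigma>)
          {Y \<in> space (sample_dist (X n) \<theta> \<sigma>).
             tv_dist k (G_check p_min c A pbar (X n) Y) (G_fin p_min c A (X n) \<theta> \<sigma>) > \<delta>})
         \<longlonglongrightarrow> 0 \<and>
       (\<lambda>n. measure (sample_dist (X n) \<theta> \<sigma>)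
          {Y \<in> space (sample_dist (X n) \<theta> \<sigma>).
             tv_dist k (G_check p_min c A pbar (X n) Y) (G_inf p_min c A Q \<theta> \<sigma>) > \<delta>})
         \<longlonglongrightarrow> 0"
proof (intro ballI allI impI conjI)
  fix \<theta> :: "real vec" and \<sigma> \<delta> :: real
  assume \<theta>: "\<theta> \<in> carrier_vec P" and \<sigma>: "0 < \<sigma>" and \<delta>: "0 < \<delta>"
  interpret asymptotic_design P k p_min X Q A c pbar \<theta> \<sigma>
    using assms \<theta> \<sigma> by unfold_locales auto
  show "(\<lambda>n. measure (sample_dist (X n) \<theta> \<sigma>)
          {Y \<in> space (sample_dist (X n) \<theta> \<sigma>).
             tv_dist k (G_check p_min c A pbar (X n) Y) (G_fin p_min c A (X n) \<theta> \<sigma>) > \<delta>}) \<longlonglongrightarrow> 0"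
    by (rule G_check_consistent_for[OF \<delta>]) (rule finite_sample_law_tendsto)
  show "(\<lambda>n. measure (sample_dist (X n) \<theta> \<sigma>)
          {Y \<in> space (sample_dist (X n) \<theta> \<sigma>).
             tv_dist k (G_check p_min c A pbar (X n) Y) (G_inf p_min c A Q \<theta> \<sigma>) > \<delta>}) \<longlonglongrightarrow> 0"
    by (rule G_check_consistent_for[OF \<delta>]) (simp add: limit_law_eq)
qed

end
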